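(* Let $e$ be an edge of the tiling of the hyperbolic disc by ideal pentagons, with endpoints $p$ and $q$ (periodic directions), so that $e$ is a side of a pentagon $Q$ of some generation $k\ge 0$ and of exactly one pentagon $Q'$ of the next generation $k+1$. Let $a,A$ be the short and the long cyclic symbolic orbits of the direction $p$, and let $b,B$ be the short and the long cyclic symbolic orbits of the direction $q$. Let $r_1,r_2,r_3$ be the three vertices of $Q'$ other than $p,q$, listed in the direction from $p$ to $q$ (so that $p,r_1,r_2,r_3,q$ are the consecutive vertices of $Q'$). Then one can cut the cyclic words $a,A,b,B$ into linear words (still denoted $a,A,b,B$; the same four linear words are used throughout) such that the short and long cyclic symbolic orbits of $r_1,r_2,r_3$ are obtained by closing up to cyclic words the following concatenations: $$\begin{array}{lll} r_1: & \text{short } bA, & \text{long } BaA;\\ r_2: & \text{short } AB, & \text{long } bBaA;\\ r_3: & \text{short } aB, & \text{long } AbB.\end{array}$$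
   Context: Double pentagon. Let $P$ be a regular pentagon in the plane with a horizontal bottom side, and let $-P$ be a centrally symmetric copy of it. Each side of $P$ is glued by a parallel translation to the side of $-P$ parallel to it. The result is a closed translation surface of genus $2$ with one conical singularity. The five pairs of glued sides are labeled by $1,2,3,4,5$: going counterclockwise around $P$ from the bottom side, the labels are $3,5,2,4,1$; equivalently, the side labeled $k$ has direction making angle $(k-3)\pi/5 \pmod \pi$ with the horizontal. Directions. Opposite directions are identified, so the set of directions is $\mathbb{RP}^1$. It is identified with the circle at infinity of the Poincaré disc by sending the direction at angle $\theta$ to $e^{2i\theta}$. A direction is called periodic if linear trajectories (straight geodesics) in this direction on the double pentagon are closed; if one is closed, then all non-singular ones in that direction are, and they form exactly two strips (maximal families of parallel closed trajectories, i.e. cylinders), whose closures cover the surface. One strip consists of longer and the other of shorter (in geometric length) trajectories. Symbolic orbits. The symbolic orbit of a strip is the cyclic word in the symbols $1,\dots,5$ consisting of the labels of the sides consecutively crossed during one full traversal of a closed trajectory of the strip. (It does not depend on the choice of trajectory in the strip, nor on the choice of orientation, because the central symmetry exchanging $P$ and $-P$ preserves labels and maps each strip to itself reversing direction.) The short (long) symbolic orbit of a periodic direction is the symbolic orbit of its shorter (longer) strip. For example, for the direction parallel to side $1$ the short orbit is $25$ and the long orbit is $43$; for the direction parallel to side $5$ the short orbit is $41$ and the long orbit is $23$. Tiling. The directions of the five sides of $P$ are five points on the circle at infinity; they are the vertices of a regular ideal pentagon, called the pentagon of generation $0$. Successive reflections in sides tile the hyperbolic plane by ideal pentagons: the pentagons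 of generation $k+1$ are the reflections of pentagons of generation $k$ in those of their sides that are not shared with a pentagon of generation $k-1$. Every edge of the tiling is shared by one pentagon of some generation $k$ and one of generation $k+1$. The vertices of this tiling are exactly the periodic directions. To cut a cyclic word into a linear word means to choose a linear word whose closing up (identification up to cyclic rotation) is the given cyclic word. *)

theory Defs
  imports "HOL-Analysis.Analysis"
begin

section \<open>The double pentagon\<close>

text \<open>
  The pentagon has circumradius 1 and centre 0; the side from vertex 0 to vertex 1 is the
  horizontal bottom one. Vertices and sides are indexed counterclockwise (modulo 5).
\<close>

definition vertex :: "nat \<Rightarrow> complex" where
  "vertex j = cis (2 * pi * real j / 5 - 7 * pi / 10)"

definition side :: "nat \<Rightarrow> complex set" where
  "side j = closed_segment (vertex j) (vertex (Suc j))"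

definition side_label :: "nat \<Rightarrow> nat" where
  "side_label j = [3, 5, 2, 4, 1] ! j"

definition pentagon :: "complex set" where
  "pentagon = convex hull (vertex ` {..<5})"

text \<open>The sheet \<open>True\<close> is \<open>P\<close>, the sheet \<open>False\<close> is \<open>-P\<close>.\<close>

definition polygon :: "bool \<Rightarrow> complex set" where
  "polygon \<epsilon> = (if \<epsilon> then pentagon else uminus ` pentagon)"

definition sheets :: "(bool \<times> complex) set" where
  "sheets = Sigma UNIV polygon"

text \<open>
  The side of \<open>-P\<close> parallel to side \<open>j\<close> of \<open>P\<close> joins \<open>- vertex j\<close> to \<open>- vertex (Suc j)\<close>. The
  translation taking side \<open>j\<close> onto it sends \<open>vertex j\<close> to \<open>- vertex (Suc j)\<close> and
  \<open>vertex (Suc j)\<close> to \<open>- vertex j\<close>.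
\<close>

inductive glued :: "bool \<times> complex \<Rightarrow> bool \<times> complex \<Rightarrow> bool" where
  "j < 5 \<Longrightarrow> z \<in> side j \<Longrightarrow> glued (True, z) (False, z - (vertex j + vertex (Suc j)))"

type_synonym surface_point = "(bool \<times> complex) set"

definition point :: "bool \<times> complex \<Rightarrow> surface_point" where
  "point x = {y. equivclp glued x y}"

definition surface :: "surface_point set" where
  "surface = point ` sheets"

text \<open>All ten polygon vertices represent the same point, the conical singularity.\<close>

definition cone_point :: surface_point where
  "cone_point = point (True, vertex 0)"

definition surface_topology :: "surface_point topology" where
  "surface_topology =
     topology (\<lambda>U. U \<subseteq> surface \<and> openin (top_of_set sheets) {x \<in> sheets. point x \<in> U})"

lemma openin_surface_topology:
  "openin surface_topology U \<longleftrightarrow>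
     U \<subseteq> surface \<and> openin (top_of_set sheets) {x \<in> sheets. point x \<in> U}"
proof -
  have "istopology (\<lambda>U. U \<subseteq> surface \<and> openin (top_of_set sheets) {x \<in> sheets. point x \<in> U})"
    unfolding istopology_def
  proof (intro conjI allI impI; (elim conjE)?)
    fix S T
    assume "openin (top_of_set sheets) {x \<in> sheets. point x \<in> S}"
      "openin (top_of_set sheets) {x \<in> sheets. point x \<in> T}"
    then have "openin (top_of_set sheets)
        ({x \<in> sheets. point x \<in> S} \<inter> {x \<in> sheets. point x \<in> T})"
      by blast
    moreover have "{x \<in> sheets. point x \<in> S} \<inter> {x \<in> sheets. point x \<in> T} =
        {x \<in> sheets. point x \<in> S \<inter> T}"
      by auto
    ultimately show "openin (top_of_set sheets) {x \<in> sheets. point x \<in> S \<inter> T}"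
      by simp
  next
    fix \<K>
    assume *: "\<forall>K\<in>\<K>. K \<subseteq> surface \<and> openin (top_of_set sheets) {x \<in> sheets. point x \<in> K}"
    then have "openin (top_of_set sheets) (\<Union>K\<in>\<K>. {x \<in> sheets. point x \<in> K})"
      by blast
    moreover have "(\<Union>K\<in>\<K>. {x \<in> sheets. point x \<in> K}) = {x \<in> sheets. point x \<in> \<Union>\<K>}"
      by auto
    ultimately show "openin (top_of_set sheets) {x \<in> sheets. point x \<in> \<Union>\<K>}"
      by simp
  qed auto
  then show ?thesis
    unfolding surface_topology_def by (simp add: topology_inverse')
qed

lemma topspace_surface_topology [simp]: "topspace surface_topology = surface"
proof -
  have "{x \<in> sheets. point x \<in> surface} = sheets"
    by (auto simp: surface_def)
  then have "openin surface_topology surface"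
    by (simp add: openin_surface_topology)
  then show ?thesis
    by (metis openin_subset openin_surface_topology openin_topspace subset_antisym)
qed

lemma quotient_map_point: "quotient_map (top_of_set sheets) surface_topology point"
  by (auto simp: quotient_map_def openin_surface_topology surface_def)


section \<open>Closed trajectories, strips and symbolic orbits\<close>

text \<open>
  A non-singular trajectory with unit velocity \<open>u\<close> avoids the conical singularity and is, on both
  sides of every time \<open>t\<close>, locally a straight motion inside one of the two polygons (which may
  differ before and after \<open>t\<close> when \<open>\<gamma> t\<close> lies on a side).
\<close>

definition trajectory :: "complex \<Rightarrow> (real \<Rightarrow> surface_point) \<Rightarrow> bool" where
  "trajectory u \<gamma> \<longleftrightarrow> cmod u = 1 \<and>
     (\<forall>t. \<gamma> t \<noteq> cone_point \<and>
       (\<exists>\<delta>>0. \<exists>\<epsilon> z. \<forall>s\<in>{0..<\<delta>}. z + s *\<^sub>R u \<in> polygon \<epsilon> \<and> \<gamma> (t + s) = point (\<epsilon>, z + s *\<^sub>R u)) \<and>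
       (\<exists>\<delta>>0. \<exists>\<epsilon> z. \<forall>s\<in>{-\<delta><..0}. z + s *\<^sub>R u \<in> polygon \<epsilon> \<and> \<gamma> (t + s) = point (\<epsilon>, z + s *\<^sub>R u)))"

text \<open>
  The direction at angle \<open>\<theta>\<close> is the point \<open>p = exp (2 \<i> \<theta>)\<close> of the unit circle, so the two unit
  vectors \<open>u\<close> of direction \<open>p\<close> are the solutions of \<open>u\<^sup>2 = p\<close>.
\<close>

definition closed_trajectory :: "complex \<Rightarrow> (real \<Rightarrow> surface_point) \<Rightarrow> bool" where
  "closed_trajectory p \<gamma> \<longleftrightarrow>
     (\<exists>u. u\<^sup>2 = p \<and> trajectory u \<gamma>) \<and> (\<exists>T>0. \<forall>t. \<gamma> (t + T) = \<gamma> t)"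

text \<open>Trajectories have unit speed: the length is the least period.\<close>

definition traj_length :: "(real \<Rightarrow> surface_point) \<Rightarrow> real" where
  "traj_length \<gamma> = Inf {T. T > 0 \<and> (\<forall>t. \<gamma> (t + T) = \<gamma> t)}"

definition on_side :: "surface_point \<Rightarrow> nat \<Rightarrow> bool" where
  "on_side x k \<longleftrightarrow> (\<exists>j<5. k = side_label j \<and> (\<exists>z\<in>side j. (True, z) \<in> x))"

definition crossing_word :: "(real \<Rightarrow> surface_point) \<Rightarrow> nat list" where
  "crossing_word \<gamma> =
     map (\<lambda>t. THE k. on_side (\<gamma> t) k)
       (sorted_list_of_set {t \<in> {0..<traj_length \<gamma>}. \<exists>k. on_side (\<gamma> t) k})"

text \<open>A cyclic word is the set of all linear words that close up to it.\<close>

definition cyclic_word :: "'a list \<Rightarrow> 'a list set" where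
  "cyclic_word w = {rotate n w | n. True}"

text \<open>
  Strips are open cylinders, as sets of points: different ones are separated by singular
  trajectories.
\<close>

definition strips :: "complex \<Rightarrow> surface_point set set" where
  "strips p = connected_components_of
     (subtopology surface_topology (\<Union>{range \<gamma> | \<gamma>. closed_trajectory p \<gamma>}))"

definition strip_length :: "complex \<Rightarrow> surface_point set \<Rightarrow> real" where
  "strip_length p S = (THE l. \<exists>\<gamma>. closed_trajectory p \<gamma> \<and> range \<gamma> \<subseteq> S \<and> l = traj_length \<gamma>)"

definition symbolic_orbit :: "complex \<Rightarrow> surface_point set \<Rightarrow> nat list set" where
  "symbolic_orbit p S =
     (THE c. \<exists>\<gamma>. closed_trajectory p \<gamma> \<and> range \<gamma> \<subseteq> S \<and> c = cyclic_word (crossing_word \<gamma>))"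

definition short_strip :: "complex \<Rightarrow> surface_point set" where
  "short_strip p = (THE S. \<exists>L. strips p = {S, L} \<and> strip_length p S < strip_length p L)"

definition long_strip :: "complex \<Rightarrow> surface_point set" where
  "long_strip p = (THE L. \<exists>S. strips p = {S, L} \<and> strip_length p S < strip_length p L)"

definition short_orbit :: "complex \<Rightarrow> nat list set" where
  "short_orbit p = symbolic_orbit p (short_strip p)"

definition long_orbit :: "complex \<Rightarrow> nat list set" where
  "long_orbit p = symbolic_orbit p (long_strip p)"


section \<open>The tiling of the hyperbolic disc by ideal pentagons\<close>

text \<open>
  Reflection of the closed Poincare disc in the geodesic with ideal endpoints \<open>p \<noteq> q\<close>: the
  Euclidean reflection in the diameter if \<open>q = - p\<close>, and otherwise the inversion in the circle
  through \<open>p\<close> and \<open>q\<close> orthogonal to the unit circle, which has centre \<open>c = 2 p q / (p + q)\<close> and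
  squared radius \<open>\<bar>c\<bar>\<^sup>2 - 1\<close>.
\<close>

definition hyp_reflection :: "complex \<Rightarrow> complex \<Rightarrow> complex \<Rightarrow> complex" where
  "hyp_reflection p q z =
     (if p + q = 0 then p\<^sup>2 * cnj z
      else let c = 2 * p * q / (p + q)
           in c + of_real ((cmod c)\<^sup>2 - 1) / cnj (z - c))"

text \<open>
  An ideal pentagon is given by the list of its consecutive ideal vertices, and a geodesic by the
  set of its two ideal endpoints.
\<close>

definition sides :: "complex list \<Rightarrow> complex set set" where
  "sides Q = {{Q ! i, Q ! (Suc i mod length Q)} | i. i < length Q}"

definition consecutive_vertices :: "complex list \<Rightarrow> complex list \<Rightarrow> bool" where
  "consecutive_vertices Q vs \<longleftrightarrow> vs \<in> cyclic_word Q \<or> vs \<in> cyclic_word (rev Q)"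

definition side_direction :: "nat \<Rightarrow> complex" where
  "side_direction k = cis (2 * ((real k - 3) * pi / 5))"

lemma side_direction_side_label:
  assumes "j < 5"
  shows "side_direction (side_label j) = (sgn (vertex (Suc j) - vertex j))\<^sup>2"
proof -
  have s: "sin (pi / 5) > 0"
    by (intro sin_gt_zero) auto
  have e: "cis x - cis y = of_real (2 * sin ((x - y) / 2)) * cis ((x + y) / 2 + pi / 2)" for x y
  proof -
    have "cos x - cos y = - (2 * sin ((x - y) / 2) * sin ((x + y) / 2))"
      unfolding cos_diff_cos using sin_minus[of "(x - y) / 2"]
      by (simp add: minus_divide_left)
    moreover have "sin x - sin y = 2 * sin ((x - y) / 2) * cos ((x + y) / 2)"
      by (rule sin_diff_sin)
    ultimately show ?thesis
      by (simp add: complex_eq_iff cos_add sin_add)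
  qed
  have "vertex (Suc j) - vertex j = of_real (2 * sin (pi / 5)) * cis (2 * pi * real j / 5)"
    unfolding vertex_def e by (simp add: field_simps)
  then have "sgn (vertex (Suc j) - vertex j) = cis (2 * pi * real j / 5)"
    using s by (simp add: sgn_mult sgn_eq norm_mult del: of_real_mult)
  then have *: "(sgn (vertex (Suc j) - vertex j))\<^sup>2 = cis (4 * pi * real j / 5)"
    by (simp add: power2_eq_square cis_mult mult.assoc)
  have "\<exists>n::int. 2 * ((real (side_label j) - 3) * pi / 5) + 2 * pi * n = 4 * pi * real j / 5"
  proof -
    consider "j = 0" | "j = 1" | "j = 2" | "j = 3" | "j = 4"
      using assms by linarith
    then show ?thesis
    proof cases
      case 1 then show ?thesis by (intro exI[of _ 0]) (simp add: side_label_def)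
    next
      case 2 then show ?thesis by (intro exI[of _ 0]) (simp add: side_label_def)
    next
      case 3 then show ?thesis by (intro exI[of _ 1]) (simp add: side_label_def field_simps)
    next
      case 4 then show ?thesis by (intro exI[of _ 1]) (simp add: side_label_def field_simps)
    next
      case 5 then show ?thesis by (intro exI[of _ 2]) (simp add: side_label_def field_simps)
    qed
  qed
  then obtain n :: int
    where n: "2 * ((real (side_label j) - 3) * pi / 5) + 2 * pi * n = 4 * pi * real j / 5" ..
  have "side_direction (side_label j) = side_direction (side_label j) * cis (2 * pi * n)"
    by (simp add: cis_multiple_2pi)
  also have "\<dots> = cis (4 * pi * real j / 5)"
    unfolding side_direction_def cis_mult n ..
  finally show ?thesis
    using * by simp
qed

text \<open>The reflections of the pentagons in \<open>\<Q>\<close> in those of their sides that are not in \<open>E\<close>.\<close>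

definition reflected :: "complex list set \<Rightarrow> complex set set \<Rightarrow> complex list set" where
  "reflected \<Q> E =
     {map (hyp_reflection p q) Q | Q p q. Q \<in> \<Q> \<and> {p, q} \<in> sides Q \<and> {p, q} \<notin> E}"

fun pentagons :: "nat \<Rightarrow> complex list set" where
  "pentagons 0 = {map side_direction [1, 2, 3, 4, 5]}"
| "pentagons (Suc 0) = reflected (pentagons 0) {}"
| "pentagons (Suc (Suc k)) = reflected (pentagons (Suc k)) (\<Union>(sides ` pentagons k))"

end

theory Submission
  imports Defs
begin

text \<open>
  Let \<open>h\<close> and \<open>g\<close> be vectors in the directions of the two ends of an edge of the tiling, scaled to be
  the holonomies of the short cylinders; the long ones have holonomies \<open>phi h\<close> and \<open>phi g\<close>. The double
  pentagon can be cut and reglued to an L-shaped table made of three parallelograms with sides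
  parallel to \<open>h\<close> and \<open>g\<close>, whose four pairs of glued sides carry the linear words \<open>a, A, b, B\<close>.
  No side of the pentagon points into the cone between \<open>h\<close> and \<open>g\<close>, so a trajectory with direction
  in the cone that leaves the table through a given side crosses exactly the sides of the pentagon
  listed in its word. Cutting and regluing the table as in Rauzy induction yields the tables of the
  four edges beyond the given one, with words concatenated from \<open>a, A, b, B\<close>; this gives the formulas
  for \<open>r\<^sub>1, r\<^sub>2, r\<^sub>3\<close>.

  A table is described by finitely many inequalities, which survive regluing because the cones
  shrink. To see that its words are the symbolic orbits, note that in direction \<open>h\<close> they provide two
  cylinders which fill every side of the pentagon. That they do not overlap is arithmetic: the ratio
  of their holonomies is irrational, and \<open>h\<close> is indivisible in the lattice of all holonomies.

  In the projective line of directions, the reflection in the edge is the map that changes the sign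
  of \<open>g\<close> in the basis \<open>h, g\<close>, so the new vertices are spanned by \<open>phi h + g\<close>, \<open>h + g\<close>, \<open>h + phi g\<close>.
\<close>

section \<open>Points of the surface\<close>

text \<open>Every line of direction \<open>u\<close> is a level set of \<open>cross u\<close>, so
  which sides it crosses is decided by inequalities that are linear in the direction as well as in
  the position. Hence a cone of directions is controlled by its two ends, and no table has to be
  built as a surface: only words and inequalities are carried along. The obstacle lies in the
  definitions of the orbits, which range over all closed trajectories and all connected components
  in a direction, so that further closed trajectories must be excluded. A count of lengths does
  this: the cylinders cut disjoint open intervals on each side of the pentagon, these add up to the
  whole side and leave no gap, and a line on the boundary of a cylinder runs into a vertex. The
  heights in this count belong to two cylinders of equal modulus: the circumferences are as
  \<open>1 : phi\<close> and the heights as \<open>phi - 1 : 1\<close>, and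
  \<open>phi * (phi - 1) = 1\<close>. In the tiling, generations say nothing about positions; the
  order of the directions by angle shows that an edge common to two generations is the one that was
  reflected in.\<close>

definition cross :: "complex \<Rightarrow> complex \<Rightarrow> real" where
  "cross u v = Re u * Im v - Im u * Re v"

lemma cross_add_right: "cross u (v + w) = cross u v + cross u w"
  and cross_diff_right: "cross u (v - w) = cross u v - cross u w"
  and cross_minus_right: "cross u (- v) = - cross u v"
  and cross_scaleR_right: "cross u (r *\<^sub>R v) = r * cross u v"
  and cross_add_left: "cross (u + v) w = cross u w + cross v w"
  and cross_diff_left: "cross (u - v) w = cross u w - cross v w"
  and cross_minus_left: "cross (- u) w = - cross u w"
  and cross_scaleR_left: "cross (r *\<^sub>R u) w = r * cross u w"
  by (simp_all add: cross_def algebra_simps)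

lemmas cross_linear = cross_add_right cross_diff_right cross_minus_right cross_scaleR_right
  cross_add_left cross_diff_left cross_minus_left cross_scaleR_left

lemma cross_self [simp]: "cross u u = 0"
  by (simp add: cross_def)

lemma cross_zero [simp]: "cross u 0 = 0" "cross 0 u = 0"
  by (simp_all add: cross_def)

lemma continuous_on_cross [continuous_intros]:
  "continuous_on S f \<Longrightarrow> continuous_on S (\<lambda>x. cross u (f x))"
  unfolding cross_def by (intro continuous_intros)

lemma cross_sum_right: "cross u (\<Sum>i\<in>I. f i) = (\<Sum>i\<in>I. cross u (f i))"
  by (induction I rule: infinite_finite_induct) (auto simp: cross_linear)

lemma cross_cis: "cross (cis a) (cis b) = sin (b - a)"
  by (simp add: cross_def sin_diff)

lemma collinear_unit:
  assumes "cmod u = 1" "cross u z = 0"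
  shows "z = (u \<bullet> z) *\<^sub>R u"
proof -
  have n: "Re u * Re u + Im u * Im u = 1"
    using assms(1) by (metis cmod_power2 one_power2 power2_eq_square)
  have c: "Re u * Im z = Im u * Re z"
    using assms(2) by (simp add: cross_def)
  have "(Re u * Re z + Im u * Im z) * Re u = Re z * (Re u * Re u) + Im u * (Re u * Im z)"
    by (simp add: algebra_simps)
  also have "\<dots> = Re z * (Re u * Re u + Im u * Im u)"
    unfolding c by (simp add: algebra_simps)
  finally have 1: "(Re u * Re z + Im u * Im z) * Re u = Re z"
    using n by simp
  have "(Re u * Re z + Im u * Im z) * Im u = Im z * (Im u * Im u) + Re u * (Im u * Re z)"
    by (simp add: algebra_simps)
  also have "\<dots> = Im z * (Re u * Re u + Im u * Im u)"
    unfolding c[symmetric] by (simp add: algebra_simps)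
  finally have 2: "(Re u * Re z + Im u * Im z) * Im u = Im z"
    using n by simp
  show ?thesis
    using 1 2 by (simp add: complex_eq_iff inner_complex_def)
qed

text \<open>The sign of a sheet: multiplying by it carries \<open>P\<close> or \<open>-P\<close>
  onto \<open>P\<close>, so that every argument about the two sheets is made once.\<close>

definition sg :: "bool \<Rightarrow> real" where
  "sg \<epsilon> = (if \<epsilon> then 1 else -1)"

lemma sg_not [simp]: "sg (\<not> \<epsilon>) = - sg \<epsilon>" and sg_sq [simp]: "sg \<epsilon> * sg \<epsilon> = 1"
  and sg_scaleR_sg [simp]: "sg \<epsilon> *\<^sub>R sg \<epsilon> *\<^sub>R (z::complex) = z"
  and sg_nonzero [simp]: "sg \<epsilon> \<noteq> 0"
  by (auto simp: sg_def)

lemma sg_mult_sg [simp]: "sg \<epsilon> * (sg \<epsilon> * x) = x"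
  by (simp add: sg_def)

lemma mem_polygon: "z \<in> polygon \<epsilon> \<longleftrightarrow> sg \<epsilon> *\<^sub>R z \<in> pentagon"
  by (auto simp: polygon_def sg_def image_iff) (metis minus_minus)

lemma convex_pentagon: "convex pentagon"
  by (simp add: pentagon_def convex_convex_hull)

lemma convex_polygon: "convex (polygon \<epsilon>)"
  using convex_negations[OF convex_pentagon] by (simp add: polygon_def convex_pentagon)

section \<open>Vertices, sides and supporting lines of the regular pentagon\<close>

lemma vertex_plus5: "vertex (j + 5) = vertex j"
proof -
  have "2 * pi * real (j + 5) / 5 - 7 * pi / 10 = (2 * pi * real j / 5 - 7 * pi / 10) + 2 * pi"
    by (simp add: field_simps)
  then have "vertex (j + 5) = cis (2 * pi * real j / 5 - 7 * pi / 10) * cis (2 * pi)"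
    unfolding vertex_def by (simp only: cis_mult)
  then show ?thesis by (simp add: vertex_def)
qed

lemma vertex_mod: "vertex (j mod 5) = vertex j"
proof (induction j rule: less_induct)
  case (less j)
  show ?case
  proof (cases "j < 5")
    case False
    then have "vertex ((j - 5) mod 5) = vertex (j - 5)" using less by simp
    moreover have "vertex (j - 5) = vertex j" using vertex_plus5[of "j - 5"] False by simp
    moreover have "(j - 5) mod 5 = j mod 5" using False by (simp add: le_mod_geq)
    ultimately show ?thesis by simp
  qed simp
qed

lemma vertex_mem_pentagon: "vertex j \<in> pentagon"
proof -
  have "vertex (j mod 5) \<in> pentagon"
    unfolding pentagon_def by (rule hull_inc) auto
  then show ?thesis by (simp add: vertex_mod)
qed

lemma side_subset_pentagon: "side j \<subseteq> pentagon"
  unfolding side_def using convex_pentagon vertex_mem_pentagon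
  by (simp add: closed_segment_subset)

text \<open>Twice the midpoint of the side. If \<open>P\<close> is centred at 0, this is the centre
  of the copy of \<open>-P\<close> attached along side \<open>j\<close>; successive crossings
  therefore add hops with alternating sign.\<close>

definition hop :: "nat \<Rightarrow> complex" where
  "hop j = vertex j + vertex (Suc j)"

definition edge :: "nat \<Rightarrow> complex" where
  "edge j = vertex (Suc j) - vertex j"

lemma minus_mem_side: "hop j - z \<in> side j \<longleftrightarrow> z \<in> side j"
proof -
  have *: "hop j - z \<in> side j" if "z \<in> side j" for z
  proof -
    from that obtain t where t: "z = (1 - t) *\<^sub>R vertex j + t *\<^sub>R vertex (Suc j)" "0 \<le> t" "t \<le> 1"
      by (auto simp: side_def in_segment)
    have "hop j - z = (1 - (1 - t)) *\<^sub>R vertex j + (1 - t) *\<^sub>R vertex (Suc j)"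
      unfolding t hop_def by (simp add: algebra_simps)
    with t show ?thesis unfolding side_def in_segment by (intro exI[of _ "1 - t"]) auto
  qed
  show ?thesis using *[of z] *[of "hop j - z"] by auto
qed

text \<open>The third inequality is the strict convexity of the pentagon: it gives positive height
  over a side to the two vertices next to the ends of that side.\<close>

lemma sin_2pi5: "sin (2 * pi / 5) > 0" "sin (4 * pi / 5) > 0" "sin (4 * pi / 5) < 2 * sin (2 * pi / 5)"
proof -
  show 1: "sin (2 * pi / 5) > 0" by (rule sin_gt_zero) auto
  show "sin (4 * pi / 5) > 0" by (rule sin_gt_zero) auto
  have "cos (2 * pi / 5) < cos 0" by (rule cos_monotone_0_pi) auto
  then have c: "cos (2 * pi / 5) < 1" by simp
  have "sin (4 * pi / 5) = sin (2 * (2 * pi / 5))" by simp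
  also have "\<dots> = 2 * sin (2 * pi / 5) * cos (2 * pi / 5)" by (rule sin_double)
  finally show "sin (4 * pi / 5) < 2 * sin (2 * pi / 5)" using 1 c by simp
qed

text \<open>Side length times the distance from the line through side \<open>j\<close>, positive on
  the side of the pentagon because the vertices run counterclockwise.\<close>

definition supp :: "nat \<Rightarrow> complex \<Rightarrow> real" where
  "supp j z = cross (edge j) (z - vertex j)"

text \<open>The value depends only on \<open>m - j\<close> and is a combination of sines of
  multiples of 2 pi / 5, so the 25 cases reduce to the inequalities for two sines.\<close>

lemma supp_vertex:
  assumes "j < 5" "m < 5"
  shows "supp j (vertex m) \<ge> 0" "supp j (vertex m) = 0 \<Longrightarrow> m = j \<or> m = Suc j mod 5"
proof -
  let ?\<alpha> = "2 * pi / 5"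
  have s3: "sin (6 * pi / 5) = - sin (4 * pi / 5)"
    using sin_2pi_minus[of "4 * pi / 5"] by (simp add: field_simps)
  have s4: "sin (8 * pi / 5) = - sin (2 * pi / 5)"
    using sin_2pi_minus[of "2 * pi / 5"] by (simp add: field_simps)
  have e: "supp j (vertex m) = sin ((real m - real j - 1) * ?\<alpha>) - sin ((real m - real j) * ?\<alpha>) + sin ?\<alpha>"
  proof -
    define X Y Z where "X = 2 * pi * real (Suc j) / 5 - 7 * pi / 10"
      and "Y = 2 * pi * real j / 5 - 7 * pi / 10" and "Z = 2 * pi * real m / 5 - 7 * pi / 10"
    have "supp j (vertex m) = sin (Z - X) - sin (Z - Y) - sin (Y - X)"
      unfolding supp_def edge_def vertex_def cross_linear cross_cis X_def Y_def Z_def by simp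
    moreover have "Z - X = (real m - real j - 1) * ?\<alpha>" "Z - Y = (real m - real j) * ?\<alpha>" "Y - X = - ?\<alpha>"
      unfolding X_def Y_def Z_def by (simp_all add: field_simps)
    ultimately show ?thesis by simp
  qed
  have "m = 0 \<or> m = 1 \<or> m = 2 \<or> m = 3 \<or> m = 4" "j = 0 \<or> j = 1 \<or> j = 2 \<or> j = 3 \<or> j = 4"
    using assms by auto
  then have "supp j (vertex m) \<ge> 0 \<and> (supp j (vertex m) = 0 \<longrightarrow> m = j \<or> m = Suc j mod 5)"
    unfolding e using sin_2pi5 by (elim disjE) (simp_all add: s3 s4)
  then show "supp j (vertex m) \<ge> 0" "supp j (vertex m) = 0 \<Longrightarrow> m = j \<or> m = Suc j mod 5"
    by auto
qed

text \<open>If two vertices coincided, each would have height 0 over the side starting at the other,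
  hence each would be the successor of the other modulo 5.\<close>

lemma vertex_inj:
  assumes "j < 5" "m < 5" "vertex j = vertex m"
  shows "j = m"
proof (rule ccontr)
  assume "j \<noteq> m"
  have "supp j (vertex m) = 0" using assms by (simp add: supp_def flip: assms(3))
  then have "m = Suc j mod 5" using supp_vertex(2)[OF assms(1,2)] \<open>j \<noteq> m\<close> by auto
  have "supp m (vertex j) = 0" using assms by (simp add: supp_def)
  then have "j = Suc m mod 5" using supp_vertex(2)[OF assms(2,1)] \<open>j \<noteq> m\<close> by auto
  with \<open>m = _\<close> assms(1,2) show False by (simp add: mod_Suc split: if_splits)
qed

lemma pentagon_convex_comb:
  assumes "z \<in> pentagon"
  obtains c where "\<And>m. m < 5 \<Longrightarrow> c m \<ge> 0" "(\<Sum>m<5. c m) = (1::real)" "z = (\<Sum>m<5. c m *\<^sub>R vertex m)"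
proof -
  have inj: "inj_on vertex {..<5}" using vertex_inj by (auto simp: inj_on_def)
  from assms obtain c where c: "\<forall>x\<in>vertex ` {..<5}. 0 \<le> c x" "sum c (vertex ` {..<5}) = 1"
    "(\<Sum>x\<in>vertex ` {..<5}. c x *\<^sub>R x) = z"
    unfolding pentagon_def by (subst (asm) convex_hull_finite) auto
  show thesis
    using c by (intro that[of "c \<circ> vertex"]) (auto simp: sum.reindex[OF inj])
qed

lemma supp_convex_comb:
  assumes "(\<Sum>m\<in>I. c m) = (1::real)"
  shows "supp j (\<Sum>m\<in>I. c m *\<^sub>R z m) = (\<Sum>m\<in>I. c m * supp j (z m))"
proof -
  have "cross (edge j) (vertex j) = (\<Sum>m\<in>I. c m * cross (edge j) (vertex j))"
    using assms by (simp add: sum_distrib_right[symmetric])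
  then show ?thesis
    unfolding supp_def cross_linear cross_sum_right
    by (simp add: right_diff_distrib sum_subtractf)
qed

lemma supp_nonneg:
  assumes "j < 5" "z \<in> pentagon"
  shows "supp j z \<ge> 0"
proof -
  obtain c where c: "\<And>m. m < 5 \<Longrightarrow> c m \<ge> 0" "(\<Sum>m<5. c m) = (1::real)" "z = (\<Sum>m<5. c m *\<^sub>R vertex m)"
    using pentagon_convex_comb[OF assms(2)] by blast
  show ?thesis
    unfolding c(3) supp_convex_comb[OF c(2)] using c(1) supp_vertex(1)[OF assms(1)]
    by (intro sum_nonneg mult_nonneg_nonneg) auto
qed

text \<open>In a convex combination of vertices all heights over side \<open>j\<close> are
  nonnegative, so total height 0 forces all weight onto the two ends of the side.\<close>

lemma mem_side_iff:
  assumes "j < 5" "z \<in> pentagon"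
  shows "z \<in> side j \<longleftrightarrow> supp j z = 0"
proof
  assume "z \<in> side j"
  then obtain t where t: "z = (1 - t) *\<^sub>R vertex j + t *\<^sub>R vertex (Suc j)"
    by (auto simp: side_def in_segment)
  show "supp j z = 0"
    unfolding t supp_def edge_def by (simp add: cross_def algebra_simps)
next
  assume 0: "supp j z = 0"
  obtain c where c: "\<And>m. m < 5 \<Longrightarrow> c m \<ge> 0" "(\<Sum>m<5. c m) = (1::real)" "z = (\<Sum>m<5. c m *\<^sub>R vertex m)"
    using pentagon_convex_comb[OF assms(2)] by blast
  have z: "(\<Sum>m<5. c m * supp j (vertex m)) = 0"
    using 0 unfolding c(3) supp_convex_comb[OF c(2)] .
  have "c m * supp j (vertex m) = 0" if "m < 5" for m
  proof -
    have "\<forall>m\<in>{..<5}. c m * supp j (vertex m) = 0"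
      using z c(1) supp_vertex(1)[OF assms(1)] by (subst (asm) sum_nonneg_eq_0_iff) auto
    with that show ?thesis by simp
  qed
  then have z: "c m = 0" if "m < 5" "m \<noteq> j" "m \<noteq> Suc j mod 5" for m
    using that supp_vertex(2)[OF assms(1)] by auto
  have j: "j \<noteq> Suc j mod 5" "Suc j mod 5 < 5" using assms(1) by (auto simp: mod_Suc)
  have "(\<Sum>m<5. c m) = (\<Sum>m\<in>{j, Suc j mod 5}. c m)"
    using z assms(1) by (intro sum.mono_neutral_right) auto
  then have 1: "c j + c (Suc j mod 5) = 1" using c(2) j by simp
  have "z = (\<Sum>m\<in>{j, Suc j mod 5}. c m *\<^sub>R vertex m)"
    unfolding c(3) using z assms(1) by (intro sum.mono_neutral_right) auto
  then have z': "z = c j *\<^sub>R vertex j + c (Suc j mod 5) *\<^sub>R vertex (Suc j)"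
    using j by (simp add: vertex_mod)
  then have "z = (1 - c (Suc j mod 5)) *\<^sub>R vertex j + c (Suc j mod 5) *\<^sub>R vertex (Suc j)"
  proof -
    have "1 - c (Suc j mod 5) = c j" using 1 by simp
    then show ?thesis using z' by simp
  qed
  moreover have "0 \<le> c (Suc j mod 5)" "c (Suc j mod 5) \<le> 1"
    using c(1)[OF j(2)] c(1)[OF assms(1)] 1 by linarith+
  ultimately show "z \<in> side j" unfolding side_def in_segment by blast
qed

text \<open>The height over side \<open>j\<close> is affine and nonnegative along side
  \<open>m\<close>. A zero in the interior of side \<open>m\<close> would make it vanish at both
  ends of side \<open>m\<close>, so the two sides would be equal.\<close>

lemma mem_two_sides:
  assumes "j < 5" "m < 5" "z \<in> side j" "z \<in> side m" "j \<noteq> m"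
  shows "z = vertex m \<or> z = vertex (Suc m)"
proof -
  obtain t where t: "z = (1 - t) *\<^sub>R vertex m + t *\<^sub>R vertex (Suc m)" "0 \<le> t" "t \<le> 1"
    using assms(4) by (auto simp: side_def in_segment)
  have "supp j z = 0" using mem_side_iff assms side_subset_pentagon by blast
  moreover have "supp j z = (1 - t) * supp j (vertex m) + t * supp j (vertex (Suc m))"
    unfolding t(1) supp_def cross_linear by (simp add: algebra_simps)
  moreover have nn: "supp j (vertex m) \<ge> 0" "supp j (vertex (Suc m)) \<ge> 0"
    using supp_nonneg[OF assms(1)] vertex_mem_pentagon by auto
  ultimately have "(1 - t) * supp j (vertex m) = 0" "t * supp j (vertex (Suc m)) = 0"
    using t(2,3) by (auto simp: add_nonneg_eq_0_iff)
  show ?thesis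
  proof (rule ccontr)
    assume "\<not> ?thesis"
    then have "t \<noteq> 0" "t \<noteq> 1" using t by auto
    then have 0: "supp j (vertex m) = 0" "supp j (vertex (Suc m mod 5)) = 0"
      using \<open>(1 - t) * _ = 0\<close> \<open>t * _ = 0\<close> by (auto simp: vertex_mod)
    then have "m = j \<or> m = Suc j mod 5" "Suc m mod 5 = j \<or> Suc m mod 5 = Suc j mod 5"
      using supp_vertex(2)[OF assms(1)] assms(2) by auto
    then show False using assms(1,2,5) by (auto simp: mod_Suc split: if_splits)
  qed
qed

lemma supp_hop: "supp j (hop j - z) = - supp j z"
  unfolding supp_def edge_def hop_def by (simp add: cross_def algebra_simps)

text \<open>Passing to the neighbour changes the sign of \<open>supp j\<close>, which is nonnegative
  on the pentagon. So adjacent developed polygons meet only in their common side.\<close>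

lemma two_polygons:
  assumes "j < 5" "z \<in> polygon \<epsilon>" "z - sg \<epsilon> *\<^sub>R hop j \<in> polygon (\<not> \<epsilon>)"
  shows "sg \<epsilon> *\<^sub>R z \<in> side j"
proof -
  have 1: "sg \<epsilon> *\<^sub>R z \<in> pentagon" using assms(2) by (simp add: mem_polygon)
  have "hop j - sg \<epsilon> *\<^sub>R z \<in> pentagon"
    using assms(3) by (simp add: mem_polygon scaleR_diff_right)
  from supp_nonneg[OF assms(1) this] supp_nonneg[OF assms(1) 1] have "supp j (sg \<epsilon> *\<^sub>R z) = 0"
    by (simp add: supp_hop)
  then show ?thesis using mem_side_iff[OF assms(1) 1] by simp
qed

section \<open>The points of the surface as classes of the gluing\<close>

definition singular :: "bool \<times> complex \<Rightarrow> bool" where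
  "singular x \<longleftrightarrow> (\<exists>j<5. sg (fst x) *\<^sub>R snd x = vertex j)"

lemma singular_Suc: "sg \<epsilon> *\<^sub>R z = vertex j \<Longrightarrow> singular (\<epsilon>, z)"
  unfolding singular_def by (intro exI[of _ "j mod 5"]) (simp add: vertex_mod)

text \<open>A symmetric form of \<open>glued\<close> that reads the same on both sheets. A point
  that is not a vertex has at most one partner.\<close>

definition glue_partner :: "bool \<times> complex \<Rightarrow> bool \<times> complex \<Rightarrow> bool" where
  "glue_partner x y \<longleftrightarrow> (\<exists>j<5. sg (fst x) *\<^sub>R snd x \<in> side j \<and>
     y = (\<not> fst x, snd x - sg (fst x) *\<^sub>R hop j))"

lemma glue_partner_iff: "glue_partner x y \<longleftrightarrow> glued x y \<or> glued y x"
proof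
  assume "glue_partner x y"
  then obtain j where j: "j < 5" "sg (fst x) *\<^sub>R snd x \<in> side j"
     "y = (\<not> fst x, snd x - sg (fst x) *\<^sub>R hop j)"
    by (auto simp: glue_partner_def)
  obtain e z where x: "x = (e, z)" by (cases x)
  show "glued x y \<or> glued y x"
  proof (cases e)
    case True
    then show ?thesis using j glued.intros[of j z] by (simp add: x sg_def hop_def)
  next
    case False
    then have "hop j - - z \<in> side j" using j by (subst minus_mem_side) (simp add: x sg_def)
    then have "hop j + z \<in> side j" by simp
    from glued.intros[OF j(1) this] have "glued (True, hop j + z) (False, z)"
      by (simp add: hop_def)
    moreover have "y = (True, hop j + z)" using j(3) False by (simp add: x sg_def)
    ultimately show ?thesis using False by (simp add: x)
  qed
next
  assume "glued x y \<or> glued y x"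
  then show "glue_partner x y"
  proof
    assume "glued x y" then show ?thesis
      by (induction rule: glued.induct) (auto simp: glue_partner_def sg_def hop_def)
  next
    assume "glued y x"
    then show ?thesis
    proof (induction rule: glued.induct)
      case (1 j z)
      then have "hop j - z \<in> side j" by (simp add: minus_mem_side)
      with 1 show ?case unfolding glue_partner_def
        by (intro exI[of _ j]) (simp add: sg_def hop_def algebra_simps)
    qed
  qed
qed

lemma glue_partner_sym: "glue_partner x y \<Longrightarrow> glue_partner y x"
  by (auto simp: glue_partner_iff)

lemma point_eq_iff: "point x = point y \<longleftrightarrow> equivclp glued x y"
proof
  assume "point x = point y"
  then have "y \<in> point x" by (simp add: point_def)
  then show "equivclp glued x y" by (simp add: point_def)
next
  assume xy: "equivclp glued x y"
  show "point x = point y"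
    unfolding point_def using equivclp_trans[OF xy] equivclp_trans[OF equivclp_sym[OF xy]] by auto
qed

text \<open>A gluing can move the index of a vertex up by one while changing the sheet. Since 5 is
  odd, repeating this reaches all ten vertices.\<close>

lemma point_vertices:
  "point (True, vertex j) = point (True, vertex 0) \<and> point (False, - vertex j) = point (True, vertex 0)"
proof -
  have s: "point (True, vertex j) = point (False, - vertex (Suc j))"
     "point (True, vertex (Suc j)) = point (False, - vertex j)" if "j < 5" for j
    using glued.intros[OF that, of "vertex j"] glued.intros[OF that, of "vertex (Suc j)"]
    by (auto simp: side_def point_eq_iff intro: r_into_equivclp)
  have v5: "vertex 5 = vertex 0" using vertex_plus5[of 0] by simp
  have "j mod 5 = 0 \<or> j mod 5 = 1 \<or> j mod 5 = 2 \<or> j mod 5 = 3 \<or> j mod 5 = 4" by linarith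
  then have "point (True, vertex (j mod 5)) = point (True, vertex 0) \<and>
      point (False, - vertex (j mod 5)) = point (True, vertex 0)"
    using s[of 0] s[of 1] s[of 2] s[of 3] s[of 4] v5
    by (elim disjE) (simp_all add: numeral_2_eq_2[symmetric] Suc_numeral)
  then show ?thesis by (simp only: vertex_mod)
qed

lemma singular_partner: "glue_partner x y \<Longrightarrow> singular x \<Longrightarrow> singular y"
proof -
  assume "glue_partner x y" "singular x"
  then obtain j m where j: "j < 5" "sg (fst x) *\<^sub>R snd x \<in> side j"
     "y = (\<not> fst x, snd x - sg (fst x) *\<^sub>R hop j)" and m: "m < 5" "sg (fst x) *\<^sub>R snd x = vertex m"
    by (auto simp: glue_partner_def singular_def)
  have y: "sg (fst y) *\<^sub>R snd y = hop j - vertex m"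
    using j m by (simp add: scaleR_diff_right)
  have "supp j (vertex m) = 0" using m j mem_side_iff vertex_mem_pentagon by metis
  then have "m = j \<or> m = Suc j mod 5" using supp_vertex j m by blast
  then have "vertex m = vertex j \<or> vertex m = vertex (Suc j)" by (auto simp: vertex_mod)
  then have "hop j - vertex m = vertex (Suc j) \<or> hop j - vertex m = vertex j" by (auto simp: hop_def)
  then show ?thesis using y singular_Suc[of "fst y" "snd y"] by auto
qed

lemma glue_partner_unique:
  assumes "glue_partner x y" "glue_partner x y'" "\<not> singular x"
  shows "y = y'"
proof -
  obtain j where j: "j < 5" "sg (fst x) *\<^sub>R snd x \<in> side j" "y = (\<not> fst x, snd x - sg (fst x) *\<^sub>R hop j)"
    using assms(1) by (auto simp: glue_partner_def)
  obtain m where m: "m < 5" "sg (fst x) *\<^sub>R snd x \<in> side m" "y' = (\<not> fst x, snd x - sg (fst x) *\<^sub>R hop m)"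
    using assms(2) by (auto simp: glue_partner_def)
  have "j = m"
    using mem_two_sides[OF j(1) m(1) j(2) m(2)] assms(3) singular_Suc[of "fst x" "snd x"] by auto
  with j m show ?thesis by simp
qed

text \<open>Away from the vertices partners are unique and mutual, so the equivalence closure adds
  nothing to a single gluing step and classes have at most two elements. The vertices form the one
  remaining class.\<close>

lemma equivclp_glued_iff:
  "equivclp glued x y \<longleftrightarrow> (singular x \<and> singular y) \<or> x = y \<or> glue_partner x y"
proof
  assume "equivclp glued x y"
  then show "(singular x \<and> singular y) \<or> x = y \<or> glue_partner x y"
  proof (induction rule: equivclp_induct)
    case (step y z)
    then have "glue_partner y z" by (simp add: glue_partner_iff)
    from step.IH show ?case
    proof (elim disjE conjE)
      assume "glue_partner x y"
      with \<open>glue_partner y z\<close> show ?case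
        using glue_partner_unique[of y x z] glue_partner_sym[of x y] singular_partner[of y z]
          singular_partner[of y x] by blast
    qed (use \<open>glue_partner y z\<close> singular_partner in auto)
  qed simp
next
  have c: "point (True, vertex 0) = point x" if s: "singular x" for x
  proof -
    obtain e z where x: "x = (e, z)" by (cases x)
    obtain j where j: "sg e *\<^sub>R z = vertex j" using s by (auto simp: singular_def x)
    have "z = sg e *\<^sub>R sg e *\<^sub>R z" by simp
    then have "z = (if e then vertex j else - vertex j)" unfolding j by (simp add: sg_def)
    with point_vertices[of j] show ?thesis by (cases e) (simp_all add: x)
  qed
  assume "(singular x \<and> singular y) \<or> x = y \<or> glue_partner x y"
  then show "equivclp glued x y"
  proof (elim disjE conjE)
    assume "singular x" "singular y"
    then have "point x = point y" using c[of x] c[of y] by simp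
    then show ?thesis by (simp only: point_eq_iff)
  next
    assume "glue_partner x y"
    then show ?thesis unfolding glue_partner_iff by (meson r_into_equivclp equivclp_sym)
  qed simp
qed

lemma point_eq_cone: "point x = cone_point \<longleftrightarrow> singular x"
proof -
  have s: "singular (True, vertex 0)" by (rule singular_Suc[of _ _ 0]) (simp add: sg_def)
  show ?thesis
    unfolding cone_point_def point_eq_iff equivclp_glued_iff using s
    by (auto dest: glue_partner_sym singular_partner)
qed

lemma point_eq_cases:
  assumes "point (\<epsilon>, z) = point (\<epsilon>', z')" "point (\<epsilon>, z) \<noteq> cone_point"
  obtains "\<epsilon>' = \<epsilon>" "z' = z"
  | j where "j < 5" "\<epsilon>' = (\<not> \<epsilon>)" "sg \<epsilon> *\<^sub>R z \<in> side j" "z' = z - sg \<epsilon> *\<^sub>R hop j"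
  using assms unfolding point_eq_cone unfolding point_eq_iff equivclp_glued_iff glue_partner_def
  by auto

lemma point_glue:
  assumes "j < 5" "sg \<epsilon> *\<^sub>R z \<in> side j"
  shows "point (\<epsilon>, z) = point (\<not> \<epsilon>, z - sg \<epsilon> *\<^sub>R hop j)"
  using assms unfolding point_eq_iff equivclp_glued_iff glue_partner_def by auto

text \<open>If two charts describe the same regular point through different sheets, the point lies
  on a common side. A translate that stays in both polygons stays on this side, so the charts still
  agree there.\<close>

lemma point_translate:
  assumes "point (\<epsilon>, z) = point (\<epsilon>', z')" "point (\<epsilon>, z) \<noteq> cone_point"
    and "z + w \<in> polygon \<epsilon>" "z' + w \<in> polygon \<epsilon>'"
  shows "point (\<epsilon>, z + w) = point (\<epsilon>', z' + w)"
  using assms(1,2)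
proof (cases rule: point_eq_cases)
  case (2 j)
  have "sg \<epsilon> *\<^sub>R (z + w) \<in> side j"
    using assms(3,4) 2 by (intro two_polygons) (simp_all add: algebra_simps)
  from point_glue[OF 2(1) this] show ?thesis by (simp add: 2 algebra_simps)
qed simp

text \<open>Sides are by definition tested in the sheet \<open>P\<close>. A point given in
  \<open>-P\<close> is first moved across the gluing, and not being a vertex it lies on one side
  only.\<close>

lemma on_side_point:
  assumes "\<not> singular (\<epsilon>, z)" 
  shows "on_side (point (\<epsilon>, z)) k \<longleftrightarrow> (\<exists>j<5. k = side_label j \<and> sg \<epsilon> *\<^sub>R z \<in> side j)"
proof -
  have m: "(True, w) \<in> point (\<epsilon>, z) \<longleftrightarrow> (\<epsilon>, z) = (True, w) \<or> glue_partner (\<epsilon>, z) (True, w)" for w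
    using assms by (auto simp: point_def equivclp_glued_iff)
  show ?thesis
  proof (cases \<epsilon>)
    case True
    then show ?thesis unfolding on_side_def m by (auto simp: sg_def glue_partner_def)
  next
    case False
    have "(\<exists>w\<in>side j. glue_partner (False, z) (True, w)) \<longleftrightarrow> - z \<in> side j" if "j < 5" for j
    proof
      assume "\<exists>w\<in>side j. glue_partner (False, z) (True, w)"
      then obtain m where m: "m < 5" "- z \<in> side m" "z + hop m \<in> side j"
        by (auto simp: glue_partner_def sg_def)
      have "hop m - - z \<in> side m" using m(2) by (subst minus_mem_side)
      then have "z + hop m \<in> side m" by (simp add: add.commute)
      show "- z \<in> side j"
      proof (cases "m = j")
        case False
        then have "z + hop m = vertex m \<or> z + hop m = vertex (Suc m)"
          using mem_two_sides[OF that m(1) m(3) \<open>z + hop m \<in> side m\<close>] by simp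
        then have "- z = vertex (Suc m) \<or> - z = vertex m" 
          by (auto simp: hop_def algebra_simps add_eq_0_iff)
        then have "singular (\<epsilon>, z)" using singular_Suc[of False z] \<open>\<not> \<epsilon>\<close> by (auto simp: sg_def)
        with assms show ?thesis by simp
      qed (use m in simp)
    next
      assume *: "- z \<in> side j"
      then have "hop j - - z \<in> side j" by (subst minus_mem_side)
      then show "\<exists>w\<in>side j. glue_partner (False, z) (True, w)"
        using * that by (intro bexI[of _ "z + hop j"]) (auto simp: glue_partner_def sg_def add.commute)
    qed
    with False show ?thesis unfolding on_side_def m by (auto simp: sg_def)
  qed
qed

section \<open>Straight lines\<close>

text \<open>
  The line \<open>cross u z = y\<close>, in coordinates centred at the polygon. It enters the polygon through
  side \<open>j\<close> if the line traversed backwards leaves it there: \<open>exits (- u) (- y) \<epsilon> j\<close>.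
\<close>

definition exits :: "complex \<Rightarrow> real \<Rightarrow> bool \<Rightarrow> nat \<Rightarrow> bool" where
  "exits u y \<epsilon> j \<longleftrightarrow> j < 5 \<and> cross u (sg \<epsilon> *\<^sub>R vertex j) < y \<and> y < cross u (sg \<epsilon> *\<^sub>R vertex (Suc j))"

text \<open>The intersection of the line \<open>cross u z = y\<close> with side \<open>j\<close>,
  found by linear interpolation of \<open>cross u\<close> between the ends of the side.\<close>

definition exit_point :: "complex \<Rightarrow> real \<Rightarrow> bool \<Rightarrow> nat \<Rightarrow> complex" where
  "exit_point u y \<epsilon> j =
     sg \<epsilon> *\<^sub>R (vertex j + ((y - cross u (sg \<epsilon> *\<^sub>R vertex j)) / cross u (sg \<epsilon> *\<^sub>R edge j)) *\<^sub>R edge j)"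

lemma exits_edge_pos: "exits u y \<epsilon> j \<Longrightarrow> cross u (sg \<epsilon> *\<^sub>R edge j) > 0"
  unfolding exits_def edge_def by (auto simp: cross_linear algebra_simps)

lemma exits_neighbour:
  assumes "exits u y \<epsilon> j"
  shows "exits (- u) (- (y - cross u (sg \<epsilon> *\<^sub>R hop j))) (\<not> \<epsilon>) j"
  using assms unfolding exits_def hop_def by (auto simp: cross_linear algebra_simps)

text \<open>The bounds on \<open>y\<close> are closed because lines on the boundary of a cylinder
  have to be followed as well, before it is known whether they miss the vertices.\<close>

lemma exit_point_weak:
  assumes "j < 5" "cross u (sg \<epsilon> *\<^sub>R edge j) > 0"
    "cross u (sg \<epsilon> *\<^sub>R vertex j) \<le> y" "y \<le> cross u (sg \<epsilon> *\<^sub>R vertex (Suc j))"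
  shows "sg \<epsilon> *\<^sub>R exit_point u y \<epsilon> j \<in> side j" "cross u (exit_point u y \<epsilon> j) = y"
    "exit_point u y \<epsilon> j \<in> polygon \<epsilon>"
proof -
  define t where "t = (y - cross u (sg \<epsilon> *\<^sub>R vertex j)) / cross u (sg \<epsilon> *\<^sub>R edge j)"
  have X: "exit_point u y \<epsilon> j = sg \<epsilon> *\<^sub>R (vertex j + t *\<^sub>R edge j)"
    by (simp add: exit_point_def t_def)
  have "cross u (sg \<epsilon> *\<^sub>R vertex (Suc j)) = cross u (sg \<epsilon> *\<^sub>R vertex j) + cross u (sg \<epsilon> *\<^sub>R edge j)"
    by (simp add: edge_def cross_linear algebra_simps)
  then have t: "0 \<le> t" "t \<le> 1" using assms by (simp_all add: t_def)
  have "sg \<epsilon> *\<^sub>R exit_point u y \<epsilon> j = (1 - t) *\<^sub>R vertex j + t *\<^sub>R vertex (Suc j)"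
    by (simp add: X edge_def algebra_simps)
  then show s: "sg \<epsilon> *\<^sub>R exit_point u y \<epsilon> j \<in> side j"
    unfolding side_def in_segment using t by blast
  show "exit_point u y \<epsilon> j \<in> polygon \<epsilon>"
    unfolding mem_polygon using s side_subset_pentagon by blast
  have "cross u (exit_point u y \<epsilon> j) = cross u (sg \<epsilon> *\<^sub>R vertex j) + t * cross u (sg \<epsilon> *\<^sub>R edge j)"
    unfolding X by (simp add: cross_linear algebra_simps)
  then show "cross u (exit_point u y \<epsilon> j) = y"
    using assms(2) by (simp add: t_def)
qed

lemma exit_point:
  assumes "exits u y \<epsilon> j"
  shows "sg \<epsilon> *\<^sub>R exit_point u y \<epsilon> j \<in> side j" "cross u (exit_point u y \<epsilon> j) = y"
    "exit_point u y \<epsilon> j \<in> polygon \<epsilon>"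
  using exit_point_weak[of j u \<epsilon> y] assms exits_edge_pos[OF assms] by (auto simp: exits_def)

lemma exit_not_singular:
  assumes "exits u y \<epsilon> j" "sg \<epsilon> *\<^sub>R z \<in> side j" "cross u z = y"
  shows "\<not> singular (\<epsilon>, z)"
proof
  assume "singular (\<epsilon>, z)"
  then obtain m where m: "m < 5" "sg \<epsilon> *\<^sub>R z = vertex m" by (auto simp: singular_def)
  have j: "j < 5" using assms by (simp add: exits_def)
  have "supp j (vertex m) = 0" using mem_side_iff[OF j vertex_mem_pentagon] assms(2) m(2) by metis
  then have "m = j \<or> m = Suc j mod 5" using supp_vertex j m by blast
  then have "sg \<epsilon> *\<^sub>R z = vertex j \<or> sg \<epsilon> *\<^sub>R z = vertex (Suc j)" by (auto simp: m(2) vertex_mod)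
  then have "z = sg \<epsilon> *\<^sub>R vertex j \<or> z = sg \<epsilon> *\<^sub>R vertex (Suc j)"
    by (metis sg_scaleR_sg)
  with assms(1,3) show False by (auto simp: exits_def)
qed

lemma on_exit_side_unique:
  assumes "exits u y \<epsilon> j" "sg \<epsilon> *\<^sub>R z \<in> side j" "cross u z = y"
  shows "z = exit_point u y \<epsilon> j"
proof -
  obtain t where t: "sg \<epsilon> *\<^sub>R z = (1 - t) *\<^sub>R vertex j + t *\<^sub>R vertex (Suc j)"
    using assms(2) by (auto simp: side_def in_segment)
  have "z = sg \<epsilon> *\<^sub>R sg \<epsilon> *\<^sub>R z" by simp
  also have "\<dots> = sg \<epsilon> *\<^sub>R (vertex j + t *\<^sub>R edge j)" unfolding t edge_def by (simp add: algebra_simps)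
  finally have z: "z = sg \<epsilon> *\<^sub>R (vertex j + t *\<^sub>R edge j)" .
  have "y = cross u (sg \<epsilon> *\<^sub>R vertex j) + t * cross u (sg \<epsilon> *\<^sub>R edge j)"
    unfolding assms(3)[symmetric] by (subst z) (simp add: cross_linear algebra_simps)
  then have "t = (y - cross u (sg \<epsilon> *\<^sub>R vertex j)) / cross u (sg \<epsilon> *\<^sub>R edge j)"
    using exits_edge_pos[OF assms(1)] by (simp add: field_simps)
  then show ?thesis unfolding exit_point_def z[symmetric] by (metis z)
qed

lemma supp_shift: "supp m (sg \<epsilon> *\<^sub>R (z + t *\<^sub>R u)) = supp m (sg \<epsilon> *\<^sub>R z) - t * cross u (sg \<epsilon> *\<^sub>R edge m)"
  unfolding supp_def by (simp add: cross_def algebra_simps)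

text \<open>Along \<open>u\<close> the height over side \<open>j\<close> decreases; it is 0 at
  \<open>x\<close> and nonnegative at \<open>z\<close>, so \<open>x\<close> cannot lie behind
  \<open>z\<close>.\<close>

lemma exit_ahead_weak:
  assumes "cmod u = 1" "j < 5" "cross u (sg \<epsilon> *\<^sub>R edge j) > 0" "z \<in> polygon \<epsilon>" "x \<in> polygon \<epsilon>"
    "sg \<epsilon> *\<^sub>R x \<in> side j" "cross u z = cross u x"
  obtains \<tau> where "\<tau> \<ge> 0" "x = z + \<tau> *\<^sub>R u"
proof -
  define \<tau> where "\<tau> = u \<bullet> (x - z)"
  have "x - z = \<tau> *\<^sub>R u"
    unfolding \<tau>_def using assms(1,7) by (intro collinear_unit) (simp_all add: cross_linear)
  then have x: "x = z + \<tau> *\<^sub>R u" by (simp add: algebra_simps)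
  have "0 = supp j (sg \<epsilon> *\<^sub>R x)" using mem_side_iff assms mem_polygon by metis
  also have "\<dots> = supp j (sg \<epsilon> *\<^sub>R z) - \<tau> * cross u (sg \<epsilon> *\<^sub>R edge j)" unfolding x supp_shift ..
  finally have "\<tau> * cross u (sg \<epsilon> *\<^sub>R edge j) \<ge> 0"
    using supp_nonneg[of j "sg \<epsilon> *\<^sub>R z"] assms by (simp add: mem_polygon)
  then have "\<tau> \<ge> 0" using assms(3) by (simp add: zero_le_mult_iff)
  with x that show thesis by blast
qed

lemma exit_ahead:
  assumes "cmod u = 1" "exits u y \<epsilon> j" "z \<in> polygon \<epsilon>" "cross u z = y"
  obtains \<tau> where "\<tau> \<ge> 0" "exit_point u y \<epsilon> j = z + \<tau> *\<^sub>R u"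
  using exit_ahead_weak[of u j \<epsilon> z "exit_point u y \<epsilon> j"] assms exit_point[OF assms(2)]
    exits_edge_pos[OF assms(2)] by (metis exits_def)

text \<open>Each of two exit points would lie ahead of the other. So they coincide in a common point
  of two sides, which is a vertex, and exits avoid the vertices.\<close>

lemma exits_unique:
  assumes "cmod u = 1" "exits u y \<epsilon> j" "exits u y \<epsilon> k"
  shows "j = k"
proof (rule ccontr)
  assume "j \<noteq> k"
  let ?X = "exit_point u y \<epsilon> j" and ?Y = "exit_point u y \<epsilon> k"
  obtain a where a: "a \<ge> 0" "?X = ?Y + a *\<^sub>R u"
    using exit_ahead[OF assms(1,2) exit_point(3)[OF assms(3)] exit_point(2)[OF assms(3)]] .
  obtain b where b: "b \<ge> 0" "?Y = ?X + b *\<^sub>R u"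
    using exit_ahead[OF assms(1,3) exit_point(3)[OF assms(2)] exit_point(2)[OF assms(2)]] .
  have "(a + b) *\<^sub>R u = 0" using a(2) b(2) by (simp add: algebra_simps)
  moreover have "u \<noteq> 0" using assms(1) by auto
  ultimately have "a = 0" using a(1) b(1) by auto
  then have "?X = ?Y" using a by simp
  then have "sg \<epsilon> *\<^sub>R ?X = vertex k \<or> sg \<epsilon> *\<^sub>R ?X = vertex (Suc k)"
    using mem_two_sides[of j k "sg \<epsilon> *\<^sub>R ?X"] exit_point(1)[OF assms(2)] exit_point(1)[OF assms(3)] \<open>j \<noteq> k\<close> assms
    by (auto simp: exits_def)
  then have "singular (\<epsilon>, ?X)" using singular_Suc by blast
  then show False using exit_not_singular[OF assms(2)] exit_point[OF assms(2)] by blast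
qed

text \<open>A point of side \<open>m\<close> strictly between entry and exit would be an interior
  zero of the nonnegative affine function \<open>supp m\<close> on the line. The line would then run
  along side \<open>m\<close>, although it leaves the polygon transversally.\<close>

lemma on_line_on_side:
  assumes "cmod u = 1" "exits u y \<epsilon> j" "exits (- u) (- y) \<epsilon> k" "z \<in> polygon \<epsilon>" "cross u z = y"
    "m < 5" "sg \<epsilon> *\<^sub>R z \<in> side m"
  shows "(m = j \<and> z = exit_point u y \<epsilon> j) \<or> (m = k \<and> z = exit_point (- u) (- y) \<epsilon> k)"
proof -
  let ?X = "exit_point u y \<epsilon> j" and ?E = "exit_point (- u) (- y) \<epsilon> k"
  have E: "cross u ?E = y" using exit_point(2)[OF assms(3)] by (simp add: cross_linear)
  note X = exit_point[OF assms(2)] 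
  note E1 = exit_point[OF assms(3)]
  have nsX: "\<not> singular (\<epsilon>, ?X)" using exit_not_singular[OF assms(2)] X by blast
  have nsE: "\<not> singular (\<epsilon>, ?E)" using exit_not_singular[OF assms(3)] E1 by blast
  have jk: "j < 5" "k < 5" using assms(2,3) by (auto simp: exits_def)
  have same: "m = i" if "i < 5" "\<not> singular (\<epsilon>, w)" "sg \<epsilon> *\<^sub>R w \<in> side i" "sg \<epsilon> *\<^sub>R w \<in> side m" for i w
    using mem_two_sides[OF assms(6) that(1,4,3)] singular_Suc that(2) by blast
  obtain a where a: "a \<ge> 0" "?X = z + a *\<^sub>R u" using exit_ahead[OF assms(1,2,4,5)] .
  obtain b where b: "b \<ge> 0" "?E = z + b *\<^sub>R - u"
    using exit_ahead[OF _ assms(3) assms(4)] assms(1,5) by (auto simp: cross_linear)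
  show ?thesis
  proof (cases "a = 0 \<or> b = 0")
    case True
    then consider "z = ?X" | "z = ?E" using a b by auto
    then show ?thesis
    proof cases
      case 1
      then have "sg \<epsilon> *\<^sub>R ?X \<in> side m" using assms(7) by simp
      with 1 same[OF jk(1) nsX X(1)] show ?thesis by blast
    next
      case 2
      then have "sg \<epsilon> *\<^sub>R ?E \<in> side m" using assms(7) by simp
      with 2 same[OF jk(2) nsE E1(1)] show ?thesis by blast
    qed
  next
    case False
    define \<kappa> where "\<kappa> = cross u (sg \<epsilon> *\<^sub>R edge m)"
    have z0: "supp m (sg \<epsilon> *\<^sub>R z) = 0" using mem_side_iff[OF assms(6)] assms(4,7) mem_polygon by blast
    have "supp m (sg \<epsilon> *\<^sub>R ?X) = - a * \<kappa>" unfolding a(2) supp_shift z0 \<kappa>_def by simp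
    moreover have "supp m (sg \<epsilon> *\<^sub>R ?E) = b * \<kappa>"
      using supp_shift[of m \<epsilon> z "-b" u] unfolding b(2) z0 \<kappa>_def by simp
    moreover have "supp m (sg \<epsilon> *\<^sub>R ?X) \<ge> 0" "supp m (sg \<epsilon> *\<^sub>R ?E) \<ge> 0"
      using supp_nonneg[OF assms(6)] X(3) E1(3) by (auto simp: mem_polygon)
    ultimately have "\<kappa> = 0" using a(1) b(1) False
      by (auto simp: zero_le_mult_iff mult_le_0_iff)
    then have "sg \<epsilon> *\<^sub>R ?X \<in> side m"
      using \<open>supp m (sg \<epsilon> *\<^sub>R ?X) = _\<close> mem_side_iff[OF assms(6)] X(3) mem_polygon by simp
    then have "m = j" using same[OF jk(1) nsX X(1)] by blast
    then have "\<kappa> > 0" using exits_edge_pos[OF assms(2)] by (simp add: \<kappa>_def)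
    with \<open>\<kappa> = 0\<close> show ?thesis by simp
  qed
qed

section \<open>Trajectories follow developed lines\<close>

text \<open>A trajectory is only known to be straight locally, in charts that may change at any
  time. The supremum of the times up to which it follows the segment is attained thanks to the chart
  before it and, if smaller than \<open>\<tau>\<close>, exceeded thanks to the chart after
  it.\<close>

lemma trajectory_in_polygon:
  assumes tr: "trajectory u \<gamma>" and "\<gamma> t = point (\<epsilon>, z)" and z: "z \<in> polygon \<epsilon>" "z + \<tau> *\<^sub>R u \<in> polygon \<epsilon>"
    and s: "0 \<le> s" "s \<le> \<tau>"
  shows "\<gamma> (t + s) = point (\<epsilon>, z + s *\<^sub>R u)"
proof -
  have inp: "z + r *\<^sub>R u \<in> polygon \<epsilon>" if "0 \<le> r" "r \<le> \<tau>" for r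
  proof (cases "\<tau> = 0")
    case False
    have "z + r *\<^sub>R u = (1 - r / \<tau>) *\<^sub>R z + (r / \<tau>) *\<^sub>R (z + \<tau> *\<^sub>R u)"
      using False by (simp add: algebra_simps)
    then show ?thesis
      using convexD_alt[OF convex_polygon z, of "r / \<tau>"] that False by simp
  qed (use that z in auto)
  have nc: "\<gamma> r \<noteq> cone_point" for r using tr by (simp add: trajectory_def)
  define S where "S = {s. 0 \<le> s \<and> s \<le> \<tau> \<and> (\<forall>r. 0 \<le> r \<and> r \<le> s \<longrightarrow> \<gamma> (t + r) = point (\<epsilon>, z + r *\<^sub>R u))}"
  have S0: "0 \<in> S" using assms by (auto simp: S_def)
  have bdd: "bdd_above S" by (auto simp: S_def bdd_above_def)
  define \<sigma> where "\<sigma> = Sup S"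
  have \<sigma>: "0 \<le> \<sigma>" "\<sigma> \<le> \<tau>"
    unfolding \<sigma>_def using S0 bdd by (auto intro: cSup_upper cSup_least simp: S_def)
  have below: "\<gamma> (t + r) = point (\<epsilon>, z + r *\<^sub>R u)" if "0 \<le> r" "r < \<sigma>" for r
  proof -
    obtain s where "s \<in> S" "r < s"
      using \<open>r < \<sigma>\<close> less_cSup_iff[OF _ bdd] S0 unfolding \<sigma>_def by blast
    with that show ?thesis by (auto simp: S_def)
  qed
  have at: "\<gamma> (t + \<sigma>) = point (\<epsilon>, z + \<sigma> *\<^sub>R u)"
  proof (cases "\<sigma> = 0")
    case False
    obtain \<delta> \<epsilon>' z' where d: "\<delta> > 0"
      "\<And>r. r \<in> {-\<delta><..0} \<Longrightarrow> z' + r *\<^sub>R u \<in> polygon \<epsilon>' \<and> \<gamma> (t + \<sigma> + r) = point (\<epsilon>', z' + r *\<^sub>R u)"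
      using tr unfolding trajectory_def by meson
    define r where "r = - min (\<delta> / 2) (\<sigma> / 2)"
    have r: "r \<in> {-\<delta><..0}" "0 \<le> \<sigma> + r" "\<sigma> + r < \<sigma>"
      using \<sigma> False d(1) by (auto simp: r_def min_def)
    have "point (\<epsilon>, z + (\<sigma> + r) *\<^sub>R u) = point (\<epsilon>', z' + r *\<^sub>R u)"
      using below[OF r(2,3)] d(2)[OF r(1)] by (simp add: add.assoc)
    moreover have "point (\<epsilon>, z + (\<sigma> + r) *\<^sub>R u) \<noteq> cone_point"
      using below[OF r(2,3)] nc by metis
    moreover have "z + (\<sigma> + r) *\<^sub>R u + (- r) *\<^sub>R u \<in> polygon \<epsilon>"
      using inp[OF \<sigma>] by (simp add: algebra_simps)
    moreover have "z' + r *\<^sub>R u + (- r) *\<^sub>R u \<in> polygon \<epsilon>'"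
      using d(2)[of 0] d(1) by simp
    ultimately have "point (\<epsilon>, z + (\<sigma> + r) *\<^sub>R u + (- r) *\<^sub>R u) = point (\<epsilon>', z' + r *\<^sub>R u + (- r) *\<^sub>R u)"
      by (rule point_translate)
    then show ?thesis using d(2)[of 0] d(1) by (simp add: algebra_simps)
  qed (use assms in simp)
  have "\<sigma> = \<tau>"
  proof (rule ccontr)
    assume "\<sigma> \<noteq> \<tau>"
    obtain \<delta> \<epsilon>' z' where d: "\<delta> > 0"
      "\<And>r. r \<in> {0..<\<delta>} \<Longrightarrow> z' + r *\<^sub>R u \<in> polygon \<epsilon>' \<and> \<gamma> (t + \<sigma> + r) = point (\<epsilon>', z' + r *\<^sub>R u)"
      using tr unfolding trajectory_def by meson
    define \<rho> where "\<rho> = min (\<delta> / 2) (\<tau> - \<sigma>)"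
    have \<rho>: "\<rho> > 0" "\<rho> < \<delta>" "\<sigma> + \<rho> \<le> \<tau>" using d(1) \<sigma> \<open>\<sigma> \<noteq> \<tau>\<close> by (auto simp: \<rho>_def)
    have "\<gamma> (t + r) = point (\<epsilon>, z + r *\<^sub>R u)" if "0 \<le> r" "r \<le> \<sigma> + \<rho>" for r
    proof (cases "r < \<sigma>")
      case False
      define q where "q = r - \<sigma>"
      have q: "q \<in> {0..<\<delta>}" "\<sigma> + q \<le> \<tau>" "r = \<sigma> + q" using False that \<rho> by (auto simp: q_def)
      have "point (\<epsilon>, z + \<sigma> *\<^sub>R u) = point (\<epsilon>', z')" using d(2)[of 0] d(1) at by simp
      moreover have "point (\<epsilon>, z + \<sigma> *\<^sub>R u) \<noteq> cone_point" using at nc by metis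
      moreover have "z + \<sigma> *\<^sub>R u + q *\<^sub>R u \<in> polygon \<epsilon>"
        using inp[of "\<sigma> + q"] q \<sigma> by (simp add: algebra_simps)
      moreover have "z' + q *\<^sub>R u \<in> polygon \<epsilon>'" using d(2)[OF q(1)] by simp
      ultimately have "point (\<epsilon>, z + \<sigma> *\<^sub>R u + q *\<^sub>R u) = point (\<epsilon>', z' + q *\<^sub>R u)"
        by (rule point_translate)
      then show ?thesis using d(2)[OF q(1)] q(3) by (simp add: algebra_simps)
    qed (use below that in auto)
    then have "\<sigma> + \<rho> \<in> S" using \<rho> \<sigma> by (auto simp: S_def)
    then have "\<sigma> + \<rho> \<le> \<sigma>" unfolding \<sigma>_def by (intro cSup_upper bdd)
    with \<rho> show False by simp
  qed
  with at below s show ?thesis by (cases "s = \<tau>") auto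
qed

text \<open>
  The line \<open>z\<^sub>0 + t u\<close> developed in the plane: \<open>C i\<close> is the centre of the \<open>i\<close>-th polygon, which lies in
  the sheet \<open>even i\<close> and is left through the side with index \<open>J i\<close> at the time \<open>s i\<close>.
\<close>

locale itinerary =
  fixes u z\<^sub>0 :: complex and J :: "int \<Rightarrow> nat" and C :: "int \<Rightarrow> complex"
  assumes unit: "cmod u = 1"
    and C_Suc: "C (i + 1) = C i + sg (even i) *\<^sub>R hop (J i)"
    and exits: "exits u (cross u (z\<^sub>0 - C i)) (even i) (J i)"
begin

lemma J_less: "J i < 5"
  using exits by (simp add: exits_def)

lemma enters: "exits (- u) (- cross u (z\<^sub>0 - C i)) (even i) (J (i - 1))"
proof -
  have C: "C i = C (i - 1) + sg (even (i - 1)) *\<^sub>R hop (J (i - 1))" using C_Suc[of "i - 1"] by simp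
  show ?thesis
    unfolding C using exits_neighbour[OF exits[of "i - 1"]] by (simp add: cross_linear algebra_simps)
qed

definition X :: "int \<Rightarrow> complex" where
  "X i = C i + exit_point u (cross u (z\<^sub>0 - C i)) (even i) (J i)"

definition s :: "int \<Rightarrow> real" where
  "s i = u \<bullet> (X i - z\<^sub>0)"

lemma X_eq: "X i = z\<^sub>0 + s i *\<^sub>R u"
proof -
  have "cross u (X i - z\<^sub>0) = 0"
    using exit_point(2)[OF exits[of i]] by (simp add: X_def cross_linear)
  from collinear_unit[OF unit this] show ?thesis by (simp add: s_def algebra_simps)
qed

lemma X_exit: "X i - C i = exit_point u (cross u (z\<^sub>0 - C i)) (even i) (J i)"
  by (simp add: X_def)

lemma X_mem_side: "sg (even i) *\<^sub>R (X i - C i) \<in> side (J i)"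
  unfolding X_exit by (rule exit_point(1)[OF exits])

lemma X_entry: "X (i - 1) - C i = exit_point (- u) (- cross u (z\<^sub>0 - C i)) (even i) (J (i - 1))"
proof (rule on_exit_side_unique[OF enters])
  have C: "C i = C (i - 1) + sg (even (i - 1)) *\<^sub>R hop (J (i - 1))" using C_Suc[of "i - 1"] by simp
  have "sg (even i) *\<^sub>R (X (i - 1) - C i) = hop (J (i - 1)) - sg (even (i - 1)) *\<^sub>R (X (i - 1) - C (i - 1))"
    unfolding C by (simp add: scaleR_diff_right scaleR_add_right algebra_simps)
  then show "sg (even i) *\<^sub>R (X (i - 1) - C i) \<in> side (J (i - 1))"
    using X_mem_side[of "i - 1"] minus_mem_side by metis
  show "cross (- u) (X (i - 1) - C i) = - cross u (z\<^sub>0 - C i)"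
    unfolding X_eq by (simp add: cross_linear)
qed

lemma entry_mem: "X (i - 1) - C i \<in> polygon (even i)"
  unfolding X_entry by (rule exit_point(3)[OF enters])

lemma exit_mem: "X i - C i \<in> polygon (even i)"
  unfolding X_exit by (rule exit_point(3)[OF exits])

lemma cross_line: "cross u (z\<^sub>0 + t *\<^sub>R u - C i) = cross u (z\<^sub>0 - C i)"
  by (simp add: cross_linear)

lemma s_less: "s (i - 1) < s i"
proof -
  obtain a where a: "a \<ge> 0" "exit_point u (cross u (z\<^sub>0 - C i)) (even i) (J i) = (X (i - 1) - C i) + a *\<^sub>R u"
    using exit_ahead[OF unit exits entry_mem] cross_line[of "s (i - 1)" i] X_eq by metis
  have eq: "X i = X (i - 1) + a *\<^sub>R u" using a(2) X_exit[of i] by (simp add: algebra_simps)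
  have u0: "u \<noteq> 0" using unit by auto
  have "(s i - s (i - 1) - a) *\<^sub>R u = 0" using eq unfolding X_eq by (simp add: algebra_simps)
  then have a': "s i - s (i - 1) = a" using u0 by simp
  \<comment> \<open>Entry and exit in the same point would use the same side, as the point is no
    vertex; but a side through which lines of direction \<open>u\<close> enter is not one through
    which they leave.\<close>
  have "a \<noteq> 0"
  proof
    assume "a = 0"
    then have "X i = X (i - 1)" using eq by simp
    then have e: "X i - C i = exit_point (- u) (- cross u (z\<^sub>0 - C i)) (even i) (J (i - 1))"
      using X_entry[of i] by simp
    have 1: "sg (even i) *\<^sub>R (X i - C i) \<in> side (J (i - 1))"
      unfolding e by (rule exit_point(1)[OF enters])
    have ns: "\<not> singular (even i, X i - C i)"
      using exit_not_singular[OF exits X_mem_side] cross_line[of "s i" i] X_eq by metis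
    have "J i = J (i - 1)"
      using mem_two_sides[OF J_less J_less X_mem_side 1] singular_Suc ns by metis
    then show False using exits[of i] enters[of i] by (auto simp: exits_def cross_linear)
  qed
  with a a' show ?thesis by simp
qed

lemma s_mono: "i < j \<Longrightarrow> s i < s j"
proof (induction j rule: int_gr_induct)
  case base then show ?case using s_less[of "i + 1"] by simp
next
  case (step j) then show ?case using s_less[of "j + 1"] by simp
qed

lemma s_less_iff: "s i < s j \<longleftrightarrow> i < j"
  using s_mono by (metis linorder_neqE order_less_asym)

lemma s_le_iff: "s i \<le> s j \<longleftrightarrow> i \<le> j"
  using s_less_iff by (meson linorder_not_less)

lemma in_polygon:
  assumes "s (i - 1) \<le> t" "t \<le> s i"
  shows "z\<^sub>0 + t *\<^sub>R u - C i \<in> polygon (even i)"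
proof -
  define \<mu> where "\<mu> = (t - s (i - 1)) / (s i - s (i - 1))"
  have \<mu>: "0 \<le> \<mu>" "\<mu> \<le> 1" "t = s (i - 1) + \<mu> * (s i - s (i - 1))"
    using assms s_less[of i] by (auto simp: \<mu>_def field_simps)
  have "z\<^sub>0 + t *\<^sub>R u - C i = (1 - \<mu>) *\<^sub>R (X (i - 1) - C i) + \<mu> *\<^sub>R (X i - C i)"
    unfolding X_eq \<mu>(3) by (simp add: algebra_simps)
  then show ?thesis using convexD_alt[OF convex_polygon entry_mem exit_mem \<mu>(1,2)] by simp
qed

lemma on_line_side_cases:
  assumes "z \<in> polygon (even i)" "cross u z = cross u (z\<^sub>0 - C i)" "m < 5" "sg (even i) *\<^sub>R z \<in> side m"
  shows "m = J i \<and> z = X i - C i \<or> m = J (i - 1) \<and> z = X (i - 1) - C i"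
  unfolding X_exit X_entry by (rule on_line_on_side[OF unit exits enters assms])

lemma on_line_not_singular:
  assumes "z \<in> polygon (even i)" "cross u z = cross u (z\<^sub>0 - C i)"
  shows "\<not> singular (even i, z)"
proof
  assume s: "singular (even i, z)"
  then obtain m where m: "m < 5" "sg (even i) *\<^sub>R z = vertex m" by (auto simp: singular_def)
  then have "sg (even i) *\<^sub>R z \<in> side m" by (simp add: side_def)
  from on_line_side_cases[OF assms m(1) this]
  have "z = exit_point u (cross u (z\<^sub>0 - C i)) (even i) (J i) \<or>
      z = exit_point (- u) (- cross u (z\<^sub>0 - C i)) (even i) (J (i - 1))"
    unfolding X_exit X_entry by blast
  then show False
    using exit_not_singular[OF exits exit_point(1)[OF exits] exit_point(2)[OF exits]]
      exit_not_singular[OF enters exit_point(1)[OF enters] exit_point(2)[OF enters]] s by metis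
qed

lemma on_line_between:
  assumes "z \<in> polygon (even i)" "cross u z = cross u (z\<^sub>0 - C i)"
  obtains t where "s (i - 1) \<le> t" "t \<le> s i" "z = z\<^sub>0 + t *\<^sub>R u - C i"
proof -
  define t where "t = u \<bullet> (z - (z\<^sub>0 - C i))"
  have "z - (z\<^sub>0 - C i) = t *\<^sub>R u"
    unfolding t_def using assms(2) by (intro collinear_unit[OF unit]) (simp add: cross_linear)
  then have z: "z = z\<^sub>0 + t *\<^sub>R u - C i" by (simp add: algebra_simps)
  have u0: "u \<noteq> 0" using unit by auto
  obtain a where a: "a \<ge> 0" "X i - C i = z + a *\<^sub>R u"
    using exit_ahead[OF unit exits assms] X_exit by metis
  have "(s i - t - a) *\<^sub>R u = 0" using a(2) unfolding X_eq z by (simp add: algebra_simps)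
  then have 1: "t \<le> s i" using u0 a(1) by simp
  obtain b where b: "b \<ge> 0" "X (i - 1) - C i = z + b *\<^sub>R - u"
    using exit_ahead[OF _ enters assms(1)] assms(2) unit X_entry by (metis cross_minus_left norm_minus_cancel)
  have "(s (i - 1) - t + b) *\<^sub>R u = 0" using b(2) unfolding X_eq z by (simp add: algebra_simps)
  then have 2: "s (i - 1) \<le> t" using u0 b(1) by simp
  show thesis using that 1 2 z by blast
qed

lemma glue_X: "point (even i, X i - C i) = point (even (i + 1), X i - C (i + 1))"
  using point_glue[OF J_less X_mem_side] unfolding C_Suc by (simp add: algebra_simps)

end

lemma sorted_list_of_set_map_upto:
  fixes f :: "int \<Rightarrow> real"
  assumes "\<And>i j. i < j \<Longrightarrow> f i < f j"
  shows "sorted_list_of_set (set (map f [a..b])) = map f [a..b]"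
proof (rule sorted_list_of_set.idem_if_sorted_distinct)
  show "sorted (map f [a..b])"
    unfolding sorted_map using assms by (intro sorted_wrt_mono_rel[OF _ sorted_wrt_upto]) (simp add: less_imp_le)
  show "distinct (map f [a..b])"
    unfolding distinct_map inj_on_def using assms by (metis distinct_upto less_irrefl linorder_neqE)
qed

lemma sorted_list_of_set_map_rev_upto:
  fixes f :: "int \<Rightarrow> real"
  assumes "\<And>i j. i < j \<Longrightarrow> f j < f i"
  shows "sorted_list_of_set (set (map f (rev [a..b]))) = map f (rev [a..b])"
proof (rule sorted_list_of_set.idem_if_sorted_distinct)
  show "sorted (map f (rev [a..b]))"
    unfolding sorted_map sorted_wrt_rev
    using assms by (intro sorted_wrt_mono_rel[OF _ sorted_wrt_upto]) (simp add: less_imp_le)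
  show "distinct (map f (rev [a..b]))"
    unfolding distinct_map inj_on_def distinct_rev using assms
    by (metis distinct_upto less_irrefl linorder_neqE)
qed

text \<open>The sheet and the position of the line relative to the current polygon determine the
  next side, and with it the next relative position. The two starting indices may differ, so an
  itinerary can be compared with a shift of itself.\<close>

lemma itinerary_deterministic:
  assumes "itinerary u z J C" "itinerary u z' J' C'"
    and "even i = even i'" "cross u (z - C i) = cross u (z' - C' i')"
  shows "J (i + int m) = J' (i' + int m) \<and> C (i + int m) - C i = C' (i' + int m) - C' i'"
proof -
  interpret a: itinerary u z J C by fact
  interpret b: itinerary u z' J' C' by fact
  have J: "J (i + int m) = J' (i' + int m)" if "C (i + int m) - C i = C' (i' + int m) - C' i'" for m
  proof -
    have "z - C (i + int m) = (z - C i) - (C (i + int m) - C i)" by simp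
    moreover have "z' - C' (i' + int m) = (z' - C' i') - (C (i + int m) - C i)" using that by simp
    ultimately have "cross u (z - C (i + int m)) = cross u (z' - C' (i' + int m))"
      using assms(4) by (simp only: cross_diff_right)
    moreover have "even (i + int m) = even (i' + int m)" using assms(3) by simp
    ultimately show ?thesis
      using exits_unique[OF a.unit a.exits[of "i + int m"]] b.exits[of "i' + int m"] by simp
  qed
  have "C (i + int m) - C i = C' (i' + int m) - C' i'"
  proof (induction m)
    case (Suc m)
    have "C (i + int m + 1) - C i = C' (i' + int m + 1) - C' i'"
      unfolding a.C_Suc b.C_Suc using Suc J[OF Suc] assms(3) by (simp add: algebra_simps)
    moreover have "k + int (Suc m) = k + int m + 1" for k by simp
    ultimately show ?case by (simp only:)
  qed simp
  with J show ?thesis by blast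
qed

section \<open>Closed trajectories of periodic itineraries\<close>

text \<open>The period \<open>n\<close> is even so that a shift by it preserves the sheet.\<close>

locale periodic_itinerary = itinerary +
  fixes n :: int and l :: real
  assumes n: "n > 0" "even n" and l: "l > 0"
    and J_period: "J (i + n) = J i" and C_period: "C (i + n) = C i + l *\<^sub>R u"
begin

lemma s_period: "s (i + n) = s i + l"
proof -
  have "cross u (z\<^sub>0 - C (i + n)) = cross u (z\<^sub>0 - C i)" by (simp add: C_period cross_linear)
  then have "X (i + n) = X i + l *\<^sub>R u" using n(2) by (simp add: X_def J_period C_period)
  then have "(s (i + n) - s i - l) *\<^sub>R u = 0" unfolding X_eq by (simp add: algebra_simps)
  moreover have "u \<noteq> 0" using unit by auto
  ultimately show ?thesis by simp
qed

lemma s_period_mult: "s (i + int k * n) = s i + real k * l"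
proof (induction k)
  case (Suc k)
  have "s (i + int (Suc k) * n) = s (i + int k * n + n)" by (simp add: algebra_simps)
  also have "\<dots> = s i + real k * l + l" unfolding s_period Suc ..
  finally show ?case by (simp add: algebra_simps)
qed simp

lemma s_unbounded: "\<exists>i. s i > t" "\<exists>i. s i \<le> t"
proof -
  obtain k :: nat where k: "(\<bar>t\<bar> + \<bar>s 0\<bar>) / l < real k" using reals_Archimedean2 by blast
  then have k: "\<bar>t\<bar> + \<bar>s 0\<bar> < real k * l" using l by (simp add: field_simps)
  have "s (0 + int k * n) > t" unfolding s_period_mult using k by linarith
  then show "\<exists>i. s i > t" by blast
  have "s 0 = s (- int k * n) + real k * l" using s_period_mult[of "- int k * n" k] by simp
  then have "s (- int k * n) \<le> t" using k by linarith
  then show "\<exists>i. s i \<le> t" by blast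
qed

lemma s_cover: "\<exists>i. s (i - 1) \<le> t \<and> t < s i"
proof -
  obtain a b where a: "s a \<le> t" and b: "s b > t" using s_unbounded by blast
  have "a < b" using a b s_less_iff[of a b] by linarith
  show ?thesis
  proof (rule ccontr)
    assume no: "\<not> ?thesis"
    have "s (a + int m) \<le> t" for m
    proof (induction m)
      case (Suc m)
      have "\<not> t < s (a + int m + 1)" using no Suc by (metis add_diff_cancel_right')
      moreover have "a + int (Suc m) = a + int m + 1" by simp
      ultimately show ?case by (simp only: not_less)
    qed (use a in simp)
    from this[of "nat (b - a)"] b \<open>a < b\<close> show False by simp
  qed
qed

text \<open>Half-open intervals make the index unique; at a crossing time the chart of the polygon
  being entered is taken. \<open>path_eq\<close> shows that the chart of the polygon being left
  gives the same point.\<close>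

definition path :: "real \<Rightarrow> surface_point" where
  "path t = (let i = SOME i. s (i - 1) \<le> t \<and> t < s i in point (even i, z\<^sub>0 + t *\<^sub>R u - C i))"

lemma path_eq:
  assumes "s (i - 1) \<le> t" "t \<le> s i"
  shows "path t = point (even i, z\<^sub>0 + t *\<^sub>R u - C i)"
proof -
  define k where "k = (SOME i. s (i - 1) \<le> t \<and> t < s i)"
  have k: "s (k - 1) \<le> t" "t < s k"
    unfolding k_def using someI_ex[OF s_cover[of t]] by blast+
  have p: "path t = point (even k, z\<^sub>0 + t *\<^sub>R u - C k)" by (simp add: path_def k_def Let_def)
  have "s (k - 1) \<le> s i" "s (i - 1) < s k" using k assms by linarith+
  then have "k - 1 \<le> i" "i - 1 < k" unfolding s_le_iff s_less_iff by simp_all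
  then consider "k = i" | "k = i + 1" by linarith
  then show ?thesis
  proof cases
    case 2
    then have "t = s i" using k assms by simp
    then show ?thesis unfolding p 2 using glue_X[of i] by (simp add: X_eq)
  qed (simp add: p)
qed

lemma path_not_cone: "path t \<noteq> cone_point"
proof -
  obtain i where i: "s (i - 1) \<le> t" "t < s i" using s_cover by blast
  then show ?thesis
    using path_eq[of i t] on_line_not_singular[OF in_polygon[of i t] cross_line] by (simp add: point_eq_cone)
qed

lemma path_trajectory: "trajectory u path"
  unfolding trajectory_def
proof (intro conjI allI)
  show "cmod u = 1" by (rule unit)
  fix t show "path t \<noteq> cone_point" by (rule path_not_cone)
  obtain i where i: "s (i - 1) \<le> t" "t < s i" using s_cover by blast
  show "\<exists>\<delta>>0. \<exists>\<epsilon> z. \<forall>r\<in>{0..<\<delta>}. z + r *\<^sub>R u \<in> polygon \<epsilon> \<and> path (t + r) = point (\<epsilon>, z + r *\<^sub>R u)"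
  proof (intro exI[of _ "s i - t"] conjI exI[of _ "even i"] exI[of _ "z\<^sub>0 + t *\<^sub>R u - C i"] ballI)
    fix r assume "r \<in> {0..<s i - t}"
    then have r: "s (i - 1) \<le> t + r" "t + r \<le> s i" using i by auto
    have e: "z\<^sub>0 + t *\<^sub>R u - C i + r *\<^sub>R u = z\<^sub>0 + (t + r) *\<^sub>R u - C i" by (simp add: algebra_simps)
    show "z\<^sub>0 + t *\<^sub>R u - C i + r *\<^sub>R u \<in> polygon (even i)"
      "path (t + r) = point (even i, z\<^sub>0 + t *\<^sub>R u - C i + r *\<^sub>R u)"
      unfolding e using in_polygon[OF r] path_eq[OF r] .
  qed (use i in auto)
  obtain i where i: "s (i - 1) < t" "t \<le> s i"
  proof (cases "s (i - 1) = t")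
    case True then show ?thesis using s_less[of "i - 1"] that[of "i - 1"] by simp
  next
    case False then show ?thesis using i that[of i] by simp
  qed
  show "\<exists>\<delta>>0. \<exists>\<epsilon> z. \<forall>r\<in>{-\<delta><..0}. z + r *\<^sub>R u \<in> polygon \<epsilon> \<and> path (t + r) = point (\<epsilon>, z + r *\<^sub>R u)"
  proof (intro exI[of _ "t - s (i - 1)"] conjI exI[of _ "even i"] exI[of _ "z\<^sub>0 + t *\<^sub>R u - C i"] ballI)
    fix r assume "r \<in> {- (t - s (i - 1))<..0}"
    then have r: "s (i - 1) \<le> t + r" "t + r \<le> s i" using i by auto
    have e: "z\<^sub>0 + t *\<^sub>R u - C i + r *\<^sub>R u = z\<^sub>0 + (t + r) *\<^sub>R u - C i" by (simp add: algebra_simps)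
    show "z\<^sub>0 + t *\<^sub>R u - C i + r *\<^sub>R u \<in> polygon (even i)"
      "path (t + r) = point (even i, z\<^sub>0 + t *\<^sub>R u - C i + r *\<^sub>R u)"
      unfolding e using in_polygon[OF r] path_eq[OF r] .
  qed (use i in auto)
qed

lemma path_period: "path (t + l) = path t"
proof -
  obtain i where i: "s (i - 1) \<le> t" "t \<le> s i" using s_cover less_imp_le by metis
  have "s (i + n - 1) \<le> t + l" using i(1) s_period[of "i - 1"] by (simp add: algebra_simps)
  moreover have "t + l \<le> s (i + n)" using i(2) s_period[of i] by simp
  ultimately have "path (t + l) = point (even (i + n), z\<^sub>0 + (t + l) *\<^sub>R u - C (i + n))" by (rule path_eq)
  then show ?thesis using path_eq[OF i] n(2) by (simp add: C_period algebra_simps)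
qed

lemma path_period_int: "path (t + of_int k * l) = path t"
proof -
  have nat: "path (t + real m * l) = path t" for t and m :: nat
  proof (induction m)
    case (Suc m)
    have "path (t + real (Suc m) * l) = path (t + real m * l + l)" by (simp add: algebra_simps)
    then show ?case using Suc by (simp add: path_period)
  qed simp
  show ?thesis
  proof (cases "k \<ge> 0")
    case True then show ?thesis using nat[of t "nat k"] by simp
  next
    case False
    then show ?thesis using nat[of "t + of_int k * l" "nat (- k)"] by (simp add: algebra_simps)
  qed
qed

lemma path_on_side: "on_side (path t) k \<longleftrightarrow> (\<exists>i. t = s i \<and> k = side_label (J i))"
proof
  assume o: "on_side (path t) k"
  obtain i where i: "s (i - 1) \<le> t" "t \<le> s i" using s_cover less_imp_le by metis
  note z = in_polygon[OF i] cross_line[of t i]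
  from o obtain j where j: "j < 5" "k = side_label j" "sg (even i) *\<^sub>R (z\<^sub>0 + t *\<^sub>R u - C i) \<in> side j"
    unfolding path_eq[OF i] on_side_point[OF on_line_not_singular[OF z]] by blast
  have u0: "u \<noteq> 0" using unit by auto
  from on_line_side_cases[OF z j(1,3)] consider
      "j = J i" "(t - s i) *\<^sub>R u = 0" | "j = J (i - 1)" "(t - s (i - 1)) *\<^sub>R u = 0"
    unfolding X_eq by (auto simp: algebra_simps)
  then show "\<exists>i. t = s i \<and> k = side_label (J i)" using j(2) u0 by cases auto
next
  assume "\<exists>i. t = s i \<and> k = side_label (J i)"
  then obtain i where i: "t = s i" "k = side_label (J i)" by blast
  then have t: "s (i - 1) \<le> t" "t \<le> s i" using s_less[of i] by auto
  show "on_side (path t) k"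
    unfolding path_eq[OF t] on_side_point[OF on_line_not_singular[OF in_polygon[OF t] cross_line]]
    using J_less X_mem_side[of i] i by (auto simp: X_eq)
qed

lemma trajectory_eq_path_forward:
  assumes tr: "trajectory u \<gamma>" and "\<gamma> t\<^sub>1 = path t" and "\<tau> \<ge> 0"
  shows "\<gamma> (t\<^sub>1 + \<tau>) = path (t + \<tau>)"
proof -
  obtain i where i: "s (i - 1) \<le> t" "t < s i" using s_cover by blast
  have step: "\<gamma> (t\<^sub>1 + (r - t)) = path r"
    if k: "s (k - 1) \<le> q" "q \<le> r" "r \<le> s k" and q: "\<gamma> (t\<^sub>1 + (q - t)) = path q" for k q r
  proof -
    have qk: "q \<le> s k" "s (k - 1) \<le> r" using k by auto
    have e: "z\<^sub>0 + q *\<^sub>R u - C k + (r - q) *\<^sub>R u = z\<^sub>0 + r *\<^sub>R u - C k" by (simp add: algebra_simps)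
    have "\<gamma> (t\<^sub>1 + (q - t) + (r - q)) = point (even k, z\<^sub>0 + q *\<^sub>R u - C k + (r - q) *\<^sub>R u)"
    proof (rule trajectory_in_polygon[OF tr _ _ _ _ order_refl])
      show "\<gamma> (t\<^sub>1 + (q - t)) = point (even k, z\<^sub>0 + q *\<^sub>R u - C k)"
        using q path_eq[OF k(1) qk(1)] by simp
      show "z\<^sub>0 + q *\<^sub>R u - C k \<in> polygon (even k)" by (rule in_polygon[OF k(1) qk(1)])
      show "z\<^sub>0 + q *\<^sub>R u - C k + (r - q) *\<^sub>R u \<in> polygon (even k)"
        unfolding e by (rule in_polygon[OF qk(2) k(3)])
    qed (use k in simp)
    then show ?thesis unfolding e using path_eq[OF qk(2) k(3)] by simp
  qed
  have claim: "\<gamma> (t\<^sub>1 + (r - t)) = path r" if "t \<le> r" "r \<le> s (i + int m)" for m r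
    using that
  proof (induction m arbitrary: r)
    case 0
    then show ?case using step[of i t r] i assms(2) by simp
  next
    case (Suc m)
    show ?case
    proof (cases "r \<le> s (i + int m)")
      case False
      have "s i \<le> s (i + int m)" unfolding s_le_iff by simp
      then have "\<gamma> (t\<^sub>1 + (s (i + int m) - t)) = path (s (i + int m))"
        using i by (intro Suc.IH) auto
      moreover have "s (i + int (Suc m) - 1) \<le> s (i + int m)" unfolding s_le_iff by simp
      ultimately show ?thesis
        using step[of "i + int (Suc m)" "s (i + int m)" r] False Suc.prems by simp
    qed (use Suc in auto)
  qed
  obtain k where k: "s k > t + \<tau>" using s_unbounded by blast
  then have "s (i - 1) < s k" using i assms(3) by linarith
  then have "i \<le> k" unfolding s_less_iff by simp
  then have "k = i + int (nat (k - i))" by simp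
  then have "t + \<tau> \<le> s (i + int (nat (k - i)))" using k by simp
  from claim[OF _ this] assms(3) show ?thesis by simp
qed

text \<open>Trajectories through a common point agree at all later times. Far enough ahead, the
  period of \<open>\<gamma>\<close> is thus seen to be a period of \<open>path\<close> too; shifting
  forward by multiples of it reduces earlier times to later ones.\<close>

lemma closed_trajectory_eq_path:
  assumes tr: "trajectory u \<gamma>" and T: "T > 0" "\<And>t. \<gamma> (t + T) = \<gamma> t" and "\<gamma> t\<^sub>1 = path t"
  shows "\<gamma> r = path (r - t\<^sub>1 + t)"
proof -
  note f = trajectory_eq_path_forward[OF tr assms(4)]
  have per: "path (q + T) = path q" for q
  proof -
    obtain m :: nat where "(t - q) / l < real m" using reals_Archimedean2 by blast
    then have m: "q + real m * l \<ge> t" using l by (simp add: field_simps)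
    have "path (q + T) = path (q + T + of_int (int m) * l)" by (rule path_period_int[symmetric])
    also have "\<dots> = path (t + ((q + real m * l - t) + T))" by (simp add: algebra_simps)
    also have "\<dots> = \<gamma> (t\<^sub>1 + ((q + real m * l - t) + T))" using m T by (intro f[symmetric]) auto
    also have "\<dots> = \<gamma> (t\<^sub>1 + (q + real m * l - t))" using T(2)[of "t\<^sub>1 + (q + real m * l - t)"] by (simp add: add.assoc)
    also have "\<dots> = path (t + (q + real m * l - t))" using m by (intro f) auto
    also have "\<dots> = path q" using path_period_int[of q "int m"] by simp
    finally show ?thesis .
  qed
  have mult: "path (q + real m * T) = path q \<and> \<gamma> (q + real m * T) = \<gamma> q" for q m
  proof (induction m)
    case (Suc m)
    have "q + real (Suc m) * T = q + real m * T + T" by (simp add: algebra_simps)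
    then show ?case using Suc per T(2) by metis
  qed simp
  obtain m :: nat where "(t\<^sub>1 - r) / T < real m" using reals_Archimedean2 by blast
  then have m: "r - t\<^sub>1 + real m * T \<ge> 0" using T by (simp add: field_simps)
  have "\<gamma> r = \<gamma> (t\<^sub>1 + (r - t\<^sub>1 + real m * T))" using mult[of r m] by simp
  also have "\<dots> = path (t + (r - t\<^sub>1 + real m * T))" by (rule f[OF m])
  also have "\<dots> = path (r - t\<^sub>1 + t)" using mult[of "r - t\<^sub>1 + t" m] by (simp add: algebra_simps)
  finally show ?thesis .
qed

end

section \<open>Length and crossing word of a closed trajectory\<close>

text \<open>Shifts are even, since an odd one exchanges the sheets, and letters are compared only
  from \<open>i\<close> onwards, since this is what determinism gives.\<close>

locale primitive_itinerary = periodic_itinerary +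
  assumes primitive: "\<lbrakk>d > 0; even d; \<And>m::nat. J (i + int m + d) = J (i + int m)\<rbrakk> \<Longrightarrow> n dvd d"
begin

text \<open>A period of the path returns to the same sheet with the centre displaced by
  \<open>T *\<^sub>R u\<close>. By determinism the letters repeat after the corresponding even
  shift, which is then a multiple of \<open>n\<close>; so \<open>T\<close> is a positive multiple of
  \<open>l\<close>.\<close>

lemma period_ge:
  assumes "T > 0" "\<And>t. path (t + T) = path t"
  shows "l \<le> T"
proof -
  \<comment> \<open>A time strictly between two crossings, where the point lies on no side and so
    has only one chart.\<close>
  define t where "t = (s (-1) + s 0) / 2"
  have t: "s (-1) < t" "t < s 0" using s_less[of 0] by (auto simp: t_def)
  then have t0: "s (0 - 1) \<le> t" "t \<le> s 0" by auto
  obtain i where i: "s (i - 1) \<le> t + T" "t + T \<le> s i" using s_cover less_imp_le by metis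
  have "point (even (0::int), z\<^sub>0 + t *\<^sub>R u - C 0) = point (even i, z\<^sub>0 + (t + T) *\<^sub>R u - C i)"
    using path_eq[OF i] path_eq[OF t0] assms(2) by simp
  moreover have "point (even (0::int), z\<^sub>0 + t *\<^sub>R u - C 0) \<noteq> cone_point"
    using path_eq[OF t0] path_not_cone by metis
  ultimately have "even i \<and> z\<^sub>0 + t *\<^sub>R u - C 0 = z\<^sub>0 + (t + T) *\<^sub>R u - C i"
  proof (cases rule: point_eq_cases)
    case (2 j)
    have "on_side (path t) (side_label j)"
      unfolding path_eq[OF t0] on_side_point[OF on_line_not_singular[OF in_polygon[OF t0] cross_line]]
      using 2 by blast
    then obtain k where "t = s k" unfolding path_on_side by blast
    then have "-1 < k" "k < 0" using t unfolding \<open>t = s k\<close> s_less_iff by simp_all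
    then show ?thesis by simp
  qed simp
  then have ev: "even i" and Ci: "C i - C 0 = T *\<^sub>R u" by (auto simp: algebra_simps)
  have "s (-1) < s i" using t i assms(1) by linarith
  then have "i \<ge> 0" unfolding s_less_iff by simp
  moreover have "i \<noteq> 0" using Ci assms(1) unit by auto
  ultimately have "i > 0" by simp
  have it: "itinerary u z\<^sub>0 J C" by unfold_locales
  have "cross u (z\<^sub>0 - C 0) = cross u (z\<^sub>0 - C i)"
  proof -
    have "C i = C 0 + T *\<^sub>R u" using Ci by (simp add: algebra_simps)
    then show ?thesis by (simp add: cross_linear)
  qed
  then have "J (0 + int m + i) = J (0 + int m)" for m
    using itinerary_deterministic[OF it it, of 0 i m] ev by (simp add: add.commute)
  from primitive[OF \<open>i > 0\<close> ev this] obtain k where k: "i = n * k" by (auto simp: dvd_def)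
  have "k > 0" using k \<open>i > 0\<close> n(1) by (simp add: zero_less_mult_iff)
  have "C (0 + int m * n) = C 0 + (real m * l) *\<^sub>R u" for m
  proof (induction m)
    case (Suc m)
    have "C (0 + int (Suc m) * n) = C (0 + int m * n + n)" by (simp add: algebra_simps)
    also have "\<dots> = C 0 + (real m * l) *\<^sub>R u + l *\<^sub>R u" unfolding C_period Suc ..
    finally show ?case by (simp add: algebra_simps)
  qed simp
  from this[of "nat k"] have "C i = C 0 + (of_int k * l) *\<^sub>R u"
    using \<open>k > 0\<close> by (simp add: k mult.commute)
  then have "(of_int k * l - T) *\<^sub>R u = 0" using Ci by (simp add: algebra_simps)
  then have "T = of_int k * l" using unit by auto
  moreover have "1 * l \<le> of_int k * l" using \<open>k > 0\<close> l by (intro mult_right_mono) auto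
  ultimately show ?thesis by simp
qed

lemma traj_length_shift:
  assumes "\<gamma> = (\<lambda>t. path (t + c)) \<or> \<gamma> = (\<lambda>t. path (c - t))"
  shows "traj_length \<gamma> = l"
proof -
  have iff: "(\<forall>t. \<gamma> (t + T) = \<gamma> t) \<longleftrightarrow> (\<forall>t. path (t + T) = path t)" for T
  proof -
    define P where "P t \<longleftrightarrow> path (t + T) = path t" for t
    have shift: "(\<forall>t. P (t + c)) \<longleftrightarrow> (\<forall>t. P t)" "(\<forall>t. P (c - T - t)) \<longleftrightarrow> (\<forall>t. P t)"
      by (metis diff_add_cancel) (metis diff_diff_eq2 add_diff_cancel_left')
    from assms show ?thesis unfolding P_def[symmetric]
    proof
      assume g: "\<gamma> = (\<lambda>t. path (t + c))"
      have "\<gamma> (t + T) = \<gamma> t \<longleftrightarrow> P (t + c)" for t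
        by (simp add: g P_def add.commute add.left_commute)
      with shift(1) show "(\<forall>t. \<gamma> (t + T) = \<gamma> t) \<longleftrightarrow> (\<forall>t. P t)" by simp
    next
      assume g: "\<gamma> = (\<lambda>t. path (c - t))"
      have "c - T - t + T = c - t" "c - (t + T) = c - T - t" for t by simp_all
      then have "\<gamma> (t + T) = \<gamma> t \<longleftrightarrow> P (c - T - t)" for t
        unfolding g P_def by metis
      with shift(2) show "(\<forall>t. \<gamma> (t + T) = \<gamma> t) \<longleftrightarrow> (\<forall>t. P t)" by simp
    qed
  qed
  show ?thesis
    unfolding traj_length_def iff
  proof (rule cInf_eq_minimum)
    show "l \<in> {T. 0 < T \<and> (\<forall>t. path (t + T) = path t)}" using l path_period by simp
  qed (use period_ge in auto)
qed

lemma first_crossing: "\<exists>i. s (i - 1) < c \<and> c \<le> s i"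
proof -
  obtain i where i: "s (i - 1) \<le> c" "c < s i" using s_cover by blast
  show ?thesis
  proof (cases "s (i - 1) = c")
    case True then show ?thesis using s_less[of "i - 1"] by (intro exI[of _ "i - 1"]) simp
  next
    case False then show ?thesis using i by (intro exI[of _ i]) simp
  qed
qed

lemma the_side: "(THE k. on_side (path (s i)) k) = side_label (J i)"
proof -
  have "s i = s k \<longleftrightarrow> i = k" for k using s_le_iff by (metis order_antisym order_refl)
  then show ?thesis unfolding path_on_side by (intro the_equality) auto
qed

lemma crossing_word_forward: "\<exists>i. crossing_word (\<lambda>t. path (t + c)) = map (side_label \<circ> J) [i..i + n - 1]"
proof -
  \<comment> \<open>The first crossing not before \<open>c\<close>: a crossing exactly at
    \<open>c\<close> counts, since the window of times contains 0 but not \<open>l\<close>.\<close>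
  obtain i where i: "s (i - 1) < c" "c \<le> s i" using first_crossing by blast
  let ?L = "map (\<lambda>k. s k - c) [i..i + n - 1]"
  have "{t \<in> {0..<l}. \<exists>k. on_side (path (t + c)) k} = set ?L"
  proof (intro set_eqI iffI)
    fix t assume "t \<in> {t \<in> {0..<l}. \<exists>k. on_side (path (t + c)) k}"
    then obtain k where k: "0 \<le> t" "t < l" "t = s k - c" by (auto simp: path_on_side algebra_simps)
    then have "s (i - 1) < s k" "s k < s (i + n)" using i s_period[of i] by auto
    then show "t \<in> set ?L" using k(3) unfolding s_less_iff by auto
  next
    fix t assume "t \<in> set ?L"
    then obtain k where k: "i \<le> k" "k \<le> i + n - 1" "t = s k - c" by auto
    then have "s i \<le> s k" "s k \<le> s (i - 1 + n)" unfolding s_le_iff by auto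
    then have "0 \<le> t" "t < l" using i k(3) s_period[of "i - 1"] by auto
    then show "t \<in> {t \<in> {0..<l}. \<exists>k. on_side (path (t + c)) k}" using k(3) by (auto simp: path_on_side)
  qed
  moreover have "sorted_list_of_set (set ?L) = ?L"
    by (rule sorted_list_of_set_map_upto) (simp add: s_less_iff)
  ultimately show ?thesis
    unfolding crossing_word_def traj_length_shift[OF disjI1[OF refl]]
    by (intro exI[of _ i]) (simp only: list.map_comp comp_def diff_add_cancel the_side)
qed

lemma crossing_word_backward: "\<exists>i. crossing_word (\<lambda>t. path (c - t)) = map (side_label \<circ> J) (rev [i..i + n - 1])"
proof -
  \<comment> \<open>Run backwards, the path first meets the last crossing not after
    \<open>c\<close>, which has the number \<open>i' - 1 = i + n - 1\<close>.\<close>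
  obtain i' where i': "s (i' - 1) \<le> c" "c < s i'" using s_cover by blast
  define i where "i = i' - n"
  have i: "s (i + n - 1) \<le> c" "c < s (i + n)" using i' by (auto simp: i_def)
  let ?L = "map (\<lambda>k. c - s k) (rev [i..i + n - 1])"
  have "{t \<in> {0..<l}. \<exists>k. on_side (path (c - t)) k} = set ?L"
  proof (intro set_eqI iffI)
    fix t assume "t \<in> {t \<in> {0..<l}. \<exists>k. on_side (path (c - t)) k}"
    then obtain k where k: "0 \<le> t" "t < l" "t = c - s k" by (auto simp: path_on_side algebra_simps)
    then have "s (i - 1) < s k" "s k < s (i + n)" using i s_period[of "i - 1"] by (auto simp: algebra_simps)
    then show "t \<in> set ?L" using k(3) unfolding s_less_iff by auto
  next
    fix t assume "t \<in> set ?L"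
    then obtain k where k: "i \<le> k" "k \<le> i + n - 1" "t = c - s k" by auto
    then have "s i \<le> s k" "s k \<le> s (i + n - 1)" unfolding s_le_iff by auto
    then have "0 \<le> t" "t < l" using i k(3) s_period[of i] by auto
    then show "t \<in> {t \<in> {0..<l}. \<exists>k. on_side (path (c - t)) k}" using k(3)
      by (auto simp: path_on_side)
  qed
  moreover have "sorted_list_of_set (set ?L) = ?L"
    by (rule sorted_list_of_set_map_rev_upto) (simp add: s_less_iff)
  ultimately show ?thesis
    unfolding crossing_word_def traj_length_shift[OF disjI2[OF refl]]
    by (intro exI[of _ i]) (simp add: comp_def the_side)
qed

end

section \<open>Cylinders\<close>

text \<open>
  Words are lists of side indices below 5 rather than labels. They start in \<open>P\<close> and have even
  length; \<open>cen w i\<close> is the centre of the polygon reached after \<open>i\<close> crossings.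
\<close>

definition cen :: "nat list \<Rightarrow> nat \<Rightarrow> complex" where
  "cen w i = (\<Sum>m<i. sg (even m) *\<^sub>R hop (w ! m))"

definition hol :: "nat list \<Rightarrow> complex" where
  "hol w = cen w (length w)"

definition letter :: "nat list \<Rightarrow> int \<Rightarrow> nat" where
  "letter w i = w ! nat (i mod int (length w))"

definition Cen :: "nat list \<Rightarrow> int \<Rightarrow> complex" where
  "Cen w i = of_int (i div int (length w)) * hol w + cen w (nat (i mod int (length w)))"

definition word :: "nat list \<Rightarrow> bool" where
  "word w \<longleftrightarrow> w \<noteq> [] \<and> even (length w) \<and> (\<forall>j\<in>set w. j < 5)"

lemma letter_less: "word w \<Longrightarrow> letter w i < 5"
  unfolding word_def letter_def by (auto simp: nat_less_iff)

lemma letter_period: "letter w (i + int (length w)) = letter w i"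
  by (simp add: letter_def)

lemma Cen_period: "word w \<Longrightarrow> Cen w (i + int (length w)) = Cen w i + hol w"
  by (simp add: Cen_def word_def div_add_self2 algebra_simps)

lemma Cen_nat: "i < length w \<Longrightarrow> Cen w (int i) = cen w i"
  by (simp add: Cen_def)

lemma letter_nat: "i < length w \<Longrightarrow> letter w (int i) = w ! i"
  by (simp add: letter_def)

lemma Cen_Suc:
  assumes w: "word w"
  shows "Cen w (i + 1) = Cen w i + sg (even i) *\<^sub>R hop (letter w i)"
proof -
  define n where "n = int (length w)"
  have n: "n > 0" "even n" using w by (auto simp: n_def word_def)
  define k r where "k = i div n" and "r = nat (i mod n)"
  have r: "int r < n" "i = n * k + int r" using n(1) by (auto simp: k_def r_def)
  have ev: "even i = even r" using r n by simp
  have Ci: "Cen w i = of_int k * hol w + cen w r" by (simp add: Cen_def k_def r_def n_def)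
  have Li: "letter w i = w ! r" by (simp add: letter_def r_def n_def)
  have cS: "cen w (Suc r) = cen w r + sg (even r) *\<^sub>R hop (w ! r)" by (simp add: cen_def)
  show ?thesis
  proof (cases "int r + 1 = n")
    case True
    then have "i + 1 = n * (k + 1)" using r by (simp add: algebra_simps)
    then have "(i + 1) div n = k + 1" "(i + 1) mod n = 0" using n(1) by simp_all
    then have "Cen w (i + 1) = of_int (k + 1) * hol w" by (simp add: Cen_def n_def cen_def)
    moreover have "hol w = cen w (Suc r)" using True by (simp add: hol_def n_def) (metis of_nat_Suc of_nat_eq_iff add.commute)
    ultimately show ?thesis unfolding Ci Li cS[symmetric] ev using cS by (simp add: algebra_simps)
  next
    case False
    then have "i + 1 = n * k + (int r + 1)" "0 \<le> int r + 1" "int r + 1 < n" using r by auto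
    then have "(i + 1) div n = k" "(i + 1) mod n = int r + 1" 
      by (rule int_div_pos_eq, rule int_mod_pos_eq)
    then have "Cen w (i + 1) = of_int k * hol w + cen w (Suc r)"
      by (simp add: Cen_def n_def nat_add_distrib)
    then show ?thesis unfolding Ci Li cS ev by simp
  qed
qed

text \<open>One end of the side crossed in step \<open>i\<close>, measured by \<open>cross u\<close>
  in developed coordinates; \<open>upper\<close> is the other end, and a line makes this crossing if
  its value lies strictly between. When \<open>hol w\<close> is parallel to \<open>u\<close>, one
  period suffices for \<open>lo\<close> and \<open>hi\<close>.\<close>

definition lower :: "complex \<Rightarrow> nat list \<Rightarrow> int \<Rightarrow> real" where
  "lower u w i = cross u (Cen w i + sg (even i) *\<^sub>R vertex (letter w i))"

definition upper :: "complex \<Rightarrow> nat list \<Rightarrow> int \<Rightarrow> real" where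
  "upper u w i = cross u (Cen w i + sg (even i) *\<^sub>R vertex (Suc (letter w i)))"

definition lo :: "complex \<Rightarrow> nat list \<Rightarrow> real" where
  "lo u w = Max ((\<lambda>i. lower u w (int i)) ` {..<length w})"

definition hi :: "complex \<Rightarrow> nat list \<Rightarrow> real" where
  "hi u w = Min ((\<lambda>i. upper u w (int i)) ` {..<length w})"

section \<open>Auxiliary facts on intervals and on lines leaving a polygon\<close>

lemma periodic_int:
  fixes P :: "int \<Rightarrow> 'a"
  assumes "n > 0" "\<And>i. P (i + int n) = P i"
  shows "P i = P (int (nat (i mod int n)))"
proof -
  have *: "P (j + int k * int n) = P j" for j k
  proof (induction k)
    case (Suc k)
    have "P (j + int (Suc k) * int n) = P (j + int k * int n + int n)" by (simp add: algebra_simps)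
    then show ?case using Suc assms(2) by simp
  qed simp
  have i: "i = i mod int n + (i div int n) * int n" by simp
  show ?thesis
  proof (cases "i div int n \<ge> 0")
    case True
    then show ?thesis using *[of "i mod int n" "nat (i div int n)"] assms(1) by simp
  next
    case False
    then have "i + int (nat (- (i div int n))) * int n = i mod int n"
      by (subst i) (simp add: algebra_simps)
    then show ?thesis using *[of i "nat (- (i div int n))"] assms(1) by simp
  qed
qed

text \<open>A point missed by the closed intervals has a neighbourhood disjoint from them. Its part
  in \<open>[L, R]\<close> has positive length and would have to fit beside the disjoint open
  intervals, whose total length is at least \<open>R - L\<close>.\<close>

lemma disjoint_intervals_cover:
  fixes l r :: "'i \<Rightarrow> real"
  assumes fin: "finite I" and lr: "\<And>i. i \<in> I \<Longrightarrow> l i < r i" "\<And>i. i \<in> I \<Longrightarrow> L \<le> l i" "\<And>i. i \<in> I \<Longrightarrow> r i \<le> R"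
    and disj: "disjoint_family_on (\<lambda>i. {l i<..<r i}) I"
    and total: "(\<Sum>i\<in>I. r i - l i) \<ge> R - L" and "L < R" "L \<le> y" "y \<le> R"
  shows "\<exists>i\<in>I. l i \<le> y \<and> y \<le> r i"
proof (rule ccontr)
  assume no: "\<not> ?thesis"
  define B where "B = (\<Union>i\<in>I. {l i..r i})"
  have "closed B" unfolding B_def using fin by (intro closed_UN) auto
  moreover have "y \<notin> B" using no by (auto simp: B_def)
  ultimately obtain e where e: "e > 0" "ball y e \<subseteq> - B"
    by (metis ComplI open_Compl openE)
  define a b where "a = max L (y - e)" and "b = min R (y + e)"
  have ab: "a < b" "L \<le> a" "b \<le> R" using assms(7-9) e(1) by (auto simp: a_def b_def)
  have sub: "{a<..<b} \<inter> B = {}"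
    using e(2) by (auto simp: a_def b_def ball_def dist_real_def abs_less_iff subset_iff)
  let ?U = "\<Union>i\<in>I. {l i<..<r i}"
  have "measure lborel ?U = (\<Sum>i\<in>I. measure lborel {l i<..<r i})"
    using fin disj lr(1) by (intro measure_finite_Union) (auto simp: less_imp_le)
  also have "\<dots> = (\<Sum>i\<in>I. r i - l i)" using lr(1) by (intro sum.cong) (auto simp: less_imp_le)
  finally have mU: "measure lborel ?U \<ge> R - L" using total by simp
  have "?U \<inter> {a<..<b} = {}" using sub by (fastforce simp: B_def)
  moreover have fU: "emeasure lborel ?U \<noteq> \<infinity>"
  proof -
    have "emeasure lborel ?U \<le> emeasure lborel {L..R}" using lr by (intro emeasure_mono) fastforce+
    then show ?thesis using assms(7) by (auto simp: top_unique)
  qed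
  ultimately have m: "measure lborel (?U \<union> {a<..<b}) = measure lborel ?U + measure lborel {a<..<b}"
    using ab(1) fin by (intro measure_Union) auto
  have "measure lborel (?U \<union> {a<..<b}) \<le> measure lborel {L..R}"
    using lr ab fin assms(7) by (intro measure_mono_fmeasurable) (fastforce simp: fmeasurable_def)+
  then show False using m mU ab assms(7) by simp
qed

lemma edges_span:
  assumes "\<And>j. j < 5 \<Longrightarrow> cross u (edge j) = 0"
  shows "u = 0"
proof -
  have "cross (edge 0) (edge 1) = supp 0 (vertex 2)"
    by (simp add: supp_def edge_def cross_def numeral_2_eq_2 algebra_simps)
  moreover have "supp 0 (vertex 2) \<noteq> 0" using supp_vertex[of 0 2] by auto
  ultimately have c: "cross (edge 0) (edge 1) \<noteq> 0" by simp
  have e: "Re u * Im (edge j) = Im u * Re (edge j)" if "j < 5" for j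
    using assms[OF that] by (simp add: cross_def)
  have "Re u * cross (edge 0) (edge 1) = Re (edge 0) * (Re u * Im (edge 1)) - (Re u * Im (edge 0)) * Re (edge 1)"
    by (simp add: cross_def algebra_simps)
  also have "\<dots> = 0" using e[of 0] e[of 1] by simp
  finally have 1: "Re u = 0" using c by simp
  have "Im u * cross (edge 0) (edge 1) = (Im u * Re (edge 0)) * Im (edge 1) - Im (edge 0) * (Im u * Re (edge 1))"
    by (simp add: cross_def algebra_simps)
  also have "\<dots> = 0" using e[of 0, symmetric] e[of 1, symmetric] by simp
  finally have 2: "Im u = 0" using c by simp
  show ?thesis using 1 2 by (simp add: complex_eq_iff)
qed

lemma first_above:
  fixes g :: "nat \<Rightarrow> real"
  assumes "g a \<le> y" "y < g b" "\<And>m. g (m + 5) = g m"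
  shows "\<exists>j. g j \<le> y \<and> y < g (Suc j)"
proof -
  have per: "g (m + 5 * k) = g m" for m k
  proof (induction k)
    case (Suc k)
    have "g (m + 5 * Suc k) = g (m + 5 * k + 5)" by (simp add: algebra_simps)
    then show ?case using Suc assms(3) by simp
  qed simp
  show ?thesis
  proof (rule ccontr)
    assume no: "\<not> ?thesis"
    have "g (a + k) \<le> y" for k
      by (induction k) (use no assms(1) in \<open>auto simp: not_less\<close>)
    \<comment> \<open>The index \<open>a + (4 * a + b)\<close> differs from \<open>b\<close> by a
      multiple of the period and does not come before \<open>a\<close>.\<close>
    from this[of "4 * a + b"] per[of b a] assms(2) show False by (simp add: algebra_simps)
  qed
qed

lemma exists_le_weighted_mean:
  fixes c g :: "'i \<Rightarrow> real"
  assumes "finite I" "\<And>m. m \<in> I \<Longrightarrow> c m \<ge> 0" "(\<Sum>m\<in>I. c m) = 1"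
  shows "\<exists>m\<in>I. g m \<le> (\<Sum>m\<in>I. c m * g m)"
proof (rule ccontr)
  let ?y = "\<Sum>m\<in>I. c m * g m"
  assume no: "\<not> ?thesis"
  have "(\<Sum>m\<in>I. c m * ?y) < ?y"
  proof (rule sum_strict_mono_ex1[OF assms(1)])
    show "\<forall>m\<in>I. c m * ?y \<le> c m * g m"
      using no assms(2) by (auto intro!: mult_left_mono simp: not_le less_imp_le)
    obtain m where "m \<in> I" "c m \<noteq> 0" using assms(3) by (metis sum.neutral zero_neq_one)
    then show "\<exists>m\<in>I. c m * ?y < c m * g m"
      using no assms(2)[of m] by (intro bexI[of _ m]) (auto simp: not_le)
  qed
  then show False using assms(3) by (simp flip: sum_distrib_right)
qed

text \<open>As \<open>z\<close> is a mean of the vertices, some vertices lie at or below its level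
  of \<open>cross u\<close> and some at or above it. Going round the polygon, some edge passes the
  level upwards, and upwards means that lines of direction \<open>u\<close> leave there.\<close>

lemma exists_weak_exit:
  assumes u: "u \<noteq> 0" and z: "z \<in> polygon \<epsilon>"
  shows "\<exists>j<5. cross u (sg \<epsilon> *\<^sub>R edge j) > 0 \<and> cross u (sg \<epsilon> *\<^sub>R vertex j) \<le> cross u z \<and>
    cross u z \<le> cross u (sg \<epsilon> *\<^sub>R vertex (Suc j))"
proof -
  define g where "g m = cross u (sg \<epsilon> *\<^sub>R vertex m)" for m
  have per: "g (m + 5) = g m" for m by (simp add: g_def vertex_plus5)
  have gm: "g (m mod 5) = g m" for m by (simp add: g_def vertex_mod)
  have gS: "g (Suc (m mod 5)) = g (Suc m)" for m
    using gm[of "Suc (m mod 5)"] gm[of "Suc m"] by (simp add: mod_Suc_eq)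
  obtain c where c: "\<And>m. m < 5 \<Longrightarrow> c m \<ge> 0" "(\<Sum>m<5. c m) = (1::real)" "sg \<epsilon> *\<^sub>R z = (\<Sum>m<5. c m *\<^sub>R vertex m)"
    using pentagon_convex_comb z by (metis mem_polygon)
  have "z = sg \<epsilon> *\<^sub>R sg \<epsilon> *\<^sub>R z" by simp
  then have y: "cross u z = (\<Sum>m<5. c m * g m)"
    unfolding c(3) by (simp add: g_def cross_sum_right cross_scaleR_right sum_distrib_left mult.left_commute)
  have ex_le: "\<exists>m. g m \<le> cross u z"
    using exists_le_weighted_mean[of "{..<5}" c g] c(1,2) unfolding y by auto
  have ex_ge: "\<exists>m. g m \<ge> cross u z"
    using exists_le_weighted_mean[of "{..<5}" c "\<lambda>m. - g m"] c(1,2) unfolding y by (auto simp: sum_negf)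
  have "\<exists>j. g j < g (Suc j) \<and> g j \<le> cross u z \<and> cross u z \<le> g (Suc j)"
  proof (cases "\<exists>m. cross u z < g m")
    case True
    then obtain b where "cross u z < g b" by blast
    moreover obtain a where "g a \<le> cross u z" using ex_le by blast
    ultimately show ?thesis using first_above[of g a "cross u z" b] per by force
  next
    case False
    then obtain b where b: "g b = cross u z" using ex_ge by (metis antisym_conv not_less)
    obtain a where a: "g a < cross u z"
    proof (rule ccontr)
      assume "\<not> thesis"
      then have "g m = cross u z" for m using that False by (meson antisym_conv not_less)
      then have "cross u (edge j) = 0" for j
        using g_def[of j] g_def[of "Suc j"] by (simp add: edge_def cross_linear)
      with edges_span[of u] u show False by blast
    qed
    \<comment> \<open>If no vertex lies above the level, the passage is sought at the highest vertex
      value below it; the edge found there ends at the top.\<close>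
    define y' where "y' = Max (g ` {m\<in>{..<5}. g m < cross u z})"
    have fin: "finite (g ` {m\<in>{..<5}. g m < cross u z})" by simp
    have ne: "g ` {m\<in>{..<5}. g m < cross u z} \<noteq> {}"
      using a gm[of a] by (auto intro!: exI[of _ "a mod 5"])
    have y'less: "y' < cross u z" using Max_in[OF fin ne] by (auto simp: y'_def)
    have y': "g m \<le> y' \<or> cross u z \<le> g m" for m
    proof (cases "g m < cross u z")
      case True
      then have "g (m mod 5) \<in> g ` {m\<in>{..<5}. g m < cross u z}" by (intro imageI) (simp add: gm)
      from Max_ge[OF fin this] show ?thesis by (simp add: y'_def gm)
    qed auto
    have "g a \<le> y'" using y'[of a] a by auto
    with first_above[of g a y' b] per b y'less obtain j where "g j \<le> y'" "y' < g (Suc j)" by auto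
    with y'[of "Suc j"] y'less show ?thesis by (intro exI[of _ j]) auto
  qed
  then obtain j where j: "g j < g (Suc j)" "g j \<le> cross u z" "cross u z \<le> g (Suc j)" by blast
  have e: "cross u (sg \<epsilon> *\<^sub>R edge m) = g (Suc m) - g m" for m
    by (simp add: g_def edge_def cross_linear algebra_simps)
  show ?thesis
    using j by (intro exI[of _ "j mod 5"]) (auto simp: e gm gS simp flip: g_def)
qed

text \<open>A direction fixes the velocity only up to sign; reversing time reduces one sign to the
  other.\<close>

lemma trajectory_reverse:
  assumes "trajectory (- u) \<gamma>"
  shows "trajectory u (\<lambda>t. \<gamma> (- t))"
  unfolding trajectory_def
proof (intro conjI allI)
  show "cmod u = 1" using assms by (simp add: trajectory_def)
  fix t
  show "\<gamma> (- t) \<noteq> cone_point" using assms by (simp add: trajectory_def)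
  obtain \<delta> \<epsilon> z where d: "\<delta> > 0" "\<And>s. s \<in> {-\<delta><..0} \<Longrightarrow> z + s *\<^sub>R - u \<in> polygon \<epsilon> \<and> \<gamma> (- t + s) = point (\<epsilon>, z + s *\<^sub>R - u)"
    using assms unfolding trajectory_def by meson
  show "\<exists>\<delta>>0. \<exists>\<epsilon> z. \<forall>s\<in>{0..<\<delta>}. z + s *\<^sub>R u \<in> polygon \<epsilon> \<and> \<gamma> (- (t + s)) = point (\<epsilon>, z + s *\<^sub>R u)"
  proof (intro exI[of _ \<delta>] conjI d(1) exI[of _ \<epsilon>] exI[of _ z] ballI)
    fix s assume "s \<in> {0..<\<delta>}"
    then have "- s \<in> {-\<delta><..0}" by auto
    from d(2)[OF this] show "z + s *\<^sub>R u \<in> polygon \<epsilon>" "\<gamma> (- (t + s)) = point (\<epsilon>, z + s *\<^sub>R u)" by simp_all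
  qed
  obtain \<delta> \<epsilon> z where d: "\<delta> > 0" "\<And>s. s \<in> {0..<\<delta>} \<Longrightarrow> z + s *\<^sub>R - u \<in> polygon \<epsilon> \<and> \<gamma> (- t + s) = point (\<epsilon>, z + s *\<^sub>R - u)"
    using assms unfolding trajectory_def by meson
  show "\<exists>\<delta>>0. \<exists>\<epsilon> z. \<forall>s\<in>{-\<delta><..0}. z + s *\<^sub>R u \<in> polygon \<epsilon> \<and> \<gamma> (- (t + s)) = point (\<epsilon>, z + s *\<^sub>R u)"
  proof (intro exI[of _ \<delta>] conjI d(1) exI[of _ \<epsilon>] exI[of _ z] ballI)
    fix s assume "s \<in> {-\<delta><..0}"
    then have "- s \<in> {0..<\<delta>}" by auto
    from d(2)[OF this] show "z + s *\<^sub>R u \<in> polygon \<epsilon>" "\<gamma> (- (t + s)) = point (\<epsilon>, z + s *\<^sub>R u)" by simp_all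
  qed
qed

lemma exists_cross: "cmod u = 1 \<Longrightarrow> \<exists>z. cross u z = y"
proof -
  assume u: "cmod u = 1"
  have "Re u * Re u + Im u * Im u = 1"
    using u by (metis cmod_power2 one_power2 power2_eq_square)
  then have "cross u (y *\<^sub>R (\<i> * u)) = y" by (simp add: cross_def algebra_simps flip: distrib_left)
  then show ?thesis by blast
qed

text \<open>
  The cylinder of the word \<open>w\<close> has circumference \<open>len w\<close> and height at least \<open>H w\<close>; \<open>covers\<close> says
  that the cylinders fill every side of the pentagon, so that the heights are exact and every closed
  trajectory lies in one of them.
\<close>

locale cylinders =
  fixes u :: complex and W :: "nat list set" and len H :: "nat list \<Rightarrow> real"
  assumes unit: "cmod u = 1" and fin: "finite W"
    and word: "w \<in> W \<Longrightarrow> word w"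
    and hol: "w \<in> W \<Longrightarrow> hol w = len w *\<^sub>R u" and len: "w \<in> W \<Longrightarrow> len w > 0"
    and H: "w \<in> W \<Longrightarrow> H w > 0" and height: "w \<in> W \<Longrightarrow> H w \<le> hi u w - lo u w"
    and covers: "j < 5 \<Longrightarrow> cross u (edge j) = (\<Sum>w\<in>W. (\<Sum>i | i < length w \<and> w ! i = j. sg (even i)) * H w)"
    and distinct: "\<lbrakk>w \<in> W; w' \<in> W; real (length w') * len w = real (length w) * len w'\<rbrakk> \<Longrightarrow> w = w'"
    and indivisible: "\<lbrakk>w \<in> W; d > 0; even d;
      real (length w) *\<^sub>R (Cen w (i + d) - Cen w i) = of_int d *\<^sub>R hol w\<rbrakk> \<Longrightarrow> int (length w) dvd d"
begin

lemma lo_less_hi: "w \<in> W \<Longrightarrow> lo u w < hi u w"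
  using H[of w] height[of w] by linarith

lemma length_pos: "w \<in> W \<Longrightarrow> length w > 0"
  using word[of w] by (simp add: word_def)

lemma even_length: "w \<in> W \<Longrightarrow> even (length w)"
  using word[of w] by (simp add: word_def)

lemma lower_period: "w \<in> W \<Longrightarrow> lower u w (i + int (length w)) = lower u w i"
  and upper_period: "w \<in> W \<Longrightarrow> upper u w (i + int (length w)) = upper u w i"
  using even_length[of w] unfolding lower_def upper_def
  by (simp_all add: Cen_period word letter_period hol cross_linear)

lemma lower_le: "w \<in> W \<Longrightarrow> lower u w i \<le> lo u w"
proof -
  assume w: "w \<in> W"
  have "lower u w i = lower u w (int (nat (i mod int (length w))))"
    by (rule periodic_int[where P = "lower u w", OF length_pos[OF w] lower_period[OF w]])
  also have "\<dots> \<le> lo u w"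
    unfolding lo_def using length_pos[OF w]
    by (intro Max_ge imageI[of "nat (i mod int (length w))" _ "\<lambda>i. lower u w (int i)"]) (simp_all add: nat_less_iff)
  finally show ?thesis .
qed

lemma upper_ge: "w \<in> W \<Longrightarrow> hi u w \<le> upper u w i"
proof -
  assume w: "w \<in> W"
  have "hi u w \<le> upper u w (int (nat (i mod int (length w))))"
    unfolding hi_def using length_pos[OF w]
    by (intro Min_le imageI[of "nat (i mod int (length w))" _ "\<lambda>i. upper u w (int i)"]) (simp_all add: nat_less_iff)
  also have "\<dots> = upper u w i"
    by (rule periodic_int[where P = "upper u w", OF length_pos[OF w] upper_period[OF w], symmetric])
  finally show ?thesis .
qed

text \<open>Only crossings from \<open>i\<close> onwards are required because trajectories are
  followed forwards; by periodicity every crossing recurs among them.\<close>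

lemma between_iff:
  assumes w: "w \<in> W"
  shows "lo u w < y \<and> y < hi u w \<longleftrightarrow> (\<forall>m::nat. lower u w (i + int m) < y \<and> y < upper u w (i + int m))"
proof
  assume "lo u w < y \<and> y < hi u w"
  then show "\<forall>m::nat. lower u w (i + int m) < y \<and> y < upper u w (i + int m)"
    using lower_le[OF w] upper_ge[OF w] by (meson le_less_trans less_le_trans)
next
  assume *: "\<forall>m::nat. lower u w (i + int m) < y \<and> y < upper u w (i + int m)"
  have all: "lower u w k < y \<and> y < upper u w k" for k
  proof -
    define P where "P k \<longleftrightarrow> lower u w k < y \<and> y < upper u w k" for k
    have per: "P (k + int (length w)) = P k" for k
      by (simp add: P_def lower_period upper_period w)
    have "P (k + int (length w) * int m) = P k" for m
    proof (induction m)
      case (Suc m)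
      have "k + int (length w) * int (Suc m) = k + int (length w) * int m + int (length w)"
        by (simp add: algebra_simps)
      then show ?case using Suc per by metis
    qed simp
    moreover have "k + int (length w) * int (nat \<bar>i - k\<bar>) \<ge> i"
    proof -
      have "int 1 * int (nat \<bar>i - k\<bar>) \<le> int (length w) * int (nat \<bar>i - k\<bar>)"
        using Suc_leI[OF length_pos[OF w]] by (intro mult_right_mono) auto
      then show ?thesis by simp
    qed
    then have "P (k + int (length w) * int (nat \<bar>i - k\<bar>))"
      using *[rule_format, of "nat (k + int (length w) * int (nat \<bar>i - k\<bar>) - i)"] by (simp add: P_def)
    ultimately have "P k" by blast
    then show ?thesis by (simp only: P_def)
  qed
  have ne: "{..<length w} \<noteq> {}" using length_pos[OF w] by auto
  then show "lo u w < y \<and> y < hi u w"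
    unfolding lo_def hi_def using all by (auto simp: Max_less_iff Min_gr_iff)
qed

lemma exits_iff: "w \<in> W \<Longrightarrow> exits u (cross u (z - Cen w i)) (even i) (letter w i) \<longleftrightarrow>
    lower u w i < cross u z \<and> cross u z < upper u w i"
  using letter_less[OF word] unfolding exits_def lower_def upper_def by (auto simp: cross_linear)

lemma periodic_itinerary:
  assumes w: "w \<in> W" and "lo u w < cross u z" "cross u z < hi u w"
  shows "periodic_itinerary u z (letter w) (Cen w) (int (length w)) (len w)"
proof unfold_locales
  show "exits u (cross u (z - Cen w i)) (even i) (letter w i)" for i
    unfolding exits_iff[OF w] using assms lower_le[OF w, of i] upper_ge[OF w, of i] by linarith
qed (use w unit len length_pos even_length in \<open>simp_all add: Cen_Suc word letter_period Cen_period hol\<close>)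

text \<open>If the letters repeat after \<open>d\<close> steps, then \<open>length w\<close>
  repetitions give \<open>length w\<close> times one displacement, but they are also
  \<open>d\<close> full periods of the word. So the displacement is the rational multiple of
  \<open>hol w\<close> that \<open>indivisible\<close> speaks of.\<close>

lemma letter_indivisible:
  assumes w: "w \<in> W" and d: "d > 0" "even d"
    and eq: "\<And>m::nat. letter w (i + int m + d) = letter w (i + int m)"
  shows "int (length w) dvd d"
proof -
  have C: "Cen w (i + d + int m) - Cen w (i + d) = Cen w (i + int m) - Cen w i" for m
  proof (induction m)
    case (Suc m)
    have S: "Cen w (k + int (Suc m)) = Cen w (k + int m) + sg (even (k + int m)) *\<^sub>R hop (letter w (k + int m))" for k
      using Cen_Suc[OF word[OF w], of "k + int m"] by (simp add: algebra_simps)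
    have "letter w (i + d + int m) = letter w (i + int m)" using eq[of m] by (simp add: algebra_simps)
    moreover have "even (i + d + int m) = even (i + int m)" using d(2) by simp
    ultimately have "Cen w (i + d + int (Suc m)) - Cen w (i + d) =
        (Cen w (i + d + int m) - Cen w (i + d)) + sg (even (i + int m)) *\<^sub>R hop (letter w (i + int m))"
      unfolding S[of "i + d"] by simp
    then show ?case unfolding Suc S[of i] by simp
  qed simp
  have "Cen w (i + int k * d) - Cen w i = real k *\<^sub>R (Cen w (i + d) - Cen w i)" for k
  proof (induction k)
    case (Suc k)
    have "Cen w (i + int (Suc k) * d) - Cen w (i + d) = Cen w (i + int k * d) - Cen w i"
      using C[of "nat (int k * d)"] d(1) by (simp add: algebra_simps)
    also have "\<dots> = real k *\<^sub>R (Cen w (i + d) - Cen w i)" by (rule Suc)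
    finally have *: "Cen w (i + int (Suc k) * d) - Cen w (i + d) = real k *\<^sub>R (Cen w (i + d) - Cen w i)" .
    have "Cen w (i + int (Suc k) * d) - Cen w i =
        (Cen w (i + int (Suc k) * d) - Cen w (i + d)) + (Cen w (i + d) - Cen w i)" by simp
    also have "\<dots> = real (Suc k) *\<^sub>R (Cen w (i + d) - Cen w i)"
      unfolding * by (simp only: of_nat_Suc scaleR_add_left scaleR_one add.commute)
    finally show ?case .
  qed simp
  from this[of "length w"]
  have "real (length w) *\<^sub>R (Cen w (i + d) - Cen w i) = Cen w (i + d * int (length w)) - Cen w i"
    by (simp add: mult.commute)
  also have "\<dots> = of_int d *\<^sub>R hol w"
  proof -
    have "Cen w (i + int k * int (length w)) - Cen w i = real k *\<^sub>R hol w" for k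
    proof (induction k)
      case (Suc k)
      have "Cen w (i + int (Suc k) * int (length w)) = Cen w (i + int k * int (length w) + int (length w))"
        by (simp add: algebra_simps)
      also have "\<dots> = Cen w (i + int k * int (length w)) + hol w" by (rule Cen_period[OF word[OF w]])
      finally show ?case using Suc by (simp add: algebra_simps)
    qed simp
    from this[of "nat d"] d(1) show ?thesis by simp
  qed
  finally show ?thesis using indivisible[OF w d] by simp
qed

lemma primitive_itinerary:
  assumes w: "w \<in> W" and "lo u w < cross u z" "cross u z < hi u w"
  shows "primitive_itinerary u z (letter w) (Cen w) (int (length w)) (len w)"
proof -
  interpret periodic_itinerary u z "letter w" "Cen w" "int (length w)" "len w"
    by (rule periodic_itinerary[OF assms])
  show ?thesis by unfold_locales (rule letter_indivisible[OF w])
qed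

text \<open>Lines at equal relative positions have the same future. After
  \<open>n * length w'\<close> steps the displacements are \<open>length w'\<close> times
  \<open>len w\<close> and \<open>n\<close> times \<open>len w'\<close>, and \<open>distinct\<close>
  excludes equality for different words. The first itinerary is left general so that a reversed one
  can be inserted.\<close>

lemma same_word:
  assumes it: "periodic_itinerary u z J C (int n) (len w)" "w \<in> W" "length w = n"
    and w': "w' \<in> W" "even i = even i'"
    and y: "lo u w' < cross u (z - C i) + cross u (Cen w' i')" "cross u (z - C i) + cross u (Cen w' i') < hi u w'"
  shows "w = w'" "J (i + int m) = letter w' (i' + int m)"
proof -
  interpret a: periodic_itinerary u z J C "int n" "len w" by (rule it(1))
  obtain z' where z': "cross u z' = cross u (z - C i) + cross u (Cen w' i')"
    using exists_cross[OF unit] by blast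
  interpret b: periodic_itinerary u z' "letter w'" "Cen w'" "int (length w')" "len w'"
    using w'(1) y unfolding z'[symmetric] by (rule periodic_itinerary)
  have d: "J (i + int m) = letter w' (i' + int m) \<and> C (i + int m) - C i = Cen w' (i' + int m) - Cen w' i'" for m
    by (rule itinerary_deterministic[OF a.itinerary_axioms b.itinerary_axioms w'(2)])
      (simp add: cross_diff_right z')
  then show "J (i + int m) = letter w' (i' + int m)" by blast
  have 1: "C (i + int k * int n) - C i = (real k * len w) *\<^sub>R u" for k
  proof (induction k)
    case (Suc k)
    have "C (i + int (Suc k) * int n) = C (i + int k * int n + int n)" by (simp add: algebra_simps)
    also have "\<dots> = C (i + int k * int n) + len w *\<^sub>R u" by (rule a.C_period)
    finally show ?case using Suc by (simp add: algebra_simps)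
  qed simp
  have 2: "Cen w' (i' + int k * int (length w')) - Cen w' i' = (real k * len w') *\<^sub>R u" for k
  proof (induction k)
    case (Suc k)
    have "Cen w' (i' + int (Suc k) * int (length w')) = Cen w' (i' + int k * int (length w') + int (length w'))" by (simp add: algebra_simps)
    also have "\<dots> = Cen w' (i' + int k * int (length w')) + len w' *\<^sub>R u" by (rule b.C_period)
    finally show ?case using Suc by (simp add: algebra_simps)
  qed simp
  have "(real (length w') * len w) *\<^sub>R u = (real n * len w') *\<^sub>R u"
    using 1[of "length w'"] 2[of n] d[of "length w' * n"] by (simp add: mult.commute)
  moreover have "u \<noteq> 0" using unit by auto
  ultimately have "real (length w') * len w = real (length w) * len w'" by (simp add: it(3))
  from distinct[OF it(2) w'(1) this] show "w = w'" .
qed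

text \<open>Two passages of cylinders through a polygon at the same height have the same future; by
  the two arithmetic assumptions they are then the same passage up to full periods.\<close>

lemma disjoint_positions:
  assumes w: "w \<in> W" "w' \<in> W" "even i = even i'"
    and y: "lo u w < y + cross u (Cen w i)" "y + cross u (Cen w i) < hi u w"
      "lo u w' < y + cross u (Cen w' i')" "y + cross u (Cen w' i') < hi u w'"
  shows "w = w' \<and> int (length w) dvd i' - i"
proof -
  obtain z where z: "cross u z = y + cross u (Cen w i)" using exists_cross[OF unit] by blast
  have it: "periodic_itinerary u z (letter w) (Cen w) (int (length w)) (len w)"
    using w y z by (intro periodic_itinerary) auto
  have y': "cross u (z - Cen w i) = y" by (simp add: z cross_linear)
  have sw: "w = w'" "letter w (i + int m) = letter w' (i' + int m)" for m
    using same_word[OF it w(1) refl w(2,3)] y unfolding y' by blast+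
  have div: "int (length w) dvd j - k" if "k < j" "even k = even j"
    "\<And>m::nat. letter w (k + int m) = letter w (j + int m)" for j k
    using that by (intro letter_indivisible[OF w(1), of _ k]) (auto simp: algebra_simps)
  consider "i < i'" | "i' < i" | "i = i'" by linarith
  then have "int (length w) dvd i' - i"
  proof cases
    case 1 then show ?thesis using div[of i i'] sw w(3) by simp
  next
    case 2 then show ?thesis using div[of i' i] sw w(3) by (simp add: dvd_diff_commute)
  qed simp
  with sw show ?thesis by simp
qed

text \<open>Each occurrence of \<open>j\<close> in a word marks an open interval on the side. These
  intervals are disjoint, and by \<open>covers\<close> and \<open>height\<close> their total length
  is at least the width of the side across \<open>u\<close>, so their closures leave no gap.\<close>

lemma side_covered:
  assumes j: "j < 5" "cross u (sg \<epsilon> *\<^sub>R edge j) > 0"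
    and y: "cross u (sg \<epsilon> *\<^sub>R vertex j) \<le> y" "y \<le> cross u (sg \<epsilon> *\<^sub>R vertex (Suc j))"
  shows "\<exists>w\<in>W. \<exists>i. even i = \<epsilon> \<and> letter w i = j \<and> lo u w \<le> y + cross u (Cen w i) \<and> y + cross u (Cen w i) \<le> hi u w"
proof -
  define I where "I = (SIGMA w:W. {i. i < length w \<and> w ! i = j})"
  have finI: "finite I" unfolding I_def using fin by (intro finite_SigmaI) auto
  define l where "l = (\<lambda>(w, i). lo u w - cross u (Cen w (int i)))"
  define r where "r = (\<lambda>(w, i). hi u w - cross u (Cen w (int i)))"
  \<comment> \<open>Lines of direction \<open>u\<close> cross a given side always in the same sense.
    This forces the parity of each crossing, so the signed count in \<open>covers\<close> is an
    unsigned one up to a common sign.\<close>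
  have par: "even i = \<epsilon>" if "(w, i) \<in> I" for w i
  proof -
    have w: "w \<in> W" "i < length w" "w ! i = j" using that by (auto simp: I_def)
    have "lower u w (int i) < upper u w (int i)"
      using lower_le[OF w(1), of "int i"] upper_ge[OF w(1), of "int i"] lo_less_hi[OF w(1)] by linarith
    then have "sg (even i) * cross u (edge j) > 0"
      unfolding lower_def upper_def using w by (simp add: letter_nat edge_def cross_linear algebra_simps)
    then show ?thesis using j(2) by (cases "even i"; cases \<epsilon>) (auto simp: sg_def cross_linear)
  qed
  have "\<exists>x\<in>I. l x \<le> y \<and> y \<le> r x"
  proof (rule disjoint_intervals_cover[OF finI])
    fix x assume "x \<in> I"
    then obtain w i where x: "x = (w, i)" "w \<in> W" "i < length w" "w ! i = j" by (auto simp: I_def)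
    have e: "even i = \<epsilon>" using par \<open>x \<in> I\<close> x by blast
    show "l x < r x" using lo_less_hi[OF x(2)] by (simp add: l_def r_def x)
    show "cross u (sg \<epsilon> *\<^sub>R vertex j) \<le> l x"
      using lower_le[OF x(2), of "int i"] x e by (simp add: l_def lower_def letter_nat cross_linear)
    show "r x \<le> cross u (sg \<epsilon> *\<^sub>R vertex (Suc j))"
      using upper_ge[OF x(2), of "int i"] x e by (simp add: r_def upper_def letter_nat cross_linear)
  next
    show "disjoint_family_on (\<lambda>x. {l x<..<r x}) I"
      unfolding disjoint_family_on_def
    proof (intro ballI impI)
      fix x x' assume xx: "x \<in> I" "x' \<in> I" "x \<noteq> x'"
      obtain w i w' i' where x: "x = (w, i)" "x' = (w', i')" by (cases x, cases x')
      have W: "w \<in> W" "w' \<in> W" "i < length w" "i' < length w'" using xx by (auto simp: I_def x)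
      have False if "q \<in> {l x<..<r x}" "q \<in> {l x'<..<r x'}" for q
      proof -
        have "w = w' \<and> int (length w) dvd int i' - int i"
          using that par xx W unfolding x
          by (intro disjoint_positions[where y = q]) (auto simp: l_def r_def algebra_simps)
        moreover have "\<bar>int i' - int i\<bar> < int (length w)" using W calculation by auto
        ultimately show False using xx(3) zdvd_not_zless[of "\<bar>int i' - int i\<bar>" "int (length w)"]
          by (auto simp: x)
      qed
      then show "{l x<..<r x} \<inter> {l x'<..<r x'} = {}" by blast
    qed
  next
    have "cross u (sg \<epsilon> *\<^sub>R edge j) = sg \<epsilon> * (\<Sum>w\<in>W. (\<Sum>i | i < length w \<and> w ! i = j. sg (even i)) * H w)"
      by (simp add: cross_linear covers[OF j(1)])
    also have "\<dots> = (\<Sum>w\<in>W. \<Sum>i | i < length w \<and> w ! i = j. H w)"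
      unfolding sum_distrib_left sum_distrib_right
    proof (intro sum.cong refl)
      fix w i assume "w \<in> W" "i \<in> {i. i < length w \<and> w ! i = j}"
      then have "even i = \<epsilon>" by (intro par) (auto simp: I_def)
      then show "sg \<epsilon> * (sg (even i) * H w) = H w" by simp
    qed
    also have "\<dots> = (\<Sum>(w, i)\<in>I. H w)" unfolding I_def using fin by (intro sum.Sigma) auto
    also have "\<dots> \<le> (\<Sum>x\<in>I. r x - l x)"
      using height by (intro sum_mono) (auto simp: I_def l_def r_def)
    finally show "cross u (sg \<epsilon> *\<^sub>R vertex (Suc j)) - cross u (sg \<epsilon> *\<^sub>R vertex j) \<le> (\<Sum>x\<in>I. r x - l x)"
      by (simp add: edge_def cross_linear algebra_simps)
  next
    show "cross u (sg \<epsilon> *\<^sub>R vertex j) < cross u (sg \<epsilon> *\<^sub>R vertex (Suc j))"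
      using j(2) by (simp add: edge_def cross_linear algebra_simps)
  qed (use y in auto)
  then obtain w i where x: "(w, i) \<in> I" "l (w, i) \<le> y" "y \<le> r (w, i)" by force
  show ?thesis
  proof (intro bexI[of _ w] exI[of _ "int i"] conjI)
    show "even (int i) = \<epsilon>" using par[OF x(1)] by simp
  qed (use x in \<open>auto simp: I_def l_def r_def letter_nat algebra_simps\<close>)
qed

text \<open>The heights of those lines of direction \<open>u\<close> in the polygon of sheet
  \<open>\<epsilon>\<close>, centred at 0, that belong to the cylinder of \<open>w\<close>.\<close>

definition shadow :: "bool \<Rightarrow> nat list \<Rightarrow> real set" where
  "shadow \<epsilon> w = {y. \<exists>i. even i = \<epsilon> \<and> lo u w < y + cross u (Cen w i) \<and> y + cross u (Cen w i) < hi u w}"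

text \<open>
  A line on the boundary of a cylinder satisfies the weak inequalities defining it; if it never
  runs into a vertex, then they are all strict.
\<close>

lemma trajectory_in_shadow:
  assumes tr: "trajectory u \<gamma>" and g: "\<gamma> t = point (\<epsilon>, z)" "z \<in> polygon \<epsilon>"
  shows "\<exists>w\<in>W. cross u z \<in> shadow \<epsilon> w"
proof -
  have "u \<noteq> 0" using unit by auto
  from exists_weak_exit[OF this g(2)] side_covered obtain w i
    where w: "w \<in> W" "even i = \<epsilon>" "lo u w \<le> cross u z + cross u (Cen w i)" "cross u z + cross u (Cen w i) \<le> hi u w"
    by metis
  define Y where "Y = cross u z + cross u (Cen w i)"
  \<comment> \<open>\<open>Y\<close> is the height of the line in developed coordinates, constant
    along the trajectory; \<open>reach m\<close> says that the trajectory arrives in the polygon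
    \<open>m\<close> steps after the start.\<close>
  define reach where "reach m \<longleftrightarrow> (\<exists>\<tau> x. \<gamma> \<tau> = point (even (i + int m), x) \<and> x \<in> polygon (even (i + int m)) \<and>
    cross u x = Y - cross u (Cen w (i + int m)))" for m
  have step: "lower u w (i + int m) < Y \<and> Y < upper u w (i + int m) \<and> reach (Suc m)" if r: "reach m" for m
  proof -
    define k e j where "k = i + int m" and "e = even k" and "j = letter w k"
    obtain \<tau> x where x: "\<gamma> \<tau> = point (e, x)" "x \<in> polygon e" "cross u x = Y - cross u (Cen w k)"
      using r unfolding reach_def k_def e_def by blast
    have b: "lower u w k < upper u w k" "lower u w k \<le> Y" "Y \<le> upper u w k"
      using w lower_le[OF w(1), of k] upper_ge[OF w(1), of k] lo_less_hi[OF w(1)] unfolding Y_def by linarith+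
    have jj: "j < 5" unfolding j_def by (rule letter_less[OF word[OF w(1)]])
    have ed: "cross u (sg e *\<^sub>R edge j) > 0"
      using b(1) unfolding lower_def upper_def edge_def j_def e_def by (simp add: cross_linear algebra_simps)
    have c: "cross u (sg e *\<^sub>R vertex j) \<le> cross u x" "cross u x \<le> cross u (sg e *\<^sub>R vertex (Suc j))"
      using b(2,3) unfolding lower_def upper_def j_def e_def x(3) by (simp_all add: cross_linear)
    let ?q = "exit_point u (cross u x) e j"
    note q = exit_point_weak[OF jj ed c]
    obtain \<rho> where \<rho>: "\<rho> \<ge> 0" "?q = x + \<rho> *\<^sub>R u"
      using exit_ahead_weak[OF unit jj ed x(2) q(3,1) q(2)[symmetric]] .
    have gq: "\<gamma> (\<tau> + \<rho>) = point (e, ?q)"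
      using trajectory_in_polygon[OF tr x(1,2) _ \<rho>(1) order_refl] q(3) \<rho>(2) by simp
    have "\<gamma> (\<tau> + \<rho>) \<noteq> cone_point" using tr by (simp add: trajectory_def)
    then have ns: "\<not> singular (e, ?q)" unfolding gq point_eq_cone .
    have strict: "lower u w k \<noteq> Y" "Y \<noteq> upper u w k"
    proof -
      show "lower u w k \<noteq> Y"
      proof
        assume "lower u w k = Y"
        then have "cross u x = cross u (sg e *\<^sub>R vertex j)"
          unfolding lower_def x(3) j_def e_def by (simp add: cross_linear)
        then have "sg e *\<^sub>R ?q = vertex j" by (simp add: exit_point_def)
        with ns singular_Suc show False by blast
      qed
      show "Y \<noteq> upper u w k"
      proof
        assume "Y = upper u w k"
        then have "cross u x = cross u (sg e *\<^sub>R vertex (Suc j))"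
          unfolding upper_def x(3) j_def e_def by (simp add: cross_linear)
        then have "cross u x - cross u (sg e *\<^sub>R vertex j) = cross u (sg e *\<^sub>R edge j)"
          by (simp add: edge_def cross_linear algebra_simps)
        then have "sg e *\<^sub>R ?q = vertex (Suc j)" using ed by (simp add: exit_point_def edge_def)
        with ns singular_Suc show False by blast
      qed
    qed
    have "point (e, ?q) = point (\<not> e, ?q - sg e *\<^sub>R hop j)" by (rule point_glue[OF jj q(1)])
    moreover have "?q - sg e *\<^sub>R hop j \<in> polygon (\<not> e)"
    proof -
      have "hop j - sg e *\<^sub>R ?q \<in> side j" using q(1) minus_mem_side by blast
      then show ?thesis using side_subset_pentagon unfolding mem_polygon by (auto simp: algebra_simps)
    qed
    moreover have "Cen w (k + 1) = Cen w k + sg e *\<^sub>R hop j"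
      unfolding e_def j_def by (rule Cen_Suc[OF word[OF w(1)]])
    then have "cross u (?q - sg e *\<^sub>R hop j) = Y - cross u (Cen w (k + 1))"
      using q(2) x(3) by (simp add: cross_linear)
    moreover have e: "i + int (Suc m) = k + 1" "even (k + 1) = (\<not> e)" by (simp_all add: k_def e_def)
    ultimately have "reach (Suc m)"
      unfolding reach_def e using gq by (intro exI[of _ "\<tau> + \<rho>"] exI[of _ "?q - sg e *\<^sub>R hop j"]) (simp only: simp_thms)
    with b strict show ?thesis unfolding k_def by linarith
  qed
  have "reach m" for m
  proof (induction m)
    case 0
    show ?case unfolding reach_def using g w(2) by (intro exI[of _ t] exI[of _ z]) (simp add: Y_def)
  qed (use step in blast)
  then have "lo u w < Y \<and> Y < hi u w" unfolding between_iff[OF w(1), of Y i] using step by blast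
  then show ?thesis using w unfolding shadow_def Y_def by blast
qed


section \<open>The strips are the cylinders\<close>

definition strip :: "nat list \<Rightarrow> surface_point set" where
  "strip w = point ` {x \<in> sheets. cross u (snd x) \<in> shadow (fst x) w}"

lemma mem_sheets: "(\<epsilon>, z) \<in> sheets \<longleftrightarrow> z \<in> polygon \<epsilon>"
  by (simp add: sheets_def)

lemma shadow_itinerary:
  assumes w: "w \<in> W" and z: "cross u z \<in> shadow \<epsilon> w"
  obtains i where "even i = \<epsilon>" "cross u (z + Cen w i - Cen w i) = cross u z"
    "lo u w < cross u (z + Cen w i)" "cross u (z + Cen w i) < hi u w"
proof -
  obtain i where "even i = \<epsilon>" "lo u w < cross u z + cross u (Cen w i)" "cross u z + cross u (Cen w i) < hi u w"
    using z unfolding shadow_def by blast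
  then show thesis by (intro that[of i]) (simp_all add: cross_linear)
qed

text \<open>A regular point has a second chart only on a side, where the line passes from polygon
  \<open>i\<close> to \<open>i + 1\<close> or \<open>i - 1\<close> at the same developed height. So
  the preimage of a strip is saturated, which also gives its openness.\<close>

lemma shadow_saturated:
  assumes w: "w \<in> W" and z: "z \<in> polygon \<epsilon>" "cross u z \<in> shadow \<epsilon> w"
    and eq: "point (\<epsilon>, z) = point (\<epsilon>', z')"
  shows "cross u z' \<in> shadow \<epsilon>' w"
proof -
  obtain i where i: "even i = \<epsilon>" "cross u (z + Cen w i - Cen w i) = cross u z"
    "lo u w < cross u (z + Cen w i)" "cross u (z + Cen w i) < hi u w"
    using shadow_itinerary[OF w z(2)] .
  interpret periodic_itinerary u "z + Cen w i" "letter w" "Cen w" "int (length w)" "len w"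
    by (rule periodic_itinerary[OF w i(3,4)])
  have zi: "z \<in> polygon (even i)" "cross u z = cross u (z + Cen w i - Cen w i)" using z i by simp_all
  have "point (\<epsilon>, z) \<noteq> cone_point"
    using on_line_not_singular[OF zi] i(1) by (simp add: point_eq_cone)
  with eq show ?thesis
  proof (cases rule: point_eq_cases)
    case (2 j)
    have C: "Cen w i = Cen w (i - 1) + sg (even (i - 1)) *\<^sub>R hop (letter w (i - 1))" using C_Suc[of "i - 1"] by simp
    have "sg (even i) *\<^sub>R z \<in> side j" using 2 i(1) by simp
    from on_line_side_cases[OF zi 2(1) this] show ?thesis
    proof
      assume "j = letter w i \<and> z = X i - Cen w i"
      then have "cross u z' + cross u (Cen w (i + 1)) = cross u (z + Cen w i)"
        using 2(4) i(1) C_Suc[of i] by (simp add: cross_linear)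
      then show ?thesis unfolding shadow_def using i 2(2) by (intro CollectI exI[of _ "i + 1"]) auto
    next
      assume "j = letter w (i - 1) \<and> z = X (i - 1) - Cen w i"
      then have "cross u z' + cross u (Cen w (i - 1)) = cross u (z + Cen w i)"
        using 2(4) i(1) C by (simp add: cross_linear)
      then show ?thesis unfolding shadow_def using i 2(2) by (intro CollectI exI[of _ "i - 1"]) auto
    qed
  qed (use z in simp)
qed

lemma point_mem_strip:
  assumes w: "w \<in> W" and z: "z \<in> polygon \<epsilon>"
  shows "point (\<epsilon>, z) \<in> strip w \<longleftrightarrow> cross u z \<in> shadow \<epsilon> w"
proof
  assume "point (\<epsilon>, z) \<in> strip w"
  then obtain \<epsilon>' z' where x: "point (\<epsilon>, z) = point (\<epsilon>', z')" "z' \<in> polygon \<epsilon>'" "cross u z' \<in> shadow \<epsilon>' w"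
    unfolding strip_def by (auto simp: mem_sheets)
  then show "cross u z \<in> shadow \<epsilon> w" using shadow_saturated[OF w x(2,3)] by metis
next
  assume "cross u z \<in> shadow \<epsilon> w"
  then show "point (\<epsilon>, z) \<in> strip w"
    unfolding strip_def using z by (intro image_eqI[of _ _ "(\<epsilon>, z)"]) (auto simp: mem_sheets)
qed

lemma strip_disjoint:
  assumes "w \<in> W" "w' \<in> W" "w \<noteq> w'"
  shows "strip w \<inter> strip w' = {}"
proof -
  have False if x: "x \<in> strip w" "x \<in> strip w'" for x
  proof -
    obtain \<epsilon> z where z: "x = point (\<epsilon>, z)" "z \<in> polygon \<epsilon>" "cross u z \<in> shadow \<epsilon> w"
      using x(1) unfolding strip_def by (auto simp: mem_sheets)
    then have "cross u z \<in> shadow \<epsilon> w'" using x(2) point_mem_strip[OF assms(2) z(2)] by simp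
    then show False using z(3) disjoint_positions[OF assms(1,2)] assms(3) unfolding shadow_def by blast
  qed
  then show ?thesis by blast
qed

lemma open_shadow: "open (shadow \<epsilon> w)"
proof -
  have "shadow \<epsilon> w = (\<Union>i\<in>{i. even i = \<epsilon>}. {lo u w - cross u (Cen w i)<..<hi u w - cross u (Cen w i)})"
    unfolding shadow_def by (auto simp: less_diff_eq diff_less_eq)
  then show ?thesis by (simp add: open_UN)
qed

lemma openin_strip:
  assumes w: "w \<in> W"
  shows "openin surface_topology (strip w)"
  unfolding openin_surface_topology
proof
  show "strip w \<subseteq> surface" unfolding strip_def surface_def by blast
  have "{x \<in> sheets. point x \<in> strip w} =
      sheets \<inter> ({True} \<times> {z. cross u z \<in> shadow True w} \<union> {False} \<times> {z. cross u z \<in> shadow False w})"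
    using point_mem_strip[OF w] by (auto simp: mem_sheets) (metis (full_types))+
  moreover have "open {z. cross u z \<in> shadow \<epsilon> w}" for \<epsilon>
    using open_vimage[OF open_shadow, of "cross u" \<epsilon> w] continuous_on_cross[of UNIV "\<lambda>z. z" u]
    by (simp add: vimage_def)
  then have "open ({True} \<times> {z. cross u z \<in> shadow True w} \<union> {False} \<times> {z. cross u z \<in> shadow False w})"
    by (intro open_Un open_Times open_discrete) auto
  ultimately show "openin (top_of_set sheets) {x \<in> sheets. point x \<in> strip w}"
    by (simp only: openin_open_Int)
qed

text \<open>The part of the cylinder in the \<open>i\<close>-th polygon, recentred at 0; it is
  convex, hence connected.\<close>

definition slab :: "nat list \<Rightarrow> int \<Rightarrow> complex set" where
  "slab w i = {z \<in> polygon (even i). lo u w < cross u z + cross u (Cen w i) \<and> cross u z + cross u (Cen w i) < hi u w}"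

lemma slab_period: "w \<in> W \<Longrightarrow> slab w (i + int (length w)) = slab w i"
  using even_length[of w] by (simp add: slab_def Cen_period word hol cross_linear)

lemma connectedin_slab: "w \<in> W \<Longrightarrow> connectedin surface_topology (point ` ({even i} \<times> slab w i))"
proof (rule connectedin_continuous_map_image[OF quotient_imp_continuous_map[OF quotient_map_point]])
  have "convex (slab w i)"
  proof -
    have 1: "slab w i = polygon (even i) \<inter> ({z. cross u z > lo u w - cross u (Cen w i)} \<inter> {z. cross u z < hi u w - cross u (Cen w i)})"
      by (auto simp: slab_def)
    have "convex {z. cross u z > c}" "convex {z. cross u z < c}" for c
      using convex_halfspace_gt[of c "Complex (- Im u) (Re u)"] convex_halfspace_lt[of "Complex (- Im u) (Re u)" c]
      by (simp_all add: cross_def inner_complex_def algebra_simps)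
    then show ?thesis unfolding 1 by (intro convex_Int convex_polygon)
  qed
  then have "connected ({even i} \<times> slab w i)" by (intro connected_Times convex_connected) auto
  then show "connectedin (top_of_set sheets) ({even i} \<times> slab w i)"
    unfolding connectedin_subtopology connectedin_iff_connected
    by (simp add: mem_sheets slab_def subset_iff)
qed

lemma strip_eq_slabs:
  assumes w: "w \<in> W"
  shows "strip w = (\<Union>m::nat. point ` ({even (int m)} \<times> slab w (int m)))"
proof -
  have "strip w = (\<Union>i::int. point ` ({even i} \<times> slab w i))"
  proof (intro equalityI subsetI)
    fix x assume "x \<in> strip w"
    then obtain \<epsilon> z i where "x = point (\<epsilon>, z)" "z \<in> polygon \<epsilon>" "even i = \<epsilon>"
      "lo u w < cross u z + cross u (Cen w i)" "cross u z + cross u (Cen w i) < hi u w"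
      by (auto simp: strip_def shadow_def mem_sheets)
    then have "x \<in> point ` ({even i} \<times> slab w i)" by (intro image_eqI[of _ _ "(\<epsilon>, z)"]) (auto simp: slab_def)
    then show "x \<in> (\<Union>i::int. point ` ({even i} \<times> slab w i))" by blast
  next
    fix x assume "x \<in> (\<Union>i::int. point ` ({even i} \<times> slab w i))"
    then obtain i z where "x = point (even i, z)" "z \<in> slab w i" by blast
    then show "x \<in> strip w"
      unfolding strip_def slab_def shadow_def by (intro image_eqI[of _ _ "(even i, z)"]) (auto simp: mem_sheets)
  qed
  also have "\<dots> = (\<Union>m::nat. point ` ({even (int m)} \<times> slab w (int m)))"
  proof -
    have "point ` ({even i} \<times> slab w i) = point ` ({even (int (nat (i mod int (length w))))} \<times> slab w (int (nat (i mod int (length w)))))" for i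
      using even_length[OF w] slab_period[OF w]
      by (intro periodic_int[where P = "\<lambda>i. point ` ({even i} \<times> slab w i)", OF length_pos[OF w]]) simp
    then show ?thesis by blast
  qed
  finally show ?thesis .
qed

lemma middle_itinerary:
  assumes w: "w \<in> W"
  obtains z where "lo u w < cross u z" "cross u z < hi u w" 
    "primitive_itinerary u z (letter w) (Cen w) (int (length w)) (len w)"
proof -
  obtain z where "cross u z = (lo u w + hi u w) / 2" using exists_cross[OF unit] by blast
  then have "lo u w < cross u z" "cross u z < hi u w" using lo_less_hi[OF w] by auto
  with that primitive_itinerary[OF w] show thesis by blast
qed

text \<open>Consecutive slabs share the point at which a line inside the cylinder crosses from one
  to the next. The finite unions starting with slab 0 are therefore connected and have a common
  point.\<close>

lemma connectedin_strip:
  assumes w: "w \<in> W"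
  shows "connectedin surface_topology (strip w)" "strip w \<noteq> {}"
proof -
  obtain z where z: "lo u w < cross u z" "cross u z < hi u w"
    "primitive_itinerary u z (letter w) (Cen w) (int (length w)) (len w)"
    using middle_itinerary[OF w] .
  interpret primitive_itinerary u z "letter w" "Cen w" "int (length w)" "len w" by fact
  define A where "A i = point ` ({even i} \<times> slab w i)" for i
  have X: "X i - Cen w i \<in> slab w i" "X (i - 1) - Cen w i \<in> slab w i" for i
    using entry_mem[of i] exit_mem[of i] z by (auto simp: slab_def X_eq cross_linear)
  have meet: "A i \<inter> A (i + 1) \<noteq> {}" for i
  proof -
    have "point (even i, X i - Cen w i) \<in> A i" using X(1)[of i] by (auto simp: A_def)
    moreover have "point (even (i + 1), X i - Cen w (i + 1)) \<in> A (i + 1)"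
      using X(2)[of "i + 1"] unfolding A_def by (intro imageI) simp
    ultimately show ?thesis using glue_X[of i] by auto
  qed
  have B: "connectedin surface_topology (\<Union>m\<le>k. A (int m))" for k :: nat
  proof (induction k)
    case 0 then show ?case using connectedin_slab[OF w, of 0] by (simp add: A_def)
  next
    case (Suc k)
    have "(\<Union>m\<le>Suc k. A (int m)) = (\<Union>m\<le>k. A (int m)) \<union> A (int k + 1)"
      by (auto simp: atMost_Suc algebra_simps)
    moreover have "connectedin surface_topology (A (int k + 1))" unfolding A_def by (rule connectedin_slab[OF w])
    ultimately show ?case using Suc meet[of "int k"] by (auto intro!: connectedin_Un)
  qed
  have s: "strip w = \<Union> (range (\<lambda>k. \<Union>m\<le>k. A (int m)))"
    unfolding strip_eq_slabs[OF w] A_def by auto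
  have p: "point (even (0::int), X 0 - Cen w 0) \<in> A 0" using X(1)[of 0] by (auto simp: A_def)
  then have p': "point (even (0::int), X 0 - Cen w 0) \<in> \<Inter> (range (\<lambda>k. \<Union>m\<le>k. A (int m)))"
    by (auto intro!: bexI[of _ 0])
  show "connectedin surface_topology (strip w)"
    unfolding s
  proof (rule connectedin_Union)
    show "\<Inter> (range (\<lambda>k. \<Union>m\<le>k. A (int m))) \<noteq> {}" using p' by (metis empty_iff)
  qed (use B in auto)
  have "A 0 \<subseteq> strip w" unfolding strip_eq_slabs[OF w] A_def
    by (intro subsetI UN_I[of 0]) simp_all
  with p show "strip w \<noteq> {}" by blast
qed

text \<open>The velocity is \<open>u\<close> or \<open>- u\<close>, whence the two senses of the
  parameter. A point of the trajectory lies in the shadow of some cylinder, and the path of that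
  cylinder through the point is the whole trajectory.\<close>

lemma closed_trajectory_cases:
  assumes "closed_trajectory (u\<^sup>2) \<gamma>"
  obtains w z c where "w \<in> W" "primitive_itinerary u z (letter w) (Cen w) (int (length w)) (len w)"
    "lo u w < cross u z" "cross u z < hi u w"
    "\<gamma> = (\<lambda>t. periodic_itinerary.path u z (letter w) (Cen w) (t + c)) \<or>
     \<gamma> = (\<lambda>t. periodic_itinerary.path u z (letter w) (Cen w) (c - t))"
proof -
  obtain v T where v: "v\<^sup>2 = u\<^sup>2" "trajectory v \<gamma>" and T: "T > 0" "\<And>t. \<gamma> (t + T) = \<gamma> t"
    using assms unfolding closed_trajectory_def by blast
  note outer = that
  have forward: thesis if g: "trajectory u g" "\<And>t. g (t + T) = g t"
    and h: "(\<forall>t. \<gamma> t = g t) \<or> (\<forall>t. \<gamma> t = g (- t))" for g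
  proof -
    obtain \<delta> \<epsilon> z where "\<delta> > 0" "\<And>s. s \<in> {0..<\<delta>} \<Longrightarrow> z + s *\<^sub>R u \<in> polygon \<epsilon> \<and> g (0 + s) = point (\<epsilon>, z + s *\<^sub>R u)"
      using g(1) unfolding trajectory_def by meson
    from this(1) this(2)[of 0] have z: "g 0 = point (\<epsilon>, z)" "z \<in> polygon \<epsilon>" by auto
    obtain w where w: "w \<in> W" "cross u z \<in> shadow \<epsilon> w" using trajectory_in_shadow[OF g(1) z] by blast
    obtain i where i: "even i = \<epsilon>" "cross u (z + Cen w i - Cen w i) = cross u z"
      "lo u w < cross u (z + Cen w i)" "cross u (z + Cen w i) < hi u w"
      using shadow_itinerary[OF w] .
    interpret primitive_itinerary u "z + Cen w i" "letter w" "Cen w" "int (length w)" "len w"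
      by (rule primitive_itinerary[OF w(1) i(3,4)])
    obtain t where t: "s (i - 1) \<le> t" "t \<le> s i" "z = z + Cen w i + t *\<^sub>R u - Cen w i"
      using on_line_between[of z i] z(2) i(1,2) by auto
    have "g 0 = path t" using path_eq[OF t(1,2)] t(3) z(1) i(1) by simp
    from closed_trajectory_eq_path[OF g(1) T(1) g(2) this] have "g r = path (r + t)" for r by simp
    then have "\<gamma> = (\<lambda>r. path (r + t)) \<or> \<gamma> = (\<lambda>r. path (t - r))"
      using h by (auto simp: fun_eq_iff)
    then show thesis using outer[OF w(1) primitive_itinerary_axioms i(3,4)] by blast
  qed
  from v(1) have "v = u \<or> v = - u" by (simp add: power2_eq_iff)
  then show thesis
  proof
    assume "v = u" then show thesis using forward[of \<gamma>] v(2) T(2) by blast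
  next
    assume "v = - u"
    then have "trajectory u (\<lambda>t. \<gamma> (- t))" using v(2) trajectory_reverse by blast
    moreover have "\<gamma> (- (t + T)) = \<gamma> (- t)" for t using T(2)[of "- (t + T)"] by (simp add: algebra_simps)
    ultimately show thesis using forward[of "\<lambda>t. \<gamma> (- t)"] by simp
  qed
qed

lemma path_in_strip:
  assumes w: "w \<in> W" and it: "primitive_itinerary u z (letter w) (Cen w) (int (length w)) (len w)"
    "lo u w < cross u z" "cross u z < hi u w"
  shows "periodic_itinerary.path u z (letter w) (Cen w) t \<in> strip w"
proof -
  interpret primitive_itinerary u z "letter w" "Cen w" "int (length w)" "len w" by fact
  obtain i where i: "s (i - 1) \<le> t" "t \<le> s i" using s_cover less_imp_le by metis
  show ?thesis
    unfolding path_eq[OF i] point_mem_strip[OF w in_polygon[OF i]] cross_line shadow_def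
    using it(2,3) by (auto simp: cross_linear)
qed

lemma closed_trajectories: "\<Union>{range \<gamma> | \<gamma>. closed_trajectory (u\<^sup>2) \<gamma>} = \<Union> (strip ` W)"
proof (intro equalityI subsetI)
  fix x assume "x \<in> \<Union>{range \<gamma> | \<gamma>. closed_trajectory (u\<^sup>2) \<gamma>}"
  then obtain \<gamma> t where "closed_trajectory (u\<^sup>2) \<gamma>" "x = \<gamma> t" by blast
  then show "x \<in> \<Union> (strip ` W)"
    using path_in_strip by (elim closed_trajectory_cases) auto
next
  fix x assume "x \<in> \<Union> (strip ` W)"
  then obtain w \<epsilon> z where w: "w \<in> W" and z: "x = point (\<epsilon>, z)" "z \<in> polygon \<epsilon>" "cross u z \<in> shadow \<epsilon> w"
    unfolding strip_def by (auto simp: mem_sheets)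
  obtain i where i: "even i = \<epsilon>" "cross u (z + Cen w i - Cen w i) = cross u z"
    "lo u w < cross u (z + Cen w i)" "cross u (z + Cen w i) < hi u w"
    using shadow_itinerary[OF w z(3)] .
  interpret primitive_itinerary u "z + Cen w i" "letter w" "Cen w" "int (length w)" "len w"
    by (rule primitive_itinerary[OF w(1) i(3,4)])
  obtain t where t: "s (i - 1) \<le> t" "t \<le> s i" "z = z + Cen w i + t *\<^sub>R u - Cen w i"
    using on_line_between[of z i] z(2) i(1,2) by auto
  have "x = path t" using path_eq[OF t(1,2)] t(3) z(1) i(1) by simp
  moreover have "closed_trajectory (u\<^sup>2) path"
    unfolding closed_trajectory_def using path_trajectory path_period l by blast
  ultimately show "x \<in> \<Union>{range \<gamma> | \<gamma>. closed_trajectory (u\<^sup>2) \<gamma>}" by blast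
qed

text \<open>The strips are nonempty, open, connected and pairwise disjoint and fill the set of
  points on closed trajectories, so they are its components.\<close>

lemma strips_eq: "strips (u\<^sup>2) = strip ` W"
proof -
  let ?U = "\<Union> (strip ` W)"
  let ?X = "subtopology surface_topology ?U"
  have sub: "?U \<subseteq> topspace surface_topology" using openin_strip openin_subset by blast
  then have top: "topspace ?X = ?U" by auto
  have conn: "connectedin ?X (strip w)" if "w \<in> W" for w
    using connectedin_strip(1)[OF that] that by (auto simp: connectedin_subtopology)
  have comp: "strip w \<in> connected_components_of ?X" if w: "w \<in> W" for w
  proof -
    obtain x where x: "x \<in> strip w" using connectedin_strip(2)[OF w] by blast
    let ?C = "connected_component_of_set ?X x"
    have xX: "x \<in> topspace ?X" using x w top by blast
    have C: "?C \<in> connected_components_of ?X" using xX by (simp add: connected_component_in_connected_components_of)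
    have xC: "x \<in> ?C" using xX by (simp add: connected_component_of_refl)
    have 1: "strip w \<subseteq> ?C"
      by (rule connected_components_of_maximal[OF C conn[OF w]]) (use x xC in \<open>auto simp: disjnt_def\<close>)
    have "?C \<subseteq> strip w"
    proof (rule ccontr)
      assume no: "\<not> ?C \<subseteq> strip w"
      let ?V = "\<Union> (strip ` (W - {w}))"
      have "openin ?X (strip w)"
      proof -
        have "strip w \<inter> ?U = strip w" using w by blast
        then show ?thesis using openin_subtopology_Int[OF openin_strip[OF w], of ?U] by simp
      qed
      moreover have "openin ?X ?V"
      proof -
        have "openin surface_topology ?V" using openin_strip by (intro openin_Union) auto
        moreover have "?V \<inter> ?U = ?V" by blast
        ultimately show ?thesis using openin_subtopology_Int[of surface_topology ?V ?U] by simp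
      qed
      moreover have "?C \<subseteq> strip w \<union> ?V" using connected_components_of_subset[OF C] top by blast
      moreover have "strip w \<inter> ?V \<inter> ?C = {}" using strip_disjoint[OF w] by blast
      moreover have "strip w \<inter> ?C \<noteq> {}" using x xC by blast
      moreover have "?V \<inter> ?C \<noteq> {}" using no \<open>?C \<subseteq> strip w \<union> ?V\<close> by blast
      moreover have "connectedin ?X ?C" by (rule connectedin_connected_components_of[OF C])
      then have "\<nexists>E1 E2. openin ?X E1 \<and> openin ?X E2 \<and> ?C \<subseteq> E1 \<union> E2 \<and> E1 \<inter> E2 \<inter> ?C = {} \<and> E1 \<inter> ?C \<noteq> {} \<and> E2 \<inter> ?C \<noteq> {}"
        unfolding connectedin by simp
      ultimately show False by blast
    qed
    with 1 have "strip w = ?C" by blast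
    with C show ?thesis by simp
  qed
  have "C \<in> strip ` W" if C: "C \<in> connected_components_of ?X" for C
  proof -
    obtain x where x: "x \<in> C" using nonempty_connected_components_of[OF C] by blast
    then obtain w where w: "w \<in> W" "x \<in> strip w" using connected_components_of_subset[OF C] top by blast
    have "\<not> disjnt C (strip w)" using x w(2) by (auto simp: disjnt_def)
    then have "C = strip w"
      using pairwise_disjoint_connected_components_of[of ?X] C comp[OF w(1)]
      by (meson pairwiseD)
    with w show ?thesis by blast
  qed
  then show ?thesis unfolding strips_def closed_trajectories using comp by blast
qed

end

section \<open>Cyclic words\<close>

lemma cyclic_word_rotate [simp]: "cyclic_word (rotate k w) = cyclic_word w"
proof (cases "w = []")
  case False
  show ?thesis
  proof (intro equalityI subsetI)
    fix v assume "v \<in> cyclic_word (rotate k w)"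
    then show "v \<in> cyclic_word w" by (auto simp: cyclic_word_def rotate_rotate)
  next
    fix v assume "v \<in> cyclic_word w"
    then obtain n where n: "v = rotate n w" by (auto simp: cyclic_word_def)
    \<comment> \<open>Another \<open>k * (length w - 1)\<close> rotations complete the given
      \<open>k\<close> to full turns.\<close>
    have "n + k * (length w - 1) + k = n + k * length w" using False by (cases w) auto
    then have "rotate (n + k * (length w - 1)) (rotate k w) = rotate (n + k * length w) w"
      by (simp only: rotate_rotate)
    also have "\<dots> = rotate n w" by (subst (1 2) rotate_conv_mod) simp
    finally show "v \<in> cyclic_word (rotate k w)"
      unfolding n cyclic_word_def by (metis (mono_tags, lifting) mem_Collect_eq)
  qed
qed simp

lemma cyclic_word_eq_iff: "cyclic_word v = cyclic_word w \<longleftrightarrow> (\<exists>n. v = rotate n w)"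
proof
  assume "cyclic_word v = cyclic_word w"
  moreover have "rotate 0 v \<in> cyclic_word v" unfolding cyclic_word_def by blast
  ultimately have "v \<in> cyclic_word w" by simp
  then show "\<exists>n. v = rotate n w" by (auto simp: cyclic_word_def)
qed auto

lemma cyclic_word_rev: "cyclic_word v = cyclic_word w \<Longrightarrow> cyclic_word (rev v) = cyclic_word (rev w)"
proof -
  assume "cyclic_word v = cyclic_word w"
  then obtain n where n: "w = rotate n v" using cyclic_word_eq_iff[of w v] by auto
  have "rotate n (rev w) = rev (rotate (length w - n mod length w) w)" by (rule rotate_rev)
  also have "rotate (length w - n mod length w) w = rotate (length v - n mod length v + n) v"
    unfolding n by (simp add: rotate_rotate)
  also have "\<dots> = v"
  proof (cases "v = []")
    case False
    then have "n mod length v < length v" by simp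
    then have "length v - n mod length v + n = length v + (n - n mod length v)"
      using mod_less_eq_dividend[of n "length v"] by linarith
    also have "\<dots> = length v * (1 + n div length v)" by (simp add: minus_mod_eq_mult_div)
    finally show ?thesis by (subst rotate_conv_mod) simp
  qed simp
  finally show ?thesis by (metis cyclic_word_rotate)
qed

lemma cyclic_word_map: "cyclic_word v = cyclic_word w \<Longrightarrow> cyclic_word (map f v) = cyclic_word (map f w)"
  unfolding cyclic_word_eq_iff using rotate_map by metis

lemma cyclic_word_append_commute: "cyclic_word (v @ w) = cyclic_word (w @ v)"
  by (metis cyclic_word_rotate rotate_append)

lemma period_window:
  assumes "w \<noteq> []"
  shows "map (letter w) [i..i + int (length w) - 1] = rotate (nat (i mod int (length w))) w"
proof (rule nth_equalityI)
  show "length (map (letter w) [i..i + int (length w) - 1]) = length (rotate (nat (i mod int (length w))) w)"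
    by simp
  fix m assume "m < length (map (letter w) [i..i + int (length w) - 1])"
  then have m: "m < length w" by simp
  have "map (letter w) [i..i + int (length w) - 1] ! m = letter w (i + int m)" using m by simp
  also have "\<dots> = rotate (nat (i mod int (length w))) w ! m"
  proof -
    have "int ((nat (i mod int (length w)) + m) mod length w) = (i + int m) mod int (length w)"
      using assms by (simp add: zmod_int mod_add_left_eq)
    then have "nat ((i + int m) mod int (length w)) = (nat (i mod int (length w)) + m) mod length w"
      by (metis nat_int)
    then show ?thesis unfolding letter_def nth_rotate[OF m] by simp
  qed
  finally show "map (letter w) [i..i + int (length w) - 1] ! m = rotate (nat (i mod int (length w))) w ! m" .
qed

section \<open>Lengths and symbolic orbits of the cylinders\<close>

context cylinders
begin

lemma cyclic_word_window: "w \<in> W \<Longrightarrow> cyclic_word (map (letter w) [i..i + int (length w) - 1]) = cyclic_word w"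
  using word[of w] by (simp add: period_window word_def)

text \<open>The central symmetry of the double pentagon reverses the itineraries of a cylinder.\<close>

lemma cyclic_word_rev_cylinder:
  assumes w: "w \<in> W"
  shows "cyclic_word (rev w) = cyclic_word w"
proof -
  define n where "n = length w"
  obtain z where z: "lo u w < cross u z" "cross u z < hi u w"
    "primitive_itinerary u z (letter w) (Cen w) (int (length w)) (len w)"
    using middle_itinerary[OF w] .
  interpret a: primitive_itinerary u z "letter w" "Cen w" "int (length w)" "len w" by fact
  \<comment> \<open>The symmetry sends polygon \<open>1 - i\<close> to polygon \<open>i\<close>, the
    parity changing with the sheet, and reversing the order restores the direction \<open>u\<close>.
    The way out of the new polygon \<open>i\<close> is the old crossing between \<open>- i\<close>
    and \<open>1 - i\<close>, which has letter number \<open>- i\<close>.\<close>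
  have it: "periodic_itinerary u (- z) (\<lambda>i. letter w (- i)) (\<lambda>i. - Cen w (1 - i)) (int n) (len w)"
  proof unfold_locales
    fix i
    have C: "Cen w (1 - i) = Cen w (- i) + sg (even i) *\<^sub>R hop (letter w (- i))" using a.C_Suc[of "- i"] by simp
    show "- Cen w (1 - (i + 1)) = - Cen w (1 - i) + sg (even i) *\<^sub>R hop (letter w (- i))"
      using C by simp
    show "exits u (cross u (- z - - Cen w (1 - i))) (even i) (letter w (- i))"
      using a.exits[of "- i"] unfolding C exits_def hop_def by (simp add: cross_linear algebra_simps)
    show "letter w (- (i + int n)) = letter w (- i)"
      using a.J_period[of "- (i + int n)"] by (simp add: n_def)
    show "- Cen w (1 - (i + int n)) = - Cen w (1 - i) + len w *\<^sub>R u"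
      using a.C_period[of "1 - (i + int n)"] by (simp add: n_def algebra_simps)
  qed (use a.unit a.n a.l in \<open>simp_all add: n_def\<close>)
  interpret b: periodic_itinerary u "- z" "\<lambda>i. letter w (- i)" "\<lambda>i. - Cen w (1 - i)" "int n" "len w" by (rule it)
  have t: "b.s (0 - 1) \<le> b.s 0" "b.s 0 \<le> b.s 0" using b.s_less[of 0] by auto
  define y where "y = - z + b.s 0 *\<^sub>R u - - Cen w (1 - 0)"
  \<comment> \<open>The reversed line lies in one of the cylinders; comparing circumferences then
    shows that it is the cylinder of \<open>w\<close>.\<close>
  obtain w' where w': "w' \<in> W" "cross u y \<in> shadow (even (0::int)) w'"
    using trajectory_in_shadow[OF b.path_trajectory b.path_eq[OF t] b.in_polygon[OF t]] unfolding y_def by blast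
  obtain k where k: "even k = even (0::int)" "lo u w' < cross u y + cross u (Cen w' k)"
     "cross u y + cross u (Cen w' k) < hi u w'"
    using w'(2) unfolding shadow_def by blast
  have y: "cross u y = cross u (- z - - Cen w (1 - 0))" unfolding y_def by (rule b.cross_line)
  have sw: "w = w'" "letter w (- (0 + int m)) = letter w' (k + int m)" for m
    using same_word[OF it w _ w'(1) k(1)[symmetric]] k(2,3) unfolding y n_def by blast+
  have "map (letter w) [k..k + int n - 1] = rev (map (letter w) [- int n + 1..- int n + 1 + int n - 1])"
  proof (rule nth_equalityI)
    show "length (map (letter w) [k..k + int n - 1]) = length (rev (map (letter w) [- int n + 1..- int n + 1 + int n - 1]))"
      by simp
    fix m assume "m < length (map (letter w) [k..k + int n - 1])"
    then have m: "m < n" by simp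
    have "map (letter w) [k..k + int n - 1] ! m = letter w (k + int m)" using m by simp
    also have "\<dots> = letter w (- int m)" using sw by simp
    also have "\<dots> = rev (map (letter w) [- int n + 1..- int n + 1 + int n - 1]) ! m"
      using m by (simp add: rev_nth nth_append of_nat_diff)
    finally show "map (letter w) [k..k + int n - 1] ! m = rev (map (letter w) [- int n + 1..- int n + 1 + int n - 1]) ! m" .
  qed
  then have "cyclic_word w = cyclic_word (rev (map (letter w) [- int n + 1..- int n + 1 + int n - 1]))"
    using cyclic_word_window[OF w, of k] by (simp add: n_def)
  also have "\<dots> = cyclic_word (rev w)"
    using cyclic_word_rev[OF cyclic_word_window[OF w, of "- int n + 1"]] by (simp add: n_def)
  finally show ?thesis ..
qed

lemma strip_inj: "w \<in> W \<Longrightarrow> w' \<in> W \<Longrightarrow> strip w \<inter> strip w' \<noteq> {} \<Longrightarrow> w = w'"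
  using strip_disjoint by blast

lemma trajectory_in_strip:
  assumes w: "w \<in> W" and g: "closed_trajectory (u\<^sup>2) \<gamma>" "range \<gamma> \<subseteq> strip w"
  shows "traj_length \<gamma> = len w" "cyclic_word (crossing_word \<gamma>) = cyclic_word (map side_label w)"
proof -
  obtain w' z c where w': "w' \<in> W" "primitive_itinerary u z (letter w') (Cen w') (int (length w')) (len w')"
    "lo u w' < cross u z" "cross u z < hi u w'"
    and g': "\<gamma> = (\<lambda>t. periodic_itinerary.path u z (letter w') (Cen w') (t + c)) \<or>
     \<gamma> = (\<lambda>t. periodic_itinerary.path u z (letter w') (Cen w') (c - t))"
    using closed_trajectory_cases[OF g(1)] .
  have "\<gamma> 0 \<in> strip w'" using g' path_in_strip[OF w'] by auto
  then have "w = w'" using g(2) by (intro strip_inj[OF w w'(1)]) auto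
  interpret primitive_itinerary u z "letter w" "Cen w" "int (length w)" "len w"
    using w'(2) \<open>w = w'\<close> by simp
  have g: "\<gamma> = (\<lambda>t. path (t + c)) \<or> \<gamma> = (\<lambda>t. path (c - t))" using g' \<open>w = w'\<close> by simp
  show "traj_length \<gamma> = len w" by (rule traj_length_shift[OF g])
  from g show "cyclic_word (crossing_word \<gamma>) = cyclic_word (map side_label w)"
  proof
    assume "\<gamma> = (\<lambda>t. path (t + c))"
    then obtain i where "crossing_word \<gamma> = map side_label (map (letter w) [i..i + int (length w) - 1])"
      using crossing_word_forward by force
    then show ?thesis using cyclic_word_map[OF cyclic_word_window[OF w]] by metis
  next
    assume "\<gamma> = (\<lambda>t. path (c - t))"
    then obtain i where "crossing_word \<gamma> = map side_label (rev (map (letter w) [i..i + int (length w) - 1]))"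
      using crossing_word_backward[of c] by (auto simp: rev_map)
    moreover have "cyclic_word (rev (map (letter w) [i..i + int (length w) - 1])) = cyclic_word w"
      using cyclic_word_rev[OF cyclic_word_window[OF w]] cyclic_word_rev_cylinder[OF w] by simp
    ultimately show ?thesis using cyclic_word_map by metis
  qed
qed

lemma exists_trajectory_in_strip:
  assumes w: "w \<in> W"
  obtains \<gamma> where "closed_trajectory (u\<^sup>2) \<gamma>" "range \<gamma> \<subseteq> strip w"
proof -
  obtain z where z: "lo u w < cross u z" "cross u z < hi u w"
    "primitive_itinerary u z (letter w) (Cen w) (int (length w)) (len w)"
    using middle_itinerary[OF w] .
  interpret primitive_itinerary u z "letter w" "Cen w" "int (length w)" "len w" by fact
  have "closed_trajectory (u\<^sup>2) path"
    unfolding closed_trajectory_def using path_trajectory path_period l by blast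
  moreover have "range path \<subseteq> strip w" using path_in_strip[OF w z(3,1,2)] by blast
  ultimately show thesis by (rule that)
qed

lemma strip_length_eq: "w \<in> W \<Longrightarrow> strip_length (u\<^sup>2) (strip w) = len w"
  unfolding strip_length_def
  by (rule the_equality) (metis exists_trajectory_in_strip trajectory_in_strip(1), metis trajectory_in_strip(1))

lemma symbolic_orbit_eq: "w \<in> W \<Longrightarrow> symbolic_orbit (u\<^sup>2) (strip w) = cyclic_word (map side_label w)"
  unfolding symbolic_orbit_def
  by (rule the_equality) (metis exists_trajectory_in_strip trajectory_in_strip(2), metis trajectory_in_strip(2))

lemma short_long_orbit:
  assumes W: "W = {a, b}" and len: "len a < len b"
  shows "short_orbit (u\<^sup>2) = cyclic_word (map side_label a)" "long_orbit (u\<^sup>2) = cyclic_word (map side_label b)"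
proof -
  have s: "strips (u\<^sup>2) = {strip a, strip b}" by (simp add: strips_eq W)
  have ab: "a \<in> W" "b \<in> W" by (simp_all add: W)
  have l: "strip_length (u\<^sup>2) (strip a) = len a" "strip_length (u\<^sup>2) (strip b) = len b"
    using strip_length_eq ab by blast+
  \<comment> \<open>The strips form an unordered pair; the strict inequality of lengths decides
    which is which.\<close>
  have un: "S = strip a \<and> L = strip b"
    if "strips (u\<^sup>2) = {S, L}" "strip_length (u\<^sup>2) S < strip_length (u\<^sup>2) L" for S L
  proof -
    have "{S, L} = {strip a, strip b}" using that s by simp
    then show ?thesis using that(2) l len by (auto simp: doubleton_eq_iff)
  qed
  have "short_strip (u\<^sup>2) = strip a"
    unfolding short_strip_def using un s l len by (intro the_equality) (metis, blast)
  then show "short_orbit (u\<^sup>2) = cyclic_word (map side_label a)"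
    unfolding short_orbit_def using symbolic_orbit_eq ab by simp
  have "long_strip (u\<^sup>2) = strip b"
    unfolding long_strip_def using un s l len by (intro the_equality) (metis, blast)
  then show "long_orbit (u\<^sup>2) = cyclic_word (map side_label b)"
    unfolding long_orbit_def using symbolic_orbit_eq ab by simp
qed

end

section \<open>L-shaped tables\<close>

definition phi :: real where
  "phi = (1 + sqrt 5) / 2"

lemma phi_mult_phi [simp]: "phi * phi = phi + 1"
proof -
  have "sqrt 5 * sqrt 5 = (5::real)" by simp
  then show ?thesis by (simp add: phi_def field_simps)
qed

lemma phi_mult_phi_mult [simp]: "phi * (phi * x) = phi * x + x"
  by (metis distrib_right mult.assoc mult_1 phi_mult_phi)

lemma phi_bounds: "3 / 2 < phi" "phi < 2"
proof -
  have "sqrt 5 > 2" by (rule real_less_rsqrt) simp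
  moreover have "sqrt 5 < 3" by (rule real_less_lsqrt) simp_all
  ultimately show "3 / 2 < phi" "phi < 2" by (auto simp: phi_def)
qed

lemma phi_pos: "phi > 0"
  using phi_bounds by simp

text \<open>For a fraction \<open>m / n\<close> in lowest terms,
  \<open>m * m = m * n + n * n\<close> makes \<open>n\<close> divide \<open>m * m\<close>, so the
  fraction is an integer; but \<open>phi\<close> lies strictly between 1 and 2.\<close>

lemma phi_irrational: "phi \<notin> \<rat>"
proof
  assume "phi \<in> \<rat>"
  then obtain m n :: nat where mn: "n \<noteq> 0" "\<bar>phi\<bar> = real m / real n" "coprime m n"
    by (rule Rats_abs_nat_div_natE)
  then have m: "real m = phi * real n" using phi_pos by (simp add: field_simps)
  have "real m * real m = real m * real n + real n * real n"
    unfolding m by (simp add: algebra_simps)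
  then have "real (m * m) = real (m * n + n * n)" by simp
  then have "m * m = m * n + n * n" by (simp only: of_nat_eq_iff)
  then have "n dvd m * m" by simp
  then have "n = 1" using mn(3) by (metis coprime_commute coprime_dvd_mult_left_iff coprime_common_divisor dvd_refl nat_dvd_1_iff_1)
  then have "phi = real m" using m by simp
  then have "1 < m" "m < 2" using phi_bounds by simp_all
  then show False by simp
qed

text \<open>The ring of integers of the field generated by \<open>sqrt 5\<close>. Its rational
  elements are the ordinary integers, and this is what makes holonomies indivisible.\<close>

definition golden_ints :: "real set" where
  "golden_ints = {of_int m + of_int n * phi | m n. True}"

lemma golden_ints_of_int: "of_int m \<in> golden_ints"
  unfolding golden_ints_def by (intro CollectI exI[of _ m] exI[of _ 0]) simp

lemma golden_ints_phi: "phi \<in> golden_ints"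
  unfolding golden_ints_def by (intro CollectI exI[of _ 0] exI[of _ 1]) simp

lemma golden_ints_add: "x \<in> golden_ints \<Longrightarrow> y \<in> golden_ints \<Longrightarrow> x + y \<in> golden_ints"
proof -
  assume "x \<in> golden_ints" "y \<in> golden_ints"
  then obtain m n m' n' where "x = of_int m + of_int n * phi" "y = of_int m' + of_int n' * phi"
    unfolding golden_ints_def by blast
  then have "x + y = of_int (m + m') + of_int (n + n') * phi" by (simp add: algebra_simps)
  then show ?thesis unfolding golden_ints_def by blast
qed

lemma golden_ints_minus: "x \<in> golden_ints \<Longrightarrow> - x \<in> golden_ints"
proof -
  assume "x \<in> golden_ints"
  then obtain m n where "x = of_int m + of_int n * phi" unfolding golden_ints_def by blast
  then have "- x = of_int (- m) + of_int (- n) * phi" by simp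
  then show ?thesis unfolding golden_ints_def by blast
qed

lemma golden_ints_diff: "x \<in> golden_ints \<Longrightarrow> y \<in> golden_ints \<Longrightarrow> x - y \<in> golden_ints"
  using golden_ints_add[of x "- y"] golden_ints_minus[of y] by simp

lemma golden_ints_phi_mult: "x \<in> golden_ints \<Longrightarrow> phi * x \<in> golden_ints"
proof -
  assume "x \<in> golden_ints"
  then obtain m n where "x = of_int m + of_int n * phi" unfolding golden_ints_def by blast
  then have "phi * x = of_int n + of_int (m + n) * phi" by (simp add: algebra_simps)
  then show ?thesis unfolding golden_ints_def by blast
qed

lemma golden_ints_Rats: "x \<in> golden_ints \<Longrightarrow> x \<in> \<rat> \<Longrightarrow> x \<in> \<int>"
proof -
  assume "x \<in> golden_ints" "x \<in> \<rat>"
  then obtain m n where x: "x = of_int m + of_int n * phi" unfolding golden_ints_def by blast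
  have "n = 0"
  proof (rule ccontr)
    assume "n \<noteq> 0"
    then have "phi = (x - of_int m) / of_int n" by (simp add: x)
    also have "\<dots> \<in> \<rat>" using \<open>x \<in> \<rat>\<close> by simp
    finally show False using phi_irrational by simp
  qed
  then show ?thesis by (simp add: x)
qed

text \<open>The module over the golden integers generated by \<open>h\<close> and \<open>g\<close>.
  For a table it contains the displacements between polygons of the same sheet.\<close>

definition lattice :: "complex \<Rightarrow> complex \<Rightarrow> complex set" where
  "lattice h g = {x *\<^sub>R h + y *\<^sub>R g | x y. x \<in> golden_ints \<and> y \<in> golden_ints}"

lemma lattice_add: "v \<in> lattice h g \<Longrightarrow> w \<in> lattice h g \<Longrightarrow> v + w \<in> lattice h g"
proof -
  assume "v \<in> lattice h g" "w \<in> lattice h g"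
  then obtain x y x' y' where *: "v = x *\<^sub>R h + y *\<^sub>R g" "w = x' *\<^sub>R h + y' *\<^sub>R g"
    "x \<in> golden_ints" "y \<in> golden_ints" "x' \<in> golden_ints" "y' \<in> golden_ints"
    unfolding lattice_def by blast
  then have "v + w = (x + x') *\<^sub>R h + (y + y') *\<^sub>R g" by (simp add: algebra_simps)
  with * show ?thesis unfolding lattice_def by (blast intro: golden_ints_add)
qed

lemma lattice_minus: "v \<in> lattice h g \<Longrightarrow> - v \<in> lattice h g"
proof -
  assume "v \<in> lattice h g"
  then obtain x y where *: "v = x *\<^sub>R h + y *\<^sub>R g" "x \<in> golden_ints" "y \<in> golden_ints"
    unfolding lattice_def by blast
  then have "- v = (- x) *\<^sub>R h + (- y) *\<^sub>R g" by simp
  with * show ?thesis unfolding lattice_def by (blast intro: golden_ints_minus)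
qed

lemma lattice_zero: "0 \<in> lattice h g"
  unfolding lattice_def using golden_ints_of_int[of 0] by force

text \<open>
  Every line with direction in the cone spanned by \<open>h\<close> and \<open>g\<close> that passes between \<open>l\<close> and \<open>r\<close>
  crosses the sides listed in \<open>w\<close>.
\<close>

definition fits :: "complex \<Rightarrow> complex \<Rightarrow> nat list \<Rightarrow> complex \<Rightarrow> complex \<Rightarrow> bool" where
  "fits h g w l r \<longleftrightarrow> (\<forall>i<length w. \<forall>v\<in>{h, g}.
     cross v l \<le> cross v (cen w i + sg (even i) *\<^sub>R vertex (Suc (w ! i))) \<and>
     cross v (cen w i + sg (even i) *\<^sub>R vertex (w ! i)) \<le> cross v r)"

section \<open>Concatenation of words and regluing of tables\<close>

lemma cen_append_left: "i \<le> length v \<Longrightarrow> cen (v @ w) i = cen v i"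
  unfolding cen_def by (intro sum.cong) (auto simp: nth_append)

lemma cen_append_right:
  assumes "even (length v)"
  shows "cen (v @ w) (length v + i) = hol v + cen w i"
proof (induction i)
  case 0 show ?case by (simp add: cen_append_left hol_def) (simp add: cen_def)
next
  case (Suc i)
  have "cen (v @ w) (length v + Suc i) = cen (v @ w) (length v + i) + sg (even i) *\<^sub>R hop (w ! i)"
    using assms by (simp add: cen_def nth_append)
  then show ?case using Suc by (simp add: cen_def)
qed

lemma hol_append: "even (length v) \<Longrightarrow> hol (v @ w) = hol v + hol w"
  using cen_append_right[of v w "length w"] by (simp add: hol_def)

lemma word_append: "word v \<Longrightarrow> word w \<Longrightarrow> word (v @ w)"
  by (auto simp: word_def)

text \<open>After the even word \<open>v\<close> the development has moved by \<open>hol v\<close>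
  and is back in the first sheet, so from there the gate between \<open>l\<close> and
  \<open>r\<close> appears moved by \<open>- hol v\<close>.\<close>

lemma fits_append:
  assumes ev: "even (length v)" and v: "fits h g v l r" and w: "fits h g w (l - hol v) (r - hol v)"
  shows "fits h g (v @ w) l r"
  unfolding fits_def
proof (intro allI impI ballI)
  fix i u assume i: "i < length (v @ w)" and u: "u \<in> {h, g}"
  show "cross u l \<le> cross u (cen (v @ w) i + sg (even i) *\<^sub>R vertex (Suc ((v @ w) ! i))) \<and>
     cross u (cen (v @ w) i + sg (even i) *\<^sub>R vertex ((v @ w) ! i)) \<le> cross u r"
  proof (cases "i < length v")
    case True
    then have "cen (v @ w) i = cen v i" "(v @ w) ! i = v ! i" by (simp_all add: cen_append_left nth_append)
    then show ?thesis using v u True unfolding fits_def by metis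
  next
    case False
    define j where "j = i - length v"
    have j: "i = length v + j" "j < length w" using False i by (auto simp: j_def)
    have "cross u (l - hol v) \<le> cross u (cen w j + sg (even j) *\<^sub>R vertex (Suc (w ! j))) \<and>
      cross u (cen w j + sg (even j) *\<^sub>R vertex (w ! j)) \<le> cross u (r - hol v)"
      using w j u unfolding fits_def by blast
    moreover have "(v @ w) ! i = w ! j" "even i = even j" using ev by (simp_all add: j(1) nth_append)
    ultimately show ?thesis unfolding j(1) cen_append_right[OF ev] by (simp add: cross_linear algebra_simps)
  qed
qed

text \<open>The inequalities are linear in the direction and so pass to the nonnegative combinations
  \<open>h'\<close> and \<open>g'\<close>; a gate that is narrower as seen along both may replace
  the old one.\<close>

lemma fits_mono:
  assumes f: "fits h g w l r"
    and h': "h' = x *\<^sub>R h + y *\<^sub>R g" "x \<ge> 0" "y \<ge> 0" and g': "g' = x' *\<^sub>R h + y' *\<^sub>R g" "x' \<ge> 0" "y' \<ge> 0"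
    and l: "cross h' l' \<le> cross h' l" "cross g' l' \<le> cross g' l"
    and r: "cross h' r \<le> cross h' r'" "cross g' r \<le> cross g' r'"
  shows "fits h' g' w l' r'"
  unfolding fits_def
proof (intro allI impI ballI)
  fix i v assume i: "i < length w" and v: "v \<in> {h', g'}"
  obtain a b where ab: "v = a *\<^sub>R h + b *\<^sub>R g" "a \<ge> 0" "b \<ge> 0" using v h' g' by blast
  let ?U = "cen w i + sg (even i) *\<^sub>R vertex (Suc (w ! i))" and ?D = "cen w i + sg (even i) *\<^sub>R vertex (w ! i)"
  have f: "cross h l \<le> cross h ?U" "cross g l \<le> cross g ?U" "cross h ?D \<le> cross h r" "cross g ?D \<le> cross g r"
    using f i unfolding fits_def by auto
  have "cross v l \<le> cross v ?U" "cross v ?D \<le> cross v r"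
    unfolding ab(1) cross_add_left cross_scaleR_left using f ab by (auto intro!: add_mono mult_left_mono)
  moreover have "cross v l' \<le> cross v l" "cross v r \<le> cross v r'" using v l r by auto
  ultimately show "cross v l' \<le> cross v ?U \<and> cross v ?D \<le> cross v r'" by linarith
qed

text \<open>Crossings from \<open>P\<close> to \<open>-P\<close> minus crossings back: the
  intersection number of the closed curve with the side.\<close>

definition cnt :: "nat list \<Rightarrow> nat \<Rightarrow> real" where
  "cnt w k = (\<Sum>i | i < length w \<and> w ! i = k. sg (even i))"

lemma cnt_append: "even (length v) \<Longrightarrow> cnt (v @ w) k = cnt v k + cnt w k"
proof -
  assume ev: "even (length v)"
  have c: "cnt w k = (\<Sum>i<length w. if w ! i = k then sg (even i) else 0)" for w
    unfolding cnt_def by (subst sum.inter_filter[symmetric]) auto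
  have "cnt (v @ w) k = (\<Sum>i<length v. if (v @ w) ! i = k then sg (even i) else 0) +
     (\<Sum>i=length v..<length v + length w. if (v @ w) ! i = k then sg (even i) else 0)"
    unfolding c by (simp add: lessThan_atLeast0 sum.atLeastLessThan_concat)
  also have "(\<Sum>i<length v. if (v @ w) ! i = k then sg (even i) else 0) = cnt v k"
    unfolding c by (intro sum.cong) (auto simp: nth_append)
  also have "(\<Sum>i=length v..<length v + length w. if (v @ w) ! i = k then sg (even i) else 0) =
    (\<Sum>i<length w. if (v @ w) ! (i + length v) = k then sg (even (i + length v)) else 0)"
    using sum.shift_bounds_nat_ivl[of "\<lambda>i. if (v @ w) ! i = k then sg (even i) else 0" 0 "length v" "length w"]
    by (simp add: lessThan_atLeast0 add.commute)
  also have "\<dots> = cnt w k" unfolding c using ev by (intro sum.cong) (auto simp: nth_append)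
  finally show ?thesis .
qed

text \<open>
  The double pentagon cut and reglued to an L-shaped table with three parallelograms of sides
  \<open>h, g\<close>, \<open>h / phi, g\<close> (on the left) and \<open>h, g / phi\<close> (below); its inner corner is developed to
  \<open>c\<close>. The word \<open>A\<close>, say, lists the sides crossed on the way out of the table through the
  right-hand side of the central parallelogram, whose end points are \<open>c + h + g\<close> and \<open>c + h\<close>.
  The sides of the pentagon run from the upper left to the lower right in the coordinates \<open>h, g\<close>,
  which makes \<open>fits\<close> possible.
\<close>

definition table :: "complex \<Rightarrow> complex \<Rightarrow> nat list \<Rightarrow> nat list \<Rightarrow> nat list \<Rightarrow> nat list \<Rightarrow> bool" where
  "table h g a A b B \<longleftrightarrow> cross h g > 0 \<and> word a \<and> word A \<and> word b \<and> word B \<and>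
     hol a = h \<and> hol A = phi *\<^sub>R h \<and> hol b = g \<and> hol B = phi *\<^sub>R g \<and>
     (\<exists>c. fits h g a (c + h) (c + h - (phi - 1) *\<^sub>R g) \<and> fits h g A (c + h + g) (c + h) \<and>
       fits h g b (c - (phi - 1) *\<^sub>R h + g) (c + g) \<and> fits h g B (c + g) (c + h + g)) \<and>
     (\<forall>k<5. edge k = ((phi - 1) * cnt a k + cnt A k) *\<^sub>R g - ((phi - 1) * cnt b k + cnt B k) *\<^sub>R h) \<and>
     (\<forall>j<5. \<forall>k<5. hop j - hop k \<in> lattice h g)"

lemma lattice_mono:
  assumes "h \<in> lattice h' g'" "g \<in> lattice h' g'"
  shows "lattice h g \<subseteq> lattice h' g'"
proof
  fix v assume "v \<in> lattice h g"
  then obtain x y where v: "v = x *\<^sub>R h + y *\<^sub>R g" "x \<in> golden_ints" "y \<in> golden_ints"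
    unfolding lattice_def by blast
  have phi: "phi *\<^sub>R w \<in> lattice h' g'" if "w \<in> lattice h' g'" for w
  proof -
    from that obtain x y where w: "w = x *\<^sub>R h' + y *\<^sub>R g'" "x \<in> golden_ints" "y \<in> golden_ints"
      unfolding lattice_def by blast
    then have "phi *\<^sub>R w = (phi * x) *\<^sub>R h' + (phi * y) *\<^sub>R g'" by (simp add: scaleR_add_right)
    then show ?thesis unfolding lattice_def using golden_ints_phi_mult w(2,3) by blast
  qed
  have int: "of_int m *\<^sub>R w \<in> lattice h' g'" if w: "w \<in> lattice h' g'" for m w
  proof (induction m rule: int_induct[where k = 0])
    case base then show ?case by (simp add: lattice_zero)
  next
    case (step1 i) then show ?case using lattice_add[OF _ w] by (simp add: scaleR_add_left)
  next
    case (step2 i) then show ?case using lattice_add[OF _ lattice_minus[OF w]] by (simp add: scaleR_diff_left)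
  qed
  have mult: "x *\<^sub>R w \<in> lattice h' g'" if "x \<in> golden_ints" "w \<in> lattice h' g'" for x w
  proof -
    from that(1) obtain m n where x: "x = of_int m + of_int n * phi" unfolding golden_ints_def by blast
    have "x *\<^sub>R w = of_int m *\<^sub>R w + of_int n *\<^sub>R (phi *\<^sub>R w)" by (simp add: x scaleR_add_left)
    then show ?thesis using lattice_add[OF int[OF that(2), of m] int[OF phi[OF that(2)], of n]] by simp
  qed
  show "v \<in> lattice h' g'" unfolding v(1) by (intro lattice_add mult v(2,3) assms)
qed

lemma latticeI: "v = x *\<^sub>R h + y *\<^sub>R g \<Longrightarrow> x \<in> golden_ints \<Longrightarrow> y \<in> golden_ints \<Longrightarrow> v \<in> lattice h g"
  unfolding lattice_def by blast

text \<open>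
  The inner corner of the new table is developed to \<open>c\<close>, \<open>c + (1 - phi) h\<close>, \<open>c + (1 - phi) g\<close>
  and \<open>c\<close>, respectively.
\<close>

lemma table_step:
  assumes t: "table h g a A b B"
  shows "table h (phi *\<^sub>R h + g) a A (A @ b) (A @ B @ a)"
    "table (phi *\<^sub>R h + g) (phi *\<^sub>R h + phi *\<^sub>R g) (A @ b) (B @ a @ A) (B @ A) (B @ a @ A @ b)"
    "table (phi *\<^sub>R h + phi *\<^sub>R g) (h + phi *\<^sub>R g) (A @ B) (A @ b @ B @ a) (B @ a) (A @ b @ B)"
    "table (h + phi *\<^sub>R g) g (B @ a) (B @ A @ b) b B"
proof -
  define \<kappa> where "\<kappa> = cross h g"
  have hg: "cross h g = \<kappa>" "cross g h = - \<kappa>" by (simp_all add: \<kappa>_def cross_def)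
  \<comment> \<open>After expansion \<open>c\<close> cancels, every inequality of the new tables is
    linear in \<open>\<kappa>\<close> and \<open>phi * \<kappa>\<close>, and these bounds decide
    it.\<close>
  have \<kappa>: "\<kappa> > 0" "phi * \<kappa> > 3 / 2 * \<kappa>" "phi * \<kappa> < 2 * \<kappa>"
    using t phi_bounds by (auto simp: table_def \<kappa>_def mult_strict_right_mono)
  have words: "word a" "word A" "word b" "word B" using t by (auto simp: table_def)
  then have ev: "even (length a)" "even (length A)" "even (length b)" "even (length B)" by (auto simp: word_def)
  have hols: "hol a = h" "hol A = phi *\<^sub>R h" "hol b = g" "hol B = phi *\<^sub>R g" using t by (auto simp: table_def)
  obtain c where f: "fits h g a (c + h) (c + h - (phi - 1) *\<^sub>R g)" "fits h g A (c + h + g) (c + h)"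
    "fits h g b (c - (phi - 1) *\<^sub>R h + g) (c + g)" "fits h g B (c + g) (c + h + g)"
    using t by (auto simp: table_def)
  have ed: "edge k = ((phi - 1) * cnt a k + cnt A k) *\<^sub>R g - ((phi - 1) * cnt b k + cnt B k) *\<^sub>R h" if "k < 5" for k
    using t that by (auto simp: table_def)
  have lat: "hop j - hop k \<in> lattice h g" if "j < 5" "k < 5" for j k
    using t that by (auto simp: table_def)
  have gi: "phi \<in> golden_ints" "- phi \<in> golden_ints" "1 \<in> golden_ints" "- 1 \<in> golden_ints" "0 \<in> golden_ints"
    using golden_ints_of_int[of 0] golden_ints_of_int[of 1] golden_ints_phi golden_ints_minus by auto
  note p = phi_pos less_imp_le[OF phi_pos]
  note cs = cross_linear hg cross_self minus_add_distrib distrib_left distrib_right left_diff_distrib right_diff_distrib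
    phi_mult_phi phi_mult_phi_mult mult_1_left mult_1_right mult_minus_left mult_minus_right minus_minus mult.assoc mult_zero_right
  have pos: "cross h (phi *\<^sub>R h + g) > 0" "cross (phi *\<^sub>R h + g) (phi *\<^sub>R h + phi *\<^sub>R g) > 0"
    "cross (phi *\<^sub>R h + phi *\<^sub>R g) (h + phi *\<^sub>R g) > 0" "cross (h + phi *\<^sub>R g) g > 0"
    using \<kappa> by (simp_all add: cs)
  show "table h (phi *\<^sub>R h + g) a A (A @ b) (A @ B @ a)"
    unfolding table_def
  proof (intro conjI)
    let ?h = "h" and ?g = "(phi *\<^sub>R h + g)"
    have h': "?h = 1 *\<^sub>R h + 0 *\<^sub>R g" "(1::real) \<ge> 0" "(0::real) \<ge> 0"
      and g': "?g = phi *\<^sub>R h + 1 *\<^sub>R g" "(phi::real) \<ge> 0" "(1::real) \<ge> 0"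
      using p by simp_all
    show "\<exists>c. fits ?h ?g (a) (c + ?h) (c + ?h - (phi - 1) *\<^sub>R ?g) \<and> fits ?h ?g (A) (c + ?h + ?g) (c + ?h) \<and>
       fits ?h ?g (A @ b) (c - (phi - 1) *\<^sub>R ?h + ?g) (c + ?g) \<and> fits ?h ?g (A @ B @ a) (c + ?g) (c + ?h + ?g)"
      by (intro exI[of _ "c"] conjI fits_append ev f[THEN fits_mono, OF h' g'];
          simp only: hols cs; use \<kappa> in linarith)
  next
    show "\<forall>k<5. edge k = ((phi - 1) * cnt (a) k + cnt (A) k) *\<^sub>R (phi *\<^sub>R h + g) - ((phi - 1) * cnt (A @ b) k + cnt (A @ B @ a) k) *\<^sub>R h"
      by (simp add: ed cnt_append ev algebra_simps)
  next
    \<comment> \<open>The four base changes have determinant 1 and entries in the golden integers;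
      the coefficients here and below are those of their inverses.\<close>
    have "lattice h g \<subseteq> lattice h (phi *\<^sub>R h + g)"
      by (intro lattice_mono latticeI[where x = "1" and y = "0" and v = h] latticeI[where x = "- phi" and y = "1" and v = g] gi) (simp_all add: algebra_simps)
    then show "\<forall>j<5. \<forall>k<5. hop j - hop k \<in> lattice h (phi *\<^sub>R h + g)" using lat by blast
  qed (use pos words in \<open>simp_all add: hol_append ev hols word_append algebra_simps\<close>)
  show "table (phi *\<^sub>R h + g) (phi *\<^sub>R h + phi *\<^sub>R g) (A @ b) (B @ a @ A) (B @ A) (B @ a @ A @ b)"
    unfolding table_def
  proof (intro conjI)
    let ?h = "(phi *\<^sub>R h + g)" and ?g = "(phi *\<^sub>R h + phi *\<^sub>R g)"
    have h': "?h = phi *\<^sub>R h + 1 *\<^sub>R g" "(phi::real) \<ge> 0" "(1::real) \<ge> 0"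
      and g': "?g = phi *\<^sub>R h + phi *\<^sub>R g" "(phi::real) \<ge> 0" "(phi::real) \<ge> 0"
      using p by simp_all
    show "\<exists>c. fits ?h ?g (A @ b) (c + ?h) (c + ?h - (phi - 1) *\<^sub>R ?g) \<and> fits ?h ?g (B @ a @ A) (c + ?h + ?g) (c + ?h) \<and>
       fits ?h ?g (B @ A) (c - (phi - 1) *\<^sub>R ?h + ?g) (c + ?g) \<and> fits ?h ?g (B @ a @ A @ b) (c + ?g) (c + ?h + ?g)"
      by (intro exI[of _ "c + (1 - phi) *\<^sub>R h"] conjI fits_append ev f[THEN fits_mono, OF h' g'];
          simp only: hols cs; use \<kappa> in linarith)
  next
    show "\<forall>k<5. edge k = ((phi - 1) * cnt (A @ b) k + cnt (B @ a @ A) k) *\<^sub>R (phi *\<^sub>R h + phi *\<^sub>R g) - ((phi - 1) * cnt (B @ A) k + cnt (B @ a @ A @ b) k) *\<^sub>R (phi *\<^sub>R h + g)"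
      by (simp add: ed cnt_append ev algebra_simps)
  next
    have "lattice h g \<subseteq> lattice (phi *\<^sub>R h + g) (phi *\<^sub>R h + phi *\<^sub>R g)"
      by (intro lattice_mono latticeI[where x = "phi" and y = "- 1" and v = h] latticeI[where x = "- phi" and y = "phi" and v = g] gi) (simp_all add: algebra_simps)
    then show "\<forall>j<5. \<forall>k<5. hop j - hop k \<in> lattice (phi *\<^sub>R h + g) (phi *\<^sub>R h + phi *\<^sub>R g)" using lat by blast
  qed (use pos words in \<open>simp_all add: hol_append ev hols word_append algebra_simps\<close>)
  show "table (phi *\<^sub>R h + phi *\<^sub>R g) (h + phi *\<^sub>R g) (A @ B) (A @ b @ B @ a) (B @ a) (A @ b @ B)"
    unfolding table_def
  proof (intro conjI)
    let ?h = "(phi *\<^sub>R h + phi *\<^sub>R g)" and ?g = "(h + phi *\<^sub>R g)"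
    have h': "?h = phi *\<^sub>R h + phi *\<^sub>R g" "(phi::real) \<ge> 0" "(phi::real) \<ge> 0"
      and g': "?g = 1 *\<^sub>R h + phi *\<^sub>R g" "(1::real) \<ge> 0" "(phi::real) \<ge> 0"
      using p by simp_all
    show "\<exists>c. fits ?h ?g (A @ B) (c + ?h) (c + ?h - (phi - 1) *\<^sub>R ?g) \<and> fits ?h ?g (A @ b @ B @ a) (c + ?h + ?g) (c + ?h) \<and>
       fits ?h ?g (B @ a) (c - (phi - 1) *\<^sub>R ?h + ?g) (c + ?g) \<and> fits ?h ?g (A @ b @ B) (c + ?g) (c + ?h + ?g)"
      by (intro exI[of _ "c + (1 - phi) *\<^sub>R g"] conjI fits_append ev f[THEN fits_mono, OF h' g'];
          simp only: hols cs; use \<kappa> in linarith)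
  next
    show "\<forall>k<5. edge k = ((phi - 1) * cnt (A @ B) k + cnt (A @ b @ B @ a) k) *\<^sub>R (h + phi *\<^sub>R g) - ((phi - 1) * cnt (B @ a) k + cnt (A @ b @ B) k) *\<^sub>R (phi *\<^sub>R h + phi *\<^sub>R g)"
      by (simp add: ed cnt_append ev algebra_simps)
  next
    have "lattice h g \<subseteq> lattice (phi *\<^sub>R h + phi *\<^sub>R g) (h + phi *\<^sub>R g)"
      by (intro lattice_mono latticeI[where x = "phi" and y = "- phi" and v = h] latticeI[where x = "- 1" and y = "phi" and v = g] gi) (simp_all add: algebra_simps)
    then show "\<forall>j<5. \<forall>k<5. hop j - hop k \<in> lattice (phi *\<^sub>R h + phi *\<^sub>R g) (h + phi *\<^sub>R g)" using lat by blast
  qed (use pos words in \<open>simp_all add: hol_append ev hols word_append algebra_simps\<close>)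
  show "table (h + phi *\<^sub>R g) g (B @ a) (B @ A @ b) b B"
    unfolding table_def
  proof (intro conjI)
    let ?h = "(h + phi *\<^sub>R g)" and ?g = "g"
    have h': "?h = 1 *\<^sub>R h + phi *\<^sub>R g" "(1::real) \<ge> 0" "(phi::real) \<ge> 0"
      and g': "?g = 0 *\<^sub>R h + 1 *\<^sub>R g" "(0::real) \<ge> 0" "(1::real) \<ge> 0"
      using p by simp_all
    show "\<exists>c. fits ?h ?g (B @ a) (c + ?h) (c + ?h - (phi - 1) *\<^sub>R ?g) \<and> fits ?h ?g (B @ A @ b) (c + ?h + ?g) (c + ?h) \<and>
       fits ?h ?g (b) (c - (phi - 1) *\<^sub>R ?h + ?g) (c + ?g) \<and> fits ?h ?g (B) (c + ?g) (c + ?h + ?g)"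
      by (intro exI[of _ "c"] conjI fits_append ev f[THEN fits_mono, OF h' g'];
          simp only: hols cs; use \<kappa> in linarith)
  next
    show "\<forall>k<5. edge k = ((phi - 1) * cnt (B @ a) k + cnt (B @ A @ b) k) *\<^sub>R g - ((phi - 1) * cnt (b) k + cnt (B) k) *\<^sub>R (h + phi *\<^sub>R g)"
      by (simp add: ed cnt_append ev algebra_simps)
  next
    have "lattice h g \<subseteq> lattice (h + phi *\<^sub>R g) g"
      by (intro lattice_mono latticeI[where x = "1" and y = "- phi" and v = h] latticeI[where x = "0" and y = "1" and v = g] gi) (simp_all add: algebra_simps)
    then show "\<forall>j<5. \<forall>k<5. hop j - hop k \<in> lattice (h + phi *\<^sub>R g) g" using lat by blast
  qed (use pos words in \<open>simp_all add: hol_append ev hols word_append algebra_simps\<close>)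
qed

section \<open>The table of the initial edge\<close>

text \<open>For \<open>x = pi / 5\<close>, \<open>cos (3 * x) = - cos (2 * x)\<close> is a cubic
  equation in the cosine. The factor \<open>c + 1\<close> drops out, and \<open>phi / 2\<close> is
  the only positive root of the remaining quadratic.\<close>

lemma two_cos_pi_fifth: "2 * cos (pi / 5) = phi"
proof -
  define c where "c = cos (pi / 5)"
  have c: "c > 0" unfolding c_def by (rule cos_gt_zero; use pi_gt_zero in linarith)
  have "cos (3 * (pi / 5)) = cos (pi - 2 * (pi / 5))" by (simp add: field_simps)
  also have "\<dots> = - cos (2 * (pi / 5))" by (simp only: cos_pi_minus)
  finally have "4 * c ^ 3 - 3 * c = - (2 * c\<^sup>2 - 1)"
    unfolding cos_treble_cos cos_double_cos c_def .
  then have "(c + 1) * (4 * c\<^sup>2 - 2 * c - 1) = 0" by (simp add: power3_eq_cube power2_eq_square algebra_simps)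
  then have "4 * c\<^sup>2 - 2 * c - 1 = 0" using c by simp
  then have "(2 * c - phi) * (2 * c + phi - 1) = 0" by (simp add: power2_eq_square algebra_simps)
  moreover have "2 * c + phi - 1 \<noteq> 0" using c phi_bounds by simp
  ultimately show ?thesis by (simp add: c_def)
qed

definition omega :: complex where
  "omega = cis (pi / 5)"

lemma omega_sq: "omega * omega = phi *\<^sub>R omega - 1"
proof -
  have "omega * omega + omega * cnj omega = omega * (omega + cnj omega)" by (simp add: algebra_simps)
  also have "omega + cnj omega = of_real phi"
    by (simp add: omega_def complex_eq_iff flip: two_cos_pi_fifth)
  also have "omega * cnj omega = 1" by (simp add: omega_def cis_cnj cis_mult)
  finally show ?thesis by (simp add: scaleR_conv_of_real algebra_simps)
qed

lemma omega_power5: "omega ^ 5 = -1"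
  by (simp add: omega_def Complex.DeMoivre)

lemma vertex_rotate: "vertex (j + m) = omega ^ (2 * m) * vertex j"
  unfolding vertex_def omega_def Complex.DeMoivre cis_mult 
  by (rule arg_cong[of _ _ cis]) (simp add: add_divide_distrib distrib_left distrib_right)

text \<open>The edges are \<open>edge 0\<close> turned by even powers of \<open>omega\<close>, and
  \<open>omega * omega = phi *\<^sub>R omega - 1\<close> brings every power back to the basis
  \<open>edge 0\<close>, \<open>omega * edge 0\<close> with golden integer coefficients.\<close>

lemma vertices:
  defines "f \<equiv> omega * edge 0"
  shows "vertex 1 = vertex 0 + edge 0" "vertex 2 = vertex 0 + phi *\<^sub>R f"
    "vertex 3 = vertex 0 + phi *\<^sub>R f + f - phi *\<^sub>R edge 0" "vertex 4 = vertex 0 + phi *\<^sub>R f - phi *\<^sub>R edge 0"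
    "vertex 5 = vertex 0"
proof -
  have e: "edge m = omega ^ (2 * m) * edge 0" for m
    using vertex_rotate[of 0 m] vertex_rotate[of 1 m] by (simp add: edge_def algebra_simps)
  have o2: "omega * (omega * x) = phi *\<^sub>R (omega * x) - x" for x
    by (metis omega_sq mult.assoc left_diff_distrib mult_1 mult_scaleR_left)
  have e1: "edge 1 = phi *\<^sub>R f - edge 0"
    unfolding e[of 1] f_def by (simp add: power2_eq_square mult.assoc o2)
  have e2: "edge 2 = f - phi *\<^sub>R edge 0"
    unfolding e[of 2] f_def by (simp add: eval_nat_numeral mult.assoc o2 algebra_simps)
  have e3: "edge 3 = - f"
    unfolding e[of 3] f_def by (simp add: eval_nat_numeral mult.assoc o2 algebra_simps)
  show 1: "vertex 1 = vertex 0 + edge 0" by (simp add: edge_def)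
  show 2: "vertex 2 = vertex 0 + phi *\<^sub>R f"
    using e1 1 by (simp add: edge_def numeral_2_eq_2 algebra_simps)
  show 3: "vertex 3 = vertex 0 + phi *\<^sub>R f + f - phi *\<^sub>R edge 0"
    using e2 2 unfolding edge_def[of 2] by (simp add: Suc_numeral algebra_simps)
  show "vertex 4 = vertex 0 + phi *\<^sub>R f - phi *\<^sub>R edge 0"
    using e3 3 unfolding edge_def[of 3] by (simp add: Suc_numeral algebra_simps)
  show "vertex 5 = vertex 0" using vertex_plus5[of 0] by simp
qed

lemma cross_omega: "cross (edge 0) (omega * edge 0) > 0"
proof -
  have "cross z (omega * z) = sin (pi / 5) * (cmod z)\<^sup>2" for z
    unfolding cmod_power2 by (simp add: cross_def omega_def power2_eq_square algebra_simps)
  moreover have "sin (pi / 5) > 0" by (rule sin_gt_zero) auto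
  moreover have "edge 0 \<noteq> 0" using vertex_inj[of 0 1] by (auto simp: edge_def)
  ultimately show ?thesis by simp
qed

lemma cnt_eq: "cnt w k = (\<Sum>i<length w. if w ! i = k then sg (even i) else 0)"
  unfolding cnt_def by (subst sum.inter_filter[symmetric]) auto

lemma cnt_two: "cnt [i, j] k = (if i = k then 1 else 0) - (if j = k then 1 else 0)"
proof -
  have "{..<length [i, j]} = {0, 1}" by auto
  then show ?thesis unfolding cnt_eq by (simp add: sg_def)
qed

lemma fits_two: "fits h g [j, k] l r \<longleftrightarrow>
    cross h l \<le> cross h (vertex (Suc j)) \<and> cross h (vertex j) \<le> cross h r \<and>
    cross h l \<le> cross h (hop j - vertex (Suc k)) \<and> cross h (hop j - vertex k) \<le> cross h r \<and>
    cross g l \<le> cross g (vertex (Suc j)) \<and> cross g (vertex j) \<le> cross g r \<and>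
    cross g l \<le> cross g (hop j - vertex (Suc k)) \<and> cross g (hop j - vertex k) \<le> cross g r"
proof -
  have all2: "(\<forall>i<length [j, k]. P i) \<longleftrightarrow> P 0 \<and> P 1" for P
    by (auto simp: less_Suc_eq)
  show ?thesis
    unfolding fits_def all2 by (auto simp: cen_def sg_def)
qed

text \<open>The directions of the sides labelled 3 and 4; the word \<open>[3, 2]\<close> of indices is labelled \<open>42\<close>.\<close>

lemma table_base:
  "table (- phi *\<^sub>R edge 0) (- phi *\<^sub>R (omega * edge 0)) [3, 2] [4, 1] [0, 1] [4, 2]"
proof -
  define e f v where "e = edge 0" and "f = omega * e" and "v = vertex 0"
  note vs = vertices[folded e_def, folded f_def v_def]
  have v0: "vertex 0 = v" "vertex (Suc 0) = v + e" using vs by (simp_all add: v_def)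
  have vS: "vertex (Suc 1) = v + phi *\<^sub>R f" "vertex (Suc 2) = v + phi *\<^sub>R f + f - phi *\<^sub>R e"
    "vertex (Suc 3) = v + phi *\<^sub>R f - phi *\<^sub>R e" "vertex (Suc 4) = v"
    using vs by (simp_all add: Suc_numeral numeral_2_eq_2[symmetric])
  define \<kappa> where "\<kappa> = cross e f"
  have \<kappa>: "\<kappa> > 0" "phi * \<kappa> > 3 / 2 * \<kappa>" "phi * \<kappa> < 2 * \<kappa>"
    using cross_omega phi_bounds unfolding \<kappa>_def e_def f_def by (auto intro: mult_strict_right_mono)
  have ef: "cross e f = \<kappa>" "cross f e = - \<kappa>" by (simp_all add: \<kappa>_def cross_def)
  have hops: "hop 0 = v + v + e" "hop 1 = v + e + v + phi *\<^sub>R f" "hop 2 = v + v + phi *\<^sub>R f + phi *\<^sub>R f + f - phi *\<^sub>R e"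
    "hop 3 = v + v + phi *\<^sub>R f + phi *\<^sub>R f + f - phi *\<^sub>R e - phi *\<^sub>R e" "hop 4 = v + v + phi *\<^sub>R f - phi *\<^sub>R e"
    using vs v0 by (simp_all add: hop_def Suc_numeral numeral_2_eq_2[symmetric])
  have hol2: "hol [j, k] = hop j - hop k" for j k
    by (simp add: hol_def cen_def sg_def eval_nat_numeral)
  note cs = cross_linear ef cross_self cross_zero distrib_left distrib_right left_diff_distrib right_diff_distrib
    phi_mult_phi phi_mult_phi_mult mult_1_left mult_1_right mult_minus_left mult_minus_right minus_minus mult.assoc mult_zero_right
  have k5: "k = 0 \<or> k = 1 \<or> k = 2 \<or> k = 3 \<or> k = 4" if "k < 5" for k :: nat using that by auto
  show ?thesis
    unfolding table_def e_def[symmetric] f_def[symmetric]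
  proof (intro conjI)
    let ?h = "- phi *\<^sub>R e" and ?g = "- phi *\<^sub>R f"
    show "cross ?h ?g > 0" using \<kappa> by (simp add: cs)
    \<comment> \<open>The inner corner of this table is developed to vertex 2, which is
      \<open>v + phi *\<^sub>R f\<close>.\<close>
    show "\<exists>c. fits ?h ?g [3, 2] (c + ?h) (c + ?h - (phi - 1) *\<^sub>R ?g) \<and> fits ?h ?g [4, 1] (c + ?h + ?g) (c + ?h) \<and>
       fits ?h ?g [0, 1] (c - (phi - 1) *\<^sub>R ?h + ?g) (c + ?g) \<and> fits ?h ?g [4, 2] (c + ?g) (c + ?h + ?g)"
      unfolding fits_two One_nat_def[symmetric] hops
      by (intro exI[of _ "v + phi *\<^sub>R f"] conjI; simp only: vs vS v0 cs; use \<kappa> in linarith)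
    show "\<forall>k<5. edge k = ((phi - 1) * cnt [3, 2] k + cnt [4, 1] k) *\<^sub>R ?g - ((phi - 1) * cnt [0, 1] k + cnt [4, 2] k) *\<^sub>R ?h"
    proof (intro allI impI)
      fix k :: nat assume "k < 5"
      from k5[OF this] show "edge k = ((phi - 1) * cnt [3, 2] k + cnt [4, 1] k) *\<^sub>R ?g - ((phi - 1) * cnt [0, 1] k + cnt [4, 2] k) *\<^sub>R ?h"
        by (elim disjE; simp add: cnt_two edge_def vs v0 vS[unfolded One_nat_def] algebra_simps)
    qed
    show "\<forall>j<5. \<forall>k<5. hop j - hop k \<in> lattice ?h ?g"
    proof (intro allI impI)
      \<comment> \<open>\<open>1 - phi\<close> is the inverse of \<open>- phi\<close> and recovers
        \<open>e\<close> and \<open>f\<close> from the scaled vectors.\<close>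
      have gi: "1 - phi \<in> golden_ints" "0 \<in> golden_ints" "1 \<in> golden_ints" "phi \<in> golden_ints" "- phi \<in> golden_ints"
        using golden_ints_of_int[of 0] golden_ints_of_int[of 1] golden_ints_phi golden_ints_minus[OF golden_ints_phi]
          golden_ints_diff[OF golden_ints_of_int[of 1] golden_ints_phi] by simp_all
      have sub: "lattice e f \<subseteq> lattice ?h ?g"
        by (intro lattice_mono latticeI[where v = e and x = "1 - phi" and y = 0] latticeI[where v = f and x = 0 and y = "1 - phi"] gi)
          (simp_all add: algebra_simps)
      have vl: "vertex j - v \<in> lattice e f" for j
      proof -
        have "vertex (j mod 5) - v = 0 *\<^sub>R e + 0 *\<^sub>R f \<or> vertex (j mod 5) - v = 1 *\<^sub>R e + 0 *\<^sub>R f \<or>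
            vertex (j mod 5) - v = 0 *\<^sub>R e + phi *\<^sub>R f \<or> vertex (j mod 5) - v = (- phi) *\<^sub>R e + (phi + 1) *\<^sub>R f \<or>
            vertex (j mod 5) - v = (- phi) *\<^sub>R e + phi *\<^sub>R f"
          using k5[OF mod_less_divisor, of j, simplified] by (elim disjE) (simp_all add: vs v0 algebra_simps)
        then have "vertex (j mod 5) - v \<in> lattice e f"
          by (elim disjE) (erule latticeI; simp only: gi golden_ints_add)+
        then show ?thesis by (simp add: vertex_mod)
      qed
      fix j k :: nat
      have "hop j - hop k = (vertex j - v) + - (vertex k - v) + ((vertex (Suc j) - v) + - (vertex (Suc k) - v))"
        by (simp add: hop_def)
      also have "\<dots> \<in> lattice e f" by (intro lattice_add lattice_minus vl)
      finally show "hop j - hop k \<in> lattice ?h ?g" using sub by blast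
    qed
    show "hol [3, 2] = ?h" "hol [4, 1] = phi *\<^sub>R ?h" "hol [0, 1] = ?g" "hol [4, 2] = phi *\<^sub>R ?g"
      by (simp_all add: hol2 hops[unfolded One_nat_def] algebra_simps)
  qed (simp_all add: word_def)
qed

section \<open>The rotational symmetry of the pentagon\<close>

text \<open>Multiplication by \<open>- omega\<close> is the rotation by 6 pi / 5, three steps of the
  pentagon. The sign is there because the rotation by pi / 5 alone would exchange \<open>P\<close>
  and \<open>-P\<close>.\<close>

definition turn :: "nat \<Rightarrow> nat" where
  "turn j = (j + 3) mod 5"

lemma vertex_turn: "vertex (turn j) = - (omega * vertex j)" "vertex (Suc (turn j)) = - (omega * vertex (Suc j))"
proof -
  have o6: "omega ^ (2 * 3) = - omega" using omega_power5 by (simp add: eval_nat_numeral)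
  show 1: "vertex (turn j) = - (omega * vertex j)" for j
    unfolding turn_def vertex_mod vertex_rotate o6 by simp
  have "vertex (Suc (turn j)) = vertex (turn (Suc j))"
    unfolding turn_def vertex_mod by (metis add_Suc mod_Suc_eq vertex_mod)
  then show "vertex (Suc (turn j)) = - (omega * vertex (Suc j))" using 1 by simp
qed

lemma hop_turn: "hop (turn j) = - (omega * hop j)" and edge_turn: "edge (turn j) = - (omega * edge j)"
  by (simp_all add: hop_def edge_def vertex_turn algebra_simps)

lemma turn_less: "turn j < 5" and turn_inj: "j < 5 \<Longrightarrow> k < 5 \<Longrightarrow> turn j = turn k \<longleftrightarrow> j = k"
  and turn_surj: "k < 5 \<Longrightarrow> \<exists>j<5. k = turn j"
proof -
  show "turn j < 5" by (simp add: turn_def)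
  have inv: "turn ((k + 2) mod 5) = k" "(turn k + 2) mod 5 = k" if "k < 5" for k
    using that mod_add_left_eq[of "k + 2" 5 3] mod_add_left_eq[of "k + 3" 5 2] by (simp_all add: turn_def)
  show "j < 5 \<Longrightarrow> k < 5 \<Longrightarrow> turn j = turn k \<longleftrightarrow> j = k"
    using inv(2) by metis
  show "k < 5 \<Longrightarrow> \<exists>j<5. k = turn j"
    using inv(1) by (metis mod_less_divisor zero_less_numeral)
qed

lemma cross_turn: "cross (- (omega * x)) (- (omega * y)) = cross x y"
proof -
  have c: "Re omega * Re omega + Im omega * Im omega = 1"
    using norm_cis[of "pi / 5"] unfolding omega_def by (metis cmod_power2 one_power2 power2_eq_square)
  have "cross (- (omega * x)) (- (omega * y)) = (Re omega * Re omega + Im omega * Im omega) * cross x y"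
    by (simp add: cross_def algebra_simps)
  then show ?thesis by (simp add: c)
qed

lemma table_turn:
  assumes t: "table h g a A b B"
  shows "table (- (omega * h)) (- (omega * g)) (map turn a) (map turn A) (map turn b) (map turn B)"
proof -
  let ?R = "\<lambda>z. - (omega * z)"
  have R: "?R (x + y) = ?R x + ?R y" "?R (x - y) = ?R x - ?R y" "?R (r *\<^sub>R x) = r *\<^sub>R ?R x" for x y r
    by (simp_all add: algebra_simps)
  have cenR: "cen (map turn w) i = ?R (cen w i)" if "i \<le> length w" for w i
    using that unfolding cen_def by (simp add: hop_turn sum_distrib_left sum_negf)
  have holR: "hol (map turn w) = ?R (hol w)" for w by (simp add: hol_def cenR)
  have fitsR: "fits (?R h) (?R g) (map turn w) (?R l) (?R r) \<longleftrightarrow> fits h g w l r" for w l r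
  proof -
    have "?R (cen w i) + s *\<^sub>R ?R x = ?R (cen w i + s *\<^sub>R x)" for i s x by (simp only: R)
    then show ?thesis unfolding fits_def by (simp add: cenR vertex_turn cross_turn del: scaleR_minus_right)
  qed
  have words: "word a" "word A" "word b" "word B" using t by (auto simp: table_def)
  have wordR: "word (map turn w)" if "word w" for w
    using that by (auto simp: word_def turn_less)
  have cntR: "cnt (map turn w) (turn k) = cnt w k" if "word w" "k < 5" for w k
    unfolding cnt_def using that by (intro sum.cong) (auto simp: word_def turn_inj)
  obtain c where f: "fits h g a (c + h) (c + h - (phi - 1) *\<^sub>R g)" "fits h g A (c + h + g) (c + h)"
    "fits h g b (c - (phi - 1) *\<^sub>R h + g) (c + g)" "fits h g B (c + g) (c + h + g)"
    using t by (auto simp: table_def)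
  show ?thesis
    unfolding table_def
  proof (intro conjI)
    show "\<exists>c. fits (?R h) (?R g) (map turn a) (c + ?R h) (c + ?R h - (phi - 1) *\<^sub>R ?R g) \<and>
      fits (?R h) (?R g) (map turn A) (c + ?R h + ?R g) (c + ?R h) \<and>
      fits (?R h) (?R g) (map turn b) (c - (phi - 1) *\<^sub>R ?R h + ?R g) (c + ?R g) \<and>
      fits (?R h) (?R g) (map turn B) (c + ?R g) (c + ?R h + ?R g)"
      using f by (intro exI[of _ "?R c"]) (simp only: fitsR simp_thms flip: R)
    show "\<forall>k<5. edge k = ((phi - 1) * cnt (map turn a) k + cnt (map turn A) k) *\<^sub>R ?R g -
        ((phi - 1) * cnt (map turn b) k + cnt (map turn B) k) *\<^sub>R ?R h"
    proof (intro allI impI)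
      fix k :: nat assume "k < 5"
      then obtain j where j: "j < 5" "k = turn j" using turn_surj by blast
      then have "edge j = ((phi - 1) * cnt a j + cnt A j) *\<^sub>R g - ((phi - 1) * cnt b j + cnt B j) *\<^sub>R h"
        using t by (auto simp: table_def)
      then have "edge k = ?R (((phi - 1) * cnt a j + cnt A j) *\<^sub>R g - ((phi - 1) * cnt b j + cnt B j) *\<^sub>R h)"
        by (simp only: j(2) edge_turn)
      then show "edge k = ((phi - 1) * cnt (map turn a) k + cnt (map turn A) k) *\<^sub>R ?R g -
        ((phi - 1) * cnt (map turn b) k + cnt (map turn B) k) *\<^sub>R ?R h"
        unfolding R j(2) by (simp only: cntR words j(1))
    qed
    show "\<forall>j<5. \<forall>k<5. hop j - hop k \<in> lattice (?R h) (?R g)"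
    proof (intro allI impI)
      fix j k :: nat assume "j < 5" "k < 5"
      then obtain j' k' where j: "j' < 5" "j = turn j'" "k' < 5" "k = turn k'" using turn_surj by metis
      then have "hop j' - hop k' \<in> lattice h g" using t by (auto simp: table_def)
      then obtain x y where xy: "hop j' - hop k' = x *\<^sub>R h + y *\<^sub>R g" "x \<in> golden_ints" "y \<in> golden_ints"
        unfolding lattice_def by blast
      have "hop j - hop k = ?R (hop j' - hop k')" unfolding R j hop_turn ..
      also have "\<dots> = x *\<^sub>R ?R h + y *\<^sub>R ?R g" unfolding xy(1) R ..
      finally show "hop j - hop k \<in> lattice (?R h) (?R g)" using xy latticeI by blast
    qed
  qed (use t in \<open>simp_all add: table_def cross_turn holR wordR algebra_simps\<close>)
qed

section \<open>Orbits read off from a table\<close>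

definition dir :: "complex \<Rightarrow> complex" where
  "dir z = (sgn z)\<^sup>2"

lemma lattice_commute: "lattice h g = lattice g h"
  unfolding lattice_def by (metis (no_types, opaque_lifting) add.commute)

text \<open>Two successive crossings displace by a difference of two hops, so centres an even number
  of steps apart differ by a lattice vector.\<close>

lemma Cen_diff_lattice:
  assumes w: "word w" and hop: "\<And>j k. j < 5 \<Longrightarrow> k < 5 \<Longrightarrow> hop j - hop k \<in> lattice h g"
  shows "Cen w (i + 2 * int m) - Cen w i \<in> lattice h g"
proof (induction m)
  case 0 show ?case by (simp add: lattice_zero)
next
  case (Suc m)
  define k where "k = i + 2 * int m"
  have "Cen w (k + 1 + 1) - Cen w k = sg (even k) *\<^sub>R (hop (letter w k) - hop (letter w (k + 1)))"
    unfolding Cen_Suc[OF w] by (simp add: algebra_simps)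
  also have "\<dots> \<in> lattice h g"
    using hop[of "letter w k" "letter w (k + 1)"] hop[of "letter w (k + 1)" "letter w k"] letter_less[OF w]
    by (simp add: sg_def)
  finally have 1: "Cen w (k + 1 + 1) - Cen w k \<in> lattice h g" .
  have "i + 2 * int (Suc m) = k + 1 + 1" by (simp add: k_def)
  then have "Cen w (i + 2 * int (Suc m)) - Cen w i = (Cen w (k + 1 + 1) - Cen w k) + (Cen w k - Cen w i)"
    by (simp only: add_diff_eq diff_add_cancel)
  then show ?case using lattice_add[OF 1 Suc[folded k_def]] by (simp only:)
qed

text \<open>Comparing the coefficients of \<open>h\<close> shows that the rational number
  \<open>d / n\<close> is a golden integer, hence an integer.\<close>

lemma lattice_rational_multiple:
  assumes c: "cross h g \<noteq> 0" and v: "v \<in> lattice h g"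
    and eq: "real n *\<^sub>R v = real d *\<^sub>R c *\<^sub>R h" and n: "n > 0" and c': "c = 1 \<or> c = phi"
  shows "int n dvd int d"
proof -
  obtain x y where xy: "v = x *\<^sub>R h + y *\<^sub>R g" "x \<in> golden_ints" using v unfolding lattice_def by blast
  have "cross (real n *\<^sub>R v) g = cross (real d *\<^sub>R c *\<^sub>R h) g" by (simp only: eq)
  then have x: "real n * x = real d * c" using c by (simp add: xy cross_linear)
  define z where "z = real d / real n"
  have "z \<in> golden_ints"
    using c'
  proof
    assume "c = 1"
    then have "z = x" using x n by (simp add: z_def field_simps)
    then show ?thesis using xy by simp
  next
    assume c: "c = phi"
    have "x = z * phi" using x n by (simp add: z_def c field_simps)
    \<comment> \<open>Division by \<open>phi\<close> is multiplication by
      \<open>phi - 1\<close>.\<close>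
    then have "z = phi * x - x" by (simp add: algebra_simps)
    then show ?thesis using golden_ints_diff[OF golden_ints_phi_mult] xy(2) by simp
  qed
  then have "z \<in> \<int>" by (rule golden_ints_Rats) (simp add: z_def)
  then obtain k where "z = of_int k" by (auto elim: Ints_cases)
  then have "real d = of_int k * real n" using n by (simp add: z_def field_simps)
  then have "of_int (int d) = (of_int (k * int n) :: real)" by simp
  then have "int d = k * int n" by (simp only: of_int_eq_iff)
  then show ?thesis by simp
qed

text \<open>The data of \<open>cylinders\<close> are supplied from finite inequalities: gates of
  width \<open>(phi - 1) * K\<close> and \<open>K\<close> give the heights after division by the
  length of \<open>h\<close>, the formula for the edges becomes \<open>covers\<close>, irrationality
  of \<open>phi\<close> gives \<open>distinct\<close>, and the lattice gives
  \<open>indivisible\<close>.\<close>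

lemma orbits_of_fitting_words:
  assumes words: "word a" "word A" and hols: "hol a = h" "hol A = phi *\<^sub>R h"
    and hop: "\<And>j k. j < 5 \<Longrightarrow> k < 5 \<Longrightarrow> hop j - hop k \<in> lattice h g" and hg: "cross h g \<noteq> 0"
    and fa: "fits h h a la ra" and fA: "fits h h A lA rA"
    and K: "cross h la - cross h ra = (phi - 1) * K" "cross h lA - cross h rA = K" "K > 0"
    and ed: "\<And>k. k < 5 \<Longrightarrow> cross h (edge k) = ((phi - 1) * cnt a k + cnt A k) * K"
  shows "short_orbit (dir h) = cyclic_word (map side_label a)"
    "long_orbit (dir h) = cyclic_word (map side_label A)"
proof -
  have h0: "h \<noteq> 0" using hg by auto
  define u where "u = sgn h"
  have h: "h = cmod h *\<^sub>R u" using h0 by (simp add: u_def sgn_div_norm)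
  have cu: "cross u z = cross h z / cmod h" for z
    using h0 by (simp add: u_def sgn_div_norm cross_linear divide_inverse)
  define len H where "len = (\<lambda>w. if w = a then cmod h else phi * cmod h)"
    and "H = (\<lambda>w. if w = a then (phi - 1) * K / cmod h else K / cmod h)"
  have ne: "a \<noteq> A"
  proof
    assume "a = A"
    then have "(phi - 1) *\<^sub>R h = 0" using hols by (simp add: algebra_simps)
    then show False using h0 phi_bounds by simp
  qed
  have len: "len a = cmod h" "len A = phi * cmod h" using ne by (auto simp: len_def)
  have less: "len a < len A" using len h0 phi_bounds by simp
  have H: "H a = (phi - 1) * K / cmod h" "H A = K / cmod h" using ne by (auto simp: H_def)
  \<comment> \<open>The whole gate is admissible for every crossing of the word, so its width bounds
    the height of the cylinder from below.\<close>
  have gap: "(cross h l - cross h r) / cmod h \<le> hi u w - lo u w" if w: "word w" and f: "fits h h w l r" for w l r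
  proof -
    have up: "upper u w (int i) = cross h (cen w i + sg (even i) *\<^sub>R vertex (Suc (w ! i))) / cmod h"
      and low: "lower u w (int i) = cross h (cen w i + sg (even i) *\<^sub>R vertex (w ! i)) / cmod h" if "i < length w" for i
      using that by (simp_all add: upper_def lower_def cu Cen_nat letter_nat)
    have ne: "{..<length w} \<noteq> {}" using w by (auto simp: word_def)
    have "cross h l / cmod h \<le> hi u w"
      unfolding hi_def using ne f h0 by (subst Min_ge_iff) (auto simp: up fits_def divide_right_mono)
    moreover have "lo u w \<le> cross h r / cmod h"
      unfolding lo_def using ne f h0 by (subst Max_le_iff) (auto simp: low fits_def divide_right_mono)
    ultimately show ?thesis by (simp add: diff_divide_distrib)
  qed
  have npos: "length a > 0" "length A > 0" using words by (auto simp: word_def)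
  have irr: "real m * cmod h \<noteq> real n * (phi * cmod h)" if "n > 0" for m n
  proof
    assume "real m * cmod h = real n * (phi * cmod h)"
    then have "phi = real m / real n" using h0 that by (simp add: field_simps)
    also have "\<dots> \<in> \<rat>" by simp
    finally show False using phi_irrational by simp
  qed
  interpret cylinders u "{a, A}" len H
  proof unfold_locales
    show "cmod u = 1" using h0 by (simp add: u_def norm_sgn)
    show "word w" if "w \<in> {a, A}" for w using that words by auto
    show "hol w = len w *\<^sub>R u" if "w \<in> {a, A}" for w
      using that hols h len by (auto simp flip: scaleR_scaleR)
    show "len w > 0" if "w \<in> {a, A}" for w using that h0 len phi_pos by auto
    show "H w > 0" if "w \<in> {a, A}" for w using that H K(3) h0 phi_bounds by auto
    show "H w \<le> hi u w - lo u w" if "w \<in> {a, A}" for w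
      using that gap[OF words(1) fa] gap[OF words(2) fA] unfolding K by (auto simp: H)
    show "cross u (edge j) = (\<Sum>w\<in>{a, A}. (\<Sum>i | i < length w \<and> w ! i = j. sg (even i)) * H w)" if "j < 5" for j
    proof -
      have "(\<Sum>w\<in>{a, A}. (\<Sum>i | i < length w \<and> w ! i = j. sg (even i)) * H w) = cnt a j * H a + cnt A j * H A"
        using ne by (simp add: cnt_def)
      also have "\<dots> = ((phi - 1) * cnt a j + cnt A j) * K / cmod h"
        by (simp add: H add_divide_distrib diff_divide_distrib algebra_simps)
      finally show ?thesis by (simp add: cu ed[OF that])
    qed
    show "w = w'" if "w \<in> {a, A}" "w' \<in> {a, A}" "real (length w') * len w = real (length w) * len w'" for w w'
      using that len irr[OF npos(1), of "length A"] irr[OF npos(1), of "length A"] by auto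
    show "int (length w) dvd d" if w: "w \<in> {a, A}" and d: "d > 0" "even d"
      and eq: "real (length w) *\<^sub>R (Cen w (i + d) - Cen w i) = of_int d *\<^sub>R hol w" for w d i
    proof -
      have ww: "word w" using w words by auto
      define m where "m = nat (d div 2)"
      have m: "d = 2 * int m" using d by (simp add: m_def)
      obtain c where c: "hol w = c *\<^sub>R h" "c = 1 \<or> c = phi" using w hols by force
      have "int (length w) dvd int (nat d)"
      proof (rule lattice_rational_multiple[OF hg _ _ _ c(2)])
        show "Cen w (i + d) - Cen w i \<in> lattice h g" unfolding m by (rule Cen_diff_lattice[OF ww hop])
        show "real (length w) *\<^sub>R (Cen w (i + d) - Cen w i) = real (nat d) *\<^sub>R c *\<^sub>R h"
          using eq d(1) by (simp add: c(1))
        show "length w > 0" using ww by (simp add: word_def)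
      qed
      then show ?thesis using d(1) by simp
    qed
  qed simp
  from short_long_orbit[OF refl less]
  show "short_orbit (dir h) = cyclic_word (map side_label a)" "long_orbit (dir h) = cyclic_word (map side_label A)"
    by (simp_all add: dir_def u_def)
qed

lemma fits_one_direction:
  assumes "fits h g w l r"
  shows "fits h h w l r" "fits g g w l r"
  using assms unfolding fits_def by auto

lemma table_orbits:
  assumes t: "table h g a A b B"
  shows "short_orbit (dir h) = cyclic_word (map side_label a)" "long_orbit (dir h) = cyclic_word (map side_label A)"
    "short_orbit (dir g) = cyclic_word (map side_label b)" "long_orbit (dir g) = cyclic_word (map side_label B)"
proof -
  obtain c where f: "fits h g a (c + h) (c + h - (phi - 1) *\<^sub>R g)" "fits h g A (c + h + g) (c + h)"
    "fits h g b (c - (phi - 1) *\<^sub>R h + g) (c + g)" "fits h g B (c + g) (c + h + g)"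
    using t by (auto simp: table_def)
  have K: "cross h g > 0" and gh: "cross g h = - cross h g" using t by (auto simp: table_def cross_def)
  have words: "word a" "word A" "word b" "word B" and hols: "hol a = h" "hol A = phi *\<^sub>R h" "hol b = g" "hol B = phi *\<^sub>R g"
    using t by (auto simp: table_def)
  have hop: "hop j - hop k \<in> lattice h g" "hop j - hop k \<in> lattice g h" if "j < 5" "k < 5" for j k
    using t that lattice_commute[of g h] by (auto simp: table_def)
  have ed: "edge k = ((phi - 1) * cnt a k + cnt A k) *\<^sub>R g - ((phi - 1) * cnt b k + cnt B k) *\<^sub>R h" if "k < 5" for k
    using t that by (auto simp: table_def)
  note fh = fits_one_direction(1)[OF f(1)] fits_one_direction(1)[OF f(2)]
  show "short_orbit (dir h) = cyclic_word (map side_label a)" "long_orbit (dir h) = cyclic_word (map side_label A)"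
    by (rule orbits_of_fitting_words[OF words(1,2) hols(1,2) hop(1) _ fh, where K = "cross h g"];
        use K ed in \<open>simp add: cross_linear\<close>)+
  note fg = fits_one_direction(2)[OF f(3)] fits_one_direction(2)[OF f(4)]
  show "short_orbit (dir g) = cyclic_word (map side_label b)" "long_orbit (dir g) = cyclic_word (map side_label B)"
    by (rule orbits_of_fitting_words[OF words(3,4) hols(3,4) hop(2) _ fg, where K = "cross h g"];
        use K ed in \<open>simp add: cross_linear gh\<close>)+
qed

section \<open>The tiling\<close>

lemma dir_eq: "dir z = z / cnj z"
proof (cases "z = 0")
  case False
  have "dir z = z\<^sup>2 / (of_real (cmod z))\<^sup>2"
    by (simp add: dir_def sgn_eq power_divide)
  also have "(of_real (cmod z))\<^sup>2 = z * cnj z" by (simp only: complex_norm_square flip: of_real_power)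
  finally show ?thesis using False by (simp add: power2_eq_square)
qed (simp add: dir_def)

lemma dir_scaleR: "r \<noteq> 0 \<Longrightarrow> dir (r *\<^sub>R z) = dir z"
  by (simp add: dir_eq scaleR_conv_of_real)

lemma dir_minus [simp]: "dir (- z) = dir z"
  by (simp add: dir_eq)

lemma cross_eq: "of_real (2 * cross u v) * \<i> = cnj u * v - u * cnj v"
  by (simp add: cross_def complex_eq_iff algebra_simps)

lemma dir_eq_iff:
  assumes "v \<noteq> 0" "w \<noteq> 0"
  shows "dir v = dir w \<longleftrightarrow> cross v w = 0"
proof -
  have "dir v = dir w \<longleftrightarrow> cnj v * w - v * cnj w = 0"
    using assms by (auto simp: dir_eq frac_eq_eq mult.commute)
  also have "\<dots> \<longleftrightarrow> cross v w = 0"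
    unfolding cross_eq[symmetric] by simp
  finally show ?thesis .
qed

text \<open>On the unit circle \<open>cnj z = 1 / z\<close>, which turns the inversion into the
  Moebius involution with fixed points \<open>p\<close> and \<open>q\<close>. The formula covers the
  case of a diameter as well.\<close>

lemma hyp_reflection_unit:
  assumes "cmod p = 1" "cmod q = 1" "cmod z = 1" "p + q - 2 * z \<noteq> 0"
  shows "hyp_reflection p q z = (2 * p * q - (p + q) * z) / (p + q - 2 * z)"
proof -
  have c: "cnj x = 1 / x" "x \<noteq> 0" if "cmod x = 1" for x
  proof -
    show "x \<noteq> 0" using that by auto
    have "x * cnj x = 1" using that by (simp add: complex_norm_square[symmetric])
    then show "cnj x = 1 / x" using \<open>x \<noteq> 0\<close> by (simp add: field_simps)
  qed
  note cp = c[OF assms(1)] and cq = c[OF assms(2)] and cz = c[OF assms(3)]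
  show ?thesis
  proof (cases "p + q = 0")
    case True
    then have "q = - p" by (simp add: add_eq_0_iff2)
    then show ?thesis unfolding hyp_reflection_def using cz by (simp add: power2_eq_square)
  next
    case False
    define d where "d = (2 * p * q) / (p + q)"
    have cd: "cnj d = 2 / (p + q)"
      unfolding d_def complex_cnj_divide complex_cnj_mult complex_cnj_add cp(1) cq(1) complex_cnj_numeral
      using False cp(2) cq(2) by (simp add: field_simps)
    have n: "of_real ((cmod d)\<^sup>2 - 1) = d * cnj d - 1"
      by (simp only: of_real_diff of_real_1 complex_norm_square)
    have cz': "cnj (z - d) = (p + q - 2 * z) / (z * (p + q))"
      unfolding complex_cnj_diff cd cz(1) using False cz(2) by (simp add: field_simps)
    have "hyp_reflection p q z = d + (d * cnj d - 1) / cnj (z - d)"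
      unfolding hyp_reflection_def Let_def d_def[symmetric] n[symmetric] using False by simp
    also have "\<dots> = d + (d * (2 / (p + q)) - 1) * (z * (p + q)) / (p + q - 2 * z)"
      unfolding cz' cd by simp
    also have "\<dots> = (2 * p * q - (p + q) * z) / (p + q - 2 * z)"
    proof -
      define s where "s = p + q"
      define t where "t = p + q - 2 * z"
      have s: "s \<noteq> 0" and t: "t \<noteq> 0" using False assms(4) by (auto simp: s_def t_def)
      have ts: "t = s - 2 * z" by (simp add: s_def t_def)
      have "(2 * p * q / s + (2 * p * q / s * (2 / s) - 1) * (z * s) / t) * (s * t) = 2 * p * q * t + (2 * p * q * 2 - s * s) * z"
        using s t by (simp add: field_simps)
      also have "\<dots> = (2 * p * q - s * z) * s" by (simp add: ts algebra_simps)
      finally have "2 * p * q / s + (2 * p * q / s * (2 / s) - 1) * (z * s) / t = (2 * p * q - s * z) / t"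
        using s t by (simp add: nonzero_eq_divide_eq mult_ac)
      then show ?thesis by (simp add: d_def s_def t_def)
    qed
    finally show ?thesis .
  qed
qed

lemma norm_dir: "z \<noteq> 0 \<Longrightarrow> cmod (dir z) = 1"
  by (simp add: dir_def norm_power norm_sgn)

text \<open>Identifying the circle at infinity with the projective line, reflections become linear.\<close>

lemma hyp_reflection_dir:
  assumes hg: "cross h g \<noteq> 0" and xy: "x \<noteq> 0 \<or> y \<noteq> 0"
  shows "hyp_reflection (dir h) (dir g) (dir (x *\<^sub>R h + y *\<^sub>R g)) = dir (x *\<^sub>R h - y *\<^sub>R g)"
proof -
  define v w where "v = x *\<^sub>R h + y *\<^sub>R g" and "w = x *\<^sub>R h - y *\<^sub>R g"
  have 0: "h \<noteq> 0" "g \<noteq> 0" using hg by auto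
  have "cross h v = y * cross h g" "cross v g = x * cross h g" "cross h w = - y * cross h g" "cross w g = x * cross h g"
    by (simp_all add: v_def w_def cross_linear)
  then have vw: "v \<noteq> 0" "w \<noteq> 0" using hg xy by auto
  define \<delta> where "\<delta> = g * cnj h - h * cnj g"
  have \<delta>: "\<delta> \<noteq> 0"
  proof -
    have "\<delta> = of_real (2 * cross h g) * \<i>" unfolding cross_eq \<delta>_def by (simp add: mult.commute)
    then show ?thesis using hg by simp
  qed
  have c: "cnj h \<noteq> 0" "cnj g \<noteq> 0" "cnj v \<noteq> 0" "cnj w \<noteq> 0" using 0 vw by auto
  have den: "dir h + dir g - 2 * dir v = \<delta> * cnj w / (cnj h * cnj g * cnj v)"
  proof -
    have "(dir h + dir g - 2 * dir v) * (cnj h * cnj g * cnj v) = h * cnj g * cnj v + g * cnj h * cnj v - 2 * v * cnj h * cnj g"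
      using c by (simp add: dir_eq field_simps)
    also have "\<dots> = \<delta> * cnj w"
      by (simp add: v_def w_def \<delta>_def scaleR_conv_of_real algebra_simps)
    finally show ?thesis using c by (simp add: field_simps)
  qed
  have num: "2 * dir h * dir g - (dir h + dir g) * dir v = \<delta> * w / (cnj h * cnj g * cnj v)"
  proof -
    have "(2 * dir h * dir g - (dir h + dir g) * dir v) * (cnj h * cnj g * cnj v) = 2 * h * g * cnj v - (h * cnj g + g * cnj h) * v"
      using c by (simp add: dir_eq field_simps)
    also have "\<dots> = \<delta> * w"
      by (simp add: v_def w_def \<delta>_def scaleR_conv_of_real algebra_simps)
    finally show ?thesis using c by (simp add: field_simps)
  qed
  have "dir h + dir g - 2 * dir v \<noteq> 0" unfolding den using \<delta> c by simp
  from hyp_reflection_unit[OF norm_dir[OF 0(1)] norm_dir[OF 0(2)] norm_dir[OF vw(1)] this]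
  have "hyp_reflection (dir h) (dir g) (dir v) = (\<delta> * w / (cnj h * cnj g * cnj v)) / (\<delta> * cnj w / (cnj h * cnj g * cnj v))"
    unfolding num den .
  also have "\<dots> = dir w" using \<delta> c by (simp add: dir_eq)
  finally show ?thesis unfolding v_def w_def .
qed

lemma hyp_reflection_commute: "hyp_reflection p q = hyp_reflection q p"
proof
  fix z
  have "p + q = 0 \<Longrightarrow> p\<^sup>2 = q\<^sup>2" by (simp add: add_eq_0_iff2)
  then show "hyp_reflection p q z = hyp_reflection q p z"
    by (simp add: hyp_reflection_def add.commute mult.commute mult.left_commute)
qed

section \<open>The directions of the vertices, ordered by angle\<close>

text \<open>The three vectors put into each gap have the directions of the new vertices beyond that
  edge. \<open>l\<close> closes the last gap and is not itself listed.\<close>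

fun refine :: "complex list \<Rightarrow> complex \<Rightarrow> complex list" where
  "refine [] l = []"
| "refine [h] l = [h, phi *\<^sub>R h + l, phi *\<^sub>R h + phi *\<^sub>R l, h + phi *\<^sub>R l]"
| "refine (h # g # us) l = h # (phi *\<^sub>R h + g) # (phi *\<^sub>R h + phi *\<^sub>R g) # (h + phi *\<^sub>R g) # refine (g # us) l"

fun arcs :: "complex list \<Rightarrow> complex \<Rightarrow> (complex \<times> complex) set" where
  "arcs [] l = {}"
| "arcs [h] l = {(h, l)}"
| "arcs (h # g # us) l = insert (h, g) (arcs (g # us) l)"

text \<open>The four edges beyond a given one, in the order of the tables in
  \<open>table_step\<close>.\<close>

definition sub_arcs :: "complex \<times> complex \<Rightarrow> (complex \<times> complex) set" where
  "sub_arcs = (\<lambda>(h, g). {(h, phi *\<^sub>R h + g), (phi *\<^sub>R h + g, phi *\<^sub>R h + phi *\<^sub>R g),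
     (phi *\<^sub>R h + phi *\<^sub>R g, h + phi *\<^sub>R g), (h + phi *\<^sub>R g, g)})"

lemma refine_Cons: "\<exists>vs. refine (g # us) l = g # vs"
  by (cases us) auto

lemma arcs_refine: "arcs (refine us l) l = \<Union> (sub_arcs ` arcs us l)"
proof (induction us l rule: refine.induct)
  case (3 h g us l)
  obtain vs where "refine (g # us) l = g # vs" using refine_Cons by blast
  with 3 show ?case by (simp add: sub_arcs_def)
qed (auto simp: sub_arcs_def)

lemma set_refine: "set us \<subseteq> set (refine us l)"
  by (induction us l rule: refine.induct) auto

lemma arcs_subset: "(h, g) \<in> arcs us l \<Longrightarrow> h \<in> set us \<and> g \<in> insert l (set us)"
  by (induction us l rule: arcs.induct) auto

lemma mids_refine: "(h, g) \<in> arcs us l \<Longrightarrow>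
    {phi *\<^sub>R h + g, phi *\<^sub>R h + phi *\<^sub>R g, h + phi *\<^sub>R g} \<subseteq> set (refine us l)"
  by (induction us l rule: refine.induct) auto

text \<open>
  The arguments increase along \<open>us\<close> and then \<open>l\<close>; the first vector may be opposite to \<open>l\<close>.
\<close>

definition fan :: "complex list \<Rightarrow> complex \<Rightarrow> bool" where
  "fan us l \<longleftrightarrow> us \<noteq> [] \<and> sorted_wrt (\<lambda>v w. cross v w > 0) us \<and> (\<forall>v\<in>set us. cross v l \<ge> 0) \<and> cross (last us) l > 0"

lemma cross_refine_pos:
  assumes "\<forall>v\<in>set us. cross x v > 0" "cross x l \<ge> 0"
  shows "\<forall>w\<in>set (refine us l). cross x w > 0"
  using assms by (induction us l rule: refine.induct)
    (auto simp: cross_linear phi_pos intro!: add_pos_pos add_pos_nonneg mult_nonneg_nonneg less_imp_le[OF phi_pos])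

lemma fan_refine:
  assumes "fan us l"
  shows "fan (refine us l) l"
  using assms
proof (induction us l rule: refine.induct)
  case (2 h l)
  then have c: "cross h l > 0" by (simp add: fan_def)
  have c': "cross l h = - cross h l" by (simp add: cross_def)
  show ?case using c phi_bounds by (simp add: fan_def cross_linear c' mult_strict_right_mono algebra_simps)
next
  case (3 h g us l)
  have f: "cross h g > 0" "\<forall>v\<in>set (g # us). cross h v > 0" "\<forall>v\<in>set us. cross g v > 0" "cross h l \<ge> 0" "cross g l \<ge> 0"
    using 3(2) by (auto simp: fan_def)
  have "fan (g # us) l" using 3(2) by (auto simp: fan_def split: if_splits)
  then have IH: "fan (refine (g # us) l) l" by (rule 3(1))
  have c': "cross g h = - cross h g" by (simp add: cross_def)
  have later: "\<forall>w\<in>set (refine (g # us) l). cross (x *\<^sub>R h + y *\<^sub>R g) w > 0" if "x > 0" "y \<ge> 0" for x y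
    using f that by (intro cross_refine_pos) (auto simp: cross_linear intro!: add_pos_nonneg)
  have mid: "\<forall>w\<in>set (refine (g # us) l). cross h w > 0" "\<forall>w\<in>set (refine (g # us) l). cross (phi *\<^sub>R h + g) w > 0"
    "\<forall>w\<in>set (refine (g # us) l). cross (phi *\<^sub>R h + phi *\<^sub>R g) w > 0" "\<forall>w\<in>set (refine (g # us) l). cross (h + phi *\<^sub>R g) w > 0"
    using later[of 1 0] later[of phi 1] later[of phi phi] later[of 1 phi] phi_pos by auto
  have ne: "refine (g # us) l \<noteq> []" using refine_Cons[of g us l] by auto
  have l: "cross (phi *\<^sub>R h + g) l \<ge> 0" "cross (phi *\<^sub>R h + phi *\<^sub>R g) l \<ge> 0" "cross (h + phi *\<^sub>R g) l \<ge> 0"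
    using f phi_pos by (auto simp: cross_linear)
  have m: "cross h (phi *\<^sub>R h + g) > 0" "cross h (phi *\<^sub>R h + phi *\<^sub>R g) > 0" "cross h (h + phi *\<^sub>R g) > 0"
    "cross (phi *\<^sub>R h + g) (phi *\<^sub>R h + phi *\<^sub>R g) > 0" "cross (phi *\<^sub>R h + g) (h + phi *\<^sub>R g) > 0"
    "cross (phi *\<^sub>R h + phi *\<^sub>R g) (h + phi *\<^sub>R g) > 0"
    using f phi_bounds by (simp_all add: cross_linear c' algebra_simps)
  show ?case
    using IH mid l m f ne by (auto simp: fan_def)
qed (simp add: fan_def)

lemma fan_arc: "fan us l \<Longrightarrow> (h, g) \<in> arcs us l \<Longrightarrow> cross h g > 0"
proof (induction us l rule: arcs.induct)
  case (3 h' g' us l)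
  then have "fan (g' # us) l" by (auto simp: fan_def split: if_splits)
  with 3 show ?case by (auto simp: fan_def)
qed (auto simp: fan_def)

text \<open>A listed vector comes either not after \<open>h\<close> or not before \<open>g\<close>.
  So both ends of the arc lie weakly on one side of the line through it and not both on this line,
  and a positive combination stays off the line.\<close>

lemma fan_not_in_arc:
  assumes "fan us l" "(h, g) \<in> arcs us l" "v \<in> set us" "x > 0" "y > 0"
  shows "cross v (x *\<^sub>R h + y *\<^sub>R g) \<noteq> 0"
  using assms
proof (induction us l rule: arcs.induct)
  case (2 h' l)
  then show ?case by (auto simp: fan_def cross_linear)
next
  case (3 h' g' us l)
  have fan: "fan (g' # us) l" using 3(2) by (auto simp: fan_def split: if_splits)
  have f: "\<forall>v\<in>set (g' # us). cross h' v > 0" "\<forall>v\<in>set us. cross g' v > 0" "cross h' l \<ge> 0"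
    using 3(2) by (auto simp: fan_def)
  show ?case
  proof (cases "(h, g) = (h', g')")
    case True
    show ?thesis
    proof (cases "v = h'")
      case True
      then show ?thesis using \<open>(h, g) = _\<close> f 3(5,6) by (simp add: cross_linear)
    next
      case False
      then have "cross h' v > 0" "cross g' v \<ge> 0" using f 3(4) by auto
      moreover have "cross v h' = - cross h' v" "cross v g' = - cross g' v" by (simp_all add: cross_def)
      ultimately have "cross v (x *\<^sub>R h' + y *\<^sub>R g') = - (x * cross h' v + y * cross g' v)"
        "x * cross h' v + y * cross g' v > 0"
        using 3(5,6) by (simp_all add: cross_linear add_pos_nonneg)
      then show ?thesis using \<open>(h, g) = _\<close> by auto
    qed
  next
    case False
    then have arc: "(h, g) \<in> arcs (g' # us) l" using 3(3) by auto
    show ?thesis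
    proof (cases "v \<in> set (g' # us)")
      case True
      then show ?thesis using 3(1)[OF fan arc] 3(5,6) by blast
    next
      case False
      then have v: "v = h'" using 3(4) by auto
      have "cross h' h > 0" "cross h' g \<ge> 0" using arcs_subset[OF arc] f by (auto intro: less_imp_le)
      then have "cross v (x *\<^sub>R h + y *\<^sub>R g) > 0"
        using 3(5,6) unfolding v by (auto simp: cross_linear intro!: add_pos_nonneg)
      then show ?thesis by simp
    qed
  qed
qed simp

section \<open>Ideal pentagons as lists up to rotation and reversal\<close>

lemma consecutive_vertices_five:
  "consecutive_vertices [a, b, c, d, e] vs \<longleftrightarrow>
    vs \<in> {[a, b, c, d, e], [b, c, d, e, a], [c, d, e, a, b], [d, e, a, b, c], [e, a, b, c, d],
      [e, d, c, b, a], [d, c, b, a, e], [c, b, a, e, d], [b, a, e, d, c], [a, e, d, c, b]}"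
proof -
  have c: "cyclic_word w = {rotate 0 w, rotate 1 w, rotate 2 w, rotate 3 w, rotate 4 w}" if "length w = 5" for w :: "'a list"
  proof -
    have "rotate n w \<in> {rotate 0 w, rotate 1 w, rotate 2 w, rotate 3 w, rotate 4 w}" for n
    proof -
      have "n mod 5 = 0 \<or> n mod 5 = 1 \<or> n mod 5 = 2 \<or> n mod 5 = 3 \<or> n mod 5 = 4" by linarith
      then show ?thesis by (subst rotate_conv_mod) (auto simp: that)
    qed
    then show ?thesis unfolding cyclic_word_def by blast
  qed
  show ?thesis
    unfolding consecutive_vertices_def by (auto simp: c rotate_drop_take)
qed

lemma length_five: "length Q = 5 \<Longrightarrow> \<exists>a b c d e. Q = [a, b, c, d, e]"
  by (auto simp: numeral_eq_Suc length_Suc_conv)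

lemma consecutive_vertices_trans:
  assumes "consecutive_vertices P Q"
  shows "consecutive_vertices Q R \<longleftrightarrow> consecutive_vertices P R"
proof -
  have c: "cyclic_word v = cyclic_word w" if "v \<in> cyclic_word w" for v w :: "complex list"
    using that unfolding cyclic_word_eq_iff by (auto simp: cyclic_word_def)
  from assms consider "cyclic_word Q = cyclic_word P" | "cyclic_word Q = cyclic_word (rev P)"
    unfolding consecutive_vertices_def using c by blast
  then show ?thesis
  proof cases
    case 1
    from cyclic_word_rev[OF this] 1 show ?thesis by (simp add: consecutive_vertices_def)
  next
    case 2
    from cyclic_word_rev[OF this] 2 show ?thesis by (simp add: consecutive_vertices_def disj_commute)
  qed
qed

lemma sides_five: "sides [a, b, c, d, e] = {{a, b}, {b, c}, {c, d}, {d, e}, {e, a}}"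
proof -
  let ?Q = "[a, b, c, d, e]"
  have "sides ?Q = (\<lambda>i. {?Q ! i, ?Q ! (Suc i mod length ?Q)}) ` {..<length ?Q}"
    unfolding sides_def by blast
  moreover have "{..<length ?Q} = {0, 1, 2, 3, 4}" by auto
  ultimately have "sides ?Q = (\<lambda>i. {?Q ! i, ?Q ! (Suc i mod 5)}) ` {0, 1, 2, 3, 4}" by simp
  then show ?thesis by (simp add: mod_Suc)
qed

lemma consecutive_vertices_sides:
  assumes "length P = 5" "consecutive_vertices P Q"
  shows "sides Q = sides P" "set Q = set P" "length Q = 5"
proof -
  obtain a b c d e where P: "P = [a, b, c, d, e]" using length_five[OF assms(1)] by blast
  have "sides Q = sides P \<and> set Q = set P \<and> length Q = 5"
    using assms(2) unfolding P consecutive_vertices_five insert_iff empty_iff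
    by (elim disjE FalseE) (simp_all add: sides_five insert_commute)
  then show "sides Q = sides P" "set Q = set P" "length Q = 5" by blast+
qed

lemma consecutive_vertices_map: "consecutive_vertices P Q \<Longrightarrow> consecutive_vertices (map f P) (map f Q)"
  unfolding consecutive_vertices_def cyclic_word_def by (auto simp: rotate_map rev_map)

section \<open>Pentagons spanned by a pair of vectors\<close>

text \<open>The factor \<open>phi\<close> at the middle vertex does not change the direction; it
  makes the vector the holonomy of the short cylinder there, as in the tables.\<close>

definition pent :: "complex \<Rightarrow> complex \<Rightarrow> complex list" where
  "pent h g = map dir [h, phi *\<^sub>R h + g, phi *\<^sub>R h + phi *\<^sub>R g, h + phi *\<^sub>R g, g]"

text \<open>The pentagon of the tiling on the other side of the geodesic from \<open>dir h\<close> to \<open>dir g\<close>.\<close>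

definition mirror_pent :: "complex \<Rightarrow> complex \<Rightarrow> complex list" where
  "mirror_pent h g = map dir [h, phi *\<^sub>R h - g, h - g, h - phi *\<^sub>R g, g]"

lemma reflect_mirror_pent:
  assumes "cross h g \<noteq> 0"
  shows "map (hyp_reflection (dir h) (dir g)) (mirror_pent h g) = pent h g"
proof -
  have "dir (h + g) = dir (phi *\<^sub>R (h + g))" using phi_pos by (simp add: dir_scaleR)
  then show ?thesis
    using hyp_reflection_dir[OF assms, of 1 0] hyp_reflection_dir[OF assms, of phi "-1"]
      hyp_reflection_dir[OF assms, of 1 "-1"] hyp_reflection_dir[OF assms, of 1 "- phi"]
      hyp_reflection_dir[OF assms, of 0 1]
    by (simp add: pent_def mirror_pent_def scaleR_add_right)
qed

lemma dirI: "v = r *\<^sub>R w \<Longrightarrow> r \<noteq> 0 \<Longrightarrow> dir v = dir w"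
  by (simp add: dir_scaleR)

text \<open>By \<open>phi * phi = phi + 1\<close> the pentagon just reached has the shape
  \<open>mirror_pent\<close> in the basis given by any of its four new sides. So each further
  reflection is computed by the same formula.\<close>

lemma mirror_pent_sub_arc:
  assumes "(h', g') \<in> sub_arcs (h, g)"
  shows "consecutive_vertices (pent h g) (mirror_pent h' g')"
proof -
  have p: "phi - 1 \<noteq> 0" "1 - phi \<noteq> 0" using phi_bounds by auto
  have 0: "dir (phi *\<^sub>R h - (phi *\<^sub>R h + g)) = dir g"
    "dir (h - (phi *\<^sub>R h + g)) = dir (h + phi *\<^sub>R g)"
    "dir (h - phi *\<^sub>R (phi *\<^sub>R h + g)) = dir (phi *\<^sub>R h + phi *\<^sub>R g)"
    by (rule dirI[where r = "-1"] dirI[where r = "1 - phi"]; use p in \<open>simp add: algebra_simps\<close>)+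
  have 1: "dir (phi *\<^sub>R (phi *\<^sub>R h + g) - (phi *\<^sub>R h + phi *\<^sub>R g)) = dir h"
    "dir (phi *\<^sub>R h + g - (phi *\<^sub>R h + phi *\<^sub>R g)) = dir g"
    "dir (phi *\<^sub>R h + g - phi *\<^sub>R (phi *\<^sub>R h + phi *\<^sub>R g)) = dir (h + phi *\<^sub>R g)"
    by (rule dirI[where r = "1"] dirI[where r = "1 - phi"] dirI[where r = "-1"]; use p in \<open>simp add: algebra_simps\<close>)+
  have 2: "dir (phi *\<^sub>R (phi *\<^sub>R h + phi *\<^sub>R g) - (h + phi *\<^sub>R g)) = dir (phi *\<^sub>R h + g)"
    "dir (phi *\<^sub>R h + phi *\<^sub>R g - (h + phi *\<^sub>R g)) = dir h"
    "dir (phi *\<^sub>R h + phi *\<^sub>R g - phi *\<^sub>R (h + phi *\<^sub>R g)) = dir g"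
    by (rule dirI[where r = "1"] dirI[where r = "phi - 1"] dirI[where r = "-1"]; use p in \<open>simp add: algebra_simps\<close>)+
  have 3: "dir (phi *\<^sub>R (h + phi *\<^sub>R g) - g) = dir (phi *\<^sub>R h + phi *\<^sub>R g)"
    "dir (h + phi *\<^sub>R g - g) = dir (phi *\<^sub>R h + g)"
    "dir (h + phi *\<^sub>R g - phi *\<^sub>R g) = dir h"
    by (rule dirI[where r = "1"] dirI[where r = "phi - 1"]; use p in \<open>simp add: algebra_simps\<close>)+
  show ?thesis
    using assms unfolding sub_arcs_def prod.case insert_iff empty_iff prod.inject
    by (elim disjE conjE FalseE)
      (simp_all only: pent_def mirror_pent_def list.map consecutive_vertices_five 0 1 2 3 insert_iff simp_thms)
qed

section \<open>The initial pentagon\<close>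

text \<open>The directions of the sides, turned in steps of pi / 5 and scaled as in
  \<open>table_base\<close>. Number 5 is opposite to number 0 and so has the same direction.\<close>

definition x\<^sub>0 :: "nat \<Rightarrow> complex" where
  "x\<^sub>0 n = - phi *\<^sub>R (omega ^ n * edge 0)"

text \<open>Vectors for the vertices of generations up to \<open>k\<close>, ordered by angle within
  a half turn. \<open>x\<^sub>0 5\<close> is left out since its direction is that of
  \<open>x\<^sub>0 0\<close>.\<close>

definition fan_list :: "nat \<Rightarrow> complex list" where
  "fan_list k = ((\<lambda>us. refine us (x\<^sub>0 5)) ^^ k) (map x\<^sub>0 [0..<5])"

lemma fan_list_0: "fan_list 0 = [x\<^sub>0 0, x\<^sub>0 1, x\<^sub>0 2, x\<^sub>0 3, x\<^sub>0 4]"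
  by (simp add: fan_list_def upt_rec numeral_eq_Suc)

lemma fan_list_Suc: "fan_list (Suc k) = refine (fan_list k) (x\<^sub>0 5)"
  by (simp add: fan_list_def)

lemma edge0: "edge 0 \<noteq> 0"
  using vertex_inj[of 0 1] by (auto simp: edge_def)

lemma dir_x0: "dir (x\<^sub>0 n) = cis (2 * real n * pi / 5)"
proof -
  have "dir (edge 0) = side_direction (side_label 0)"
    using side_direction_side_label[of 0] by (simp add: dir_def edge_def)
  then have "dir (edge 0) = 1" by (simp add: side_direction_def side_label_def)
  moreover have "dir (x\<^sub>0 n) = dir (omega ^ n * edge 0)"
    unfolding x\<^sub>0_def using phi_pos by (intro dirI[OF refl]) auto
  moreover have "\<dots> = (sgn (omega ^ n))\<^sup>2 * dir (edge 0)"
    by (simp add: dir_def sgn_mult power_mult_distrib)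
  moreover have "sgn (omega ^ n) = cis (real n * (pi / 5))" by (simp add: omega_def Complex.DeMoivre sgn_cis)
  ultimately have "dir (x\<^sub>0 n) = (cis (real n * (pi / 5)))\<^sup>2" by simp
  also have "\<dots> = cis (2 * real n * pi / 5)" by (simp add: Complex.DeMoivre mult.assoc)
  finally show ?thesis .
qed

lemma dir_x0_period: "dir (x\<^sub>0 (n + 5)) = dir (x\<^sub>0 n)"
proof -
  have "cis (2 * real (n + 5) * pi / 5) = cis (2 * real n * pi / 5 + 2 * pi)"
    by (rule arg_cong[of _ _ cis]) (simp add: field_simps)
  then show ?thesis unfolding dir_x0 by (simp flip: cis_mult)
qed

lemma side_direction_x0: "map side_direction [1, 2, 3, 4, 5] = map (\<lambda>n. dir (x\<^sub>0 n)) [3, 4, 0, 1, 2]"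
proof -
  have "side_direction k = dir (x\<^sub>0 n)" if "real k + 2 = real n" for k n
  proof -
    have "2 * real n * pi / 5 = 2 * ((real k - 3) * pi / 5) + 2 * pi" using that[symmetric] by (simp add: field_simps)
    then show ?thesis unfolding dir_x0 side_direction_def by (simp only: cis_2pi mult_1_right flip: cis_mult)
  qed
  from this[of 1 3] this[of 2 4] this[of 3 5] this[of 4 6] this[of 5 7]
  show ?thesis using dir_x0_period[of 0] dir_x0_period[of 1] dir_x0_period[of 2] by simp
qed

lemma fan_fan_list: "fan (fan_list k) (x\<^sub>0 5)"
proof (induction k)
  case 0
  have c: "cross (x\<^sub>0 i) (x\<^sub>0 j) = phi * phi * (cmod (edge 0))\<^sup>2 * sin ((real j - real i) * pi / 5)" for i j
  proof -
    have "cross (cis s * z) (cis t * z) = (cmod z)\<^sup>2 * cross (cis s) (cis t)" for s t z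
      unfolding cmod_power2 by (simp add: cross_def power2_eq_square algebra_simps)
    then have "cross (omega ^ i * edge 0) (omega ^ j * edge 0) = (cmod (edge 0))\<^sup>2 * sin (real j * (pi / 5) - real i * (pi / 5))"
      by (simp only: omega_def Complex.DeMoivre cross_cis)
    moreover have "real j * (pi / 5) - real i * (pi / 5) = (real j - real i) * pi / 5" by (simp add: field_simps)
    ultimately have "cross (omega ^ i * edge 0) (omega ^ j * edge 0) = (cmod (edge 0))\<^sup>2 * sin ((real j - real i) * pi / 5)"
      by (simp only:)
    then show ?thesis unfolding x\<^sub>0_def cross_scaleR_left cross_scaleR_right
      by (simp only: mult_minus_left mult_minus_right minus_minus mult.assoc)
  qed
  have pos: "cross (x\<^sub>0 i) (x\<^sub>0 j) > 0" if "i < j" "j < i + 5" for i j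
  proof -
    have "0 < (real j - real i) * pi / 5" "(real j - real i) * pi / 5 < pi" using that by auto
    then have "sin ((real j - real i) * pi / 5) > 0" by (rule sin_gt_zero)
    then show ?thesis unfolding c using phi_pos edge0 by simp
  qed
  have "cross (x\<^sub>0 0) (x\<^sub>0 5) = 0" unfolding c by simp
  then show ?case unfolding fan_def fan_list_0 by (simp add: pos less_imp_le)
qed (simp add: fan_list_Suc fan_refine)

definition arc_set :: "nat \<Rightarrow> (complex \<times> complex) set" where
  "arc_set k = arcs (fan_list k) (x\<^sub>0 5)"

lemma arc_set_Suc: "arc_set (Suc k) = \<Union> (sub_arcs ` arc_set k)"
  by (simp add: arc_set_def fan_list_Suc arcs_refine)

lemma arc_set_0: "arc_set 0 = {(x\<^sub>0 0, x\<^sub>0 1), (x\<^sub>0 1, x\<^sub>0 2), (x\<^sub>0 2, x\<^sub>0 3), (x\<^sub>0 3, x\<^sub>0 4), (x\<^sub>0 4, x\<^sub>0 5)}"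
  by (simp add: arc_set_def fan_list_0)

lemma arc_set_cross: "(h, g) \<in> arc_set k \<Longrightarrow> cross h g > 0"
  using fan_arc[OF fan_fan_list] by (simp add: arc_set_def)

text \<open>A word of a table starts in \<open>P\<close>, which fixes the sign of \<open>h\<close> and \<open>g\<close>.\<close>

definition has_table :: "complex \<Rightarrow> complex \<Rightarrow> bool" where
  "has_table h g \<longleftrightarrow> (\<exists>a A b B. table h g a A b B \<or> table (- h) (- g) a A b B)"

lemma has_table_sub_arc:
  assumes "has_table h g" "(h', g') \<in> sub_arcs (h, g)"
  shows "has_table h' g'"
proof -
  have *: "\<exists>a A b B. table (s *\<^sub>R h') (s *\<^sub>R g') a A b B" if t: "table (s *\<^sub>R h) (s *\<^sub>R g) a A b B" for s a A b B
  proof -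
    have "phi *\<^sub>R s *\<^sub>R h + s *\<^sub>R g = s *\<^sub>R (phi *\<^sub>R h + g)" "s *\<^sub>R h + phi *\<^sub>R s *\<^sub>R g = s *\<^sub>R (h + phi *\<^sub>R g)"
      "phi *\<^sub>R s *\<^sub>R h + phi *\<^sub>R s *\<^sub>R g = s *\<^sub>R (phi *\<^sub>R h + phi *\<^sub>R g)"
      by (simp_all add: scaleR_add_right mult.commute)
    then show ?thesis using table_step[OF t] assms(2) unfolding sub_arcs_def by auto
  qed
  show ?thesis using assms(1) *[of 1] *[of "-1"] unfolding has_table_def by fastforce
qed

lemma has_table_x0: "has_table (x\<^sub>0 n) (x\<^sub>0 (Suc n))"
proof (induction n)
  case 0
  show ?case unfolding has_table_def x\<^sub>0_def using table_base by auto
next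
  case (Suc n)
  have o: "omega * x\<^sub>0 n = x\<^sub>0 (Suc n)" for n by (simp add: x\<^sub>0_def mult.assoc)
  from Suc show ?case
    using table_turn[of "x\<^sub>0 n" "x\<^sub>0 (Suc n)"] table_turn[of "- x\<^sub>0 n" "- x\<^sub>0 (Suc n)"]
    unfolding has_table_def mult_minus_right o minus_minus by blast
qed

lemma arc_set_table: "(h, g) \<in> arc_set k \<Longrightarrow> has_table h g"
proof (induction k arbitrary: h g)
  case 0
  then show ?case
    using has_table_x0[of 0] has_table_x0[of 1] has_table_x0[of 2] has_table_x0[of 3] has_table_x0[of 4]
    by (auto simp: arc_set_0 eval_nat_numeral)
next
  case (Suc k)
  from Suc(2) obtain h' g' where "(h', g') \<in> arc_set k" "(h, g) \<in> sub_arcs (h', g')"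
    unfolding arc_set_Suc by auto
  then show ?case using has_table_sub_arc[OF Suc(1)] by simp
qed

text \<open>The quadratic relation of \<open>omega\<close> expresses the other three vertices
  through two neighbours, so the initial pentagon has the standard shape seen from each of its
  sides. This starts the induction over generations.\<close>

lemma mirror_pent_x0:
  "mirror_pent (x\<^sub>0 n) (x\<^sub>0 (Suc n)) = map (\<lambda>n. dir (x\<^sub>0 n)) [n, n + 4, n + 3, n + 2, Suc n]"
proof -
  have o2: "omega * (omega * z) = phi *\<^sub>R (omega * z) - z" for z
    by (metis omega_sq mult.assoc left_diff_distrib mult_1 mult_scaleR_left)
  have xS: "x\<^sub>0 (Suc n) = omega * x\<^sub>0 n" for n by (simp add: x\<^sub>0_def mult.assoc)
  have x2: "x\<^sub>0 (n + 2) = phi *\<^sub>R x\<^sub>0 (Suc n) - x\<^sub>0 n"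
    by (simp add: xS o2)
  have x3: "x\<^sub>0 (n + 3) = phi *\<^sub>R x\<^sub>0 (Suc n) - phi *\<^sub>R x\<^sub>0 n"
    by (simp add: xS o2 eval_nat_numeral algebra_simps)
  have x4: "x\<^sub>0 (n + 4) = x\<^sub>0 (Suc n) - phi *\<^sub>R x\<^sub>0 n"
    by (simp add: xS o2 eval_nat_numeral algebra_simps)
  have "dir (phi *\<^sub>R x\<^sub>0 n - x\<^sub>0 (Suc n)) = dir (x\<^sub>0 (n + 4))"
    unfolding x4 by (rule dirI[where r = "-1"]) simp_all
  moreover have "dir (x\<^sub>0 n - x\<^sub>0 (Suc n)) = dir (x\<^sub>0 (n + 3))"
    unfolding x3 using phi_bounds by (intro dirI[where r = "1 - phi"]) (simp_all add: algebra_simps)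
  moreover have "dir (x\<^sub>0 n - phi *\<^sub>R x\<^sub>0 (Suc n)) = dir (x\<^sub>0 (n + 2))"
    unfolding x2 by (rule dirI[where r = "-1"]) simp_all
  ultimately show ?thesis by (simp add: mirror_pent_def)
qed

lemma pentagons_Suc:
  "pentagons (Suc k) = reflected (pentagons k) (if k = 0 then {} else \<Union> (sides ` pentagons (k - 1)))"
  by (cases k) auto

section \<open>Induction over the generations\<close>

text \<open>The invariant of the tiling: every side in which the next generation is reflected comes
  from an arc, and the pentagon lies behind that arc in the standard shape.\<close>

definition outer_arcs :: "nat \<Rightarrow> bool" where
  "outer_arcs k \<longleftrightarrow> (\<forall>Q\<in>pentagons k. length Q = 5 \<and>
    (\<forall>p q. {p, q} \<in> sides Q \<longrightarrow> (k > 0 \<longrightarrow> {p, q} \<notin> \<Union> (sides ` pentagons (k - 1))) \<longrightarrow>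
      (\<exists>h g. (h, g) \<in> arc_set k \<and> {p, q} = {dir h, dir g} \<and> consecutive_vertices Q (mirror_pent h g))))"

lemma outer_arcs_0: "outer_arcs 0"
proof -
  define d where "d n = dir (x\<^sub>0 n)" for n
  have per: "d 5 = d 0" "d 6 = d 1" "d 7 = d 2" "d 8 = d 3"
    using dir_x0_period[of 0] dir_x0_period[of 1] dir_x0_period[of 2] dir_x0_period[of 3] by (simp_all add: d_def)
  have per': "d (Suc (Suc 0)) = d 2" "d (Suc (Suc (Suc 0))) = d 3" by (simp_all add: numeral_eq_Suc)
  have Q: "map side_direction [1, 2, 3, 4, 5] = [d 3, d 4, d 0, d 1, d 2]"
    using side_direction_x0 by (simp add: d_def)
  have m: "mirror_pent (x\<^sub>0 n) (x\<^sub>0 (Suc n)) = [d n, d (n + 4), d (n + 3), d (n + 2), d (Suc n)]" for n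
    unfolding mirror_pent_x0 by (simp add: d_def)
  have arc: "\<exists>h g. (h, g) \<in> arc_set 0 \<and> {p, q} = {dir h, dir g} \<and> consecutive_vertices [d 3, d 4, d 0, d 1, d 2] (mirror_pent h g)"
    if "{p, q} = {d n, d (Suc n)}" "(x\<^sub>0 n, x\<^sub>0 (Suc n)) \<in> arc_set 0"
      "consecutive_vertices [d 3, d 4, d 0, d 1, d 2] [d n, d (n + 4), d (n + 3), d (n + 2), d (Suc n)]" for p q n
    using that unfolding d_def[symmetric] m[symmetric] by (intro exI[of _ "x\<^sub>0 n"] exI[of _ "x\<^sub>0 (Suc n)"]) (simp add: d_def)
  have all: "(x\<^sub>0 n, x\<^sub>0 (Suc n)) \<in> arc_set 0" if "n < 5" for n
  proof -
    have "n = 0 \<or> n = 1 \<or> n = 2 \<or> n = 3 \<or> n = 4" using that by linarith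
    then show ?thesis unfolding arc_set_0 by (elim disjE) (simp_all add: numeral_eq_Suc)
  qed
  show ?thesis
    unfolding outer_arcs_def
  proof (intro ballI conjI allI impI)
    fix Q assume "Q \<in> pentagons 0"
    then have Q: "Q = [d 3, d 4, d 0, d 1, d 2]" using Q by simp
    then show "length Q = 5" by simp
    fix p q assume "{p, q} \<in> sides Q"
    moreover have "Suc 0 = 1" "Suc 1 = 2" "Suc 2 = 3" "Suc 3 = 4" "Suc 4 = 5" by simp_all
    ultimately consider "{p, q} = {d 3, d (Suc 3)}" | "{p, q} = {d 4, d (Suc 4)}" | "{p, q} = {d 0, d (Suc 0)}"
      | "{p, q} = {d 1, d (Suc 1)}" | "{p, q} = {d 2, d (Suc 2)}"
      unfolding Q sides_five insert_iff empty_iff by (simp only: per) argo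
    then show "\<exists>h g. (h, g) \<in> arc_set 0 \<and> {p, q} = {dir h, dir g} \<and> consecutive_vertices Q (mirror_pent h g)"
    proof cases
      case 1 show ?thesis unfolding Q by (rule arc[OF 1 all]) (simp_all add: consecutive_vertices_five per per')
    next
      case 2 show ?thesis unfolding Q by (rule arc[OF 2 all]) (simp_all add: consecutive_vertices_five per per')
    next
      case 3 show ?thesis unfolding Q by (rule arc[OF 3 all]) (simp_all add: consecutive_vertices_five per per')
    next
      case 4 show ?thesis unfolding Q by (rule arc[OF 4 all]) (simp_all add: consecutive_vertices_five per per')
    next
      case 5 show ?thesis unfolding Q by (rule arc[OF 5 all]) (simp_all add: consecutive_vertices_five per per')
    qed
  qed
qed

lemma reflectedE:
  assumes "Q' \<in> reflected \<Q> E"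
  obtains Q p q where "Q' = map (hyp_reflection p q) Q" "Q \<in> \<Q>" "{p, q} \<in> sides Q" "{p, q} \<notin> E"
  using assms unfolding reflected_def mem_Collect_eq by (elim exE conjE) (rule that)

text \<open>Reflection turns the standard shape behind the arc into \<open>pent\<close>. That the
  reflecting side belongs to generation \<open>k\<close> is recorded because the next step of the
  tiling excludes such sides.\<close>

lemma pentagon_Suc_form:
  assumes "outer_arcs k" "Q' \<in> pentagons (Suc k)"
  shows "length Q' = 5" "\<exists>h g. (h, g) \<in> arc_set k \<and> consecutive_vertices Q' (pent h g) \<and> {dir h, dir g} \<in> \<Union> (sides ` pentagons k)"
proof -
  obtain Q p q where Q: "Q' = map (hyp_reflection p q) Q" "Q \<in> pentagons k" "{p, q} \<in> sides Q"
    and E: "{p, q} \<notin> (if k = 0 then {} else \<Union> (sides ` pentagons (k - 1)))"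
    using reflectedE[OF assms(2)[unfolded pentagons_Suc]] .
  have E: "k > 0 \<longrightarrow> {p, q} \<notin> \<Union> (sides ` pentagons (k - 1))"
  proof
    assume "k > 0"
    then show "{p, q} \<notin> \<Union> (sides ` pentagons (k - 1))" using E by (simp only: if_False neq0_conv[symmetric] simp_thms)
  qed
  have outer: "length Q = 5" "\<exists>h g. (h, g) \<in> arc_set k \<and> {p, q} = {dir h, dir g} \<and> consecutive_vertices Q (mirror_pent h g)"
  proof -
    note * = assms(1)[unfolded outer_arcs_def, THEN bspec, OF Q(2)]
    show "length Q = 5" by (rule conjunct1[OF *])
    show "\<exists>h g. (h, g) \<in> arc_set k \<and> {p, q} = {dir h, dir g} \<and> consecutive_vertices Q (mirror_pent h g)"
      by (rule conjunct2[OF *, THEN spec, THEN spec, THEN mp, THEN mp, OF Q(3) E])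
  qed
  from outer(2) obtain h g where hg: "(h, g) \<in> arc_set k" "{p, q} = {dir h, dir g}" "consecutive_vertices Q (mirror_pent h g)"
    by (elim exE conjE) (rule that)
  have "p = dir h \<and> q = dir g \<or> p = dir g \<and> q = dir h" using hg(2) by (simp add: doubleton_eq_iff)
  then have "hyp_reflection p q = hyp_reflection (dir h) (dir g)"
    by (elim disjE conjE; simp only: hyp_reflection_commute[of "dir g" "dir h"])
  moreover have "cross h g \<noteq> 0" using arc_set_cross[OF hg(1)] by simp
  ultimately have "map (hyp_reflection p q) (mirror_pent h g) = pent h g" using reflect_mirror_pent by simp
  then have "consecutive_vertices Q' (pent h g)"
    using consecutive_vertices_map[OF hg(3), of "hyp_reflection p q"] by (simp only: Q(1))
  moreover have "{dir h, dir g} \<in> \<Union> (sides ` pentagons k)"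
    unfolding hg(2)[symmetric] by (rule UN_I[of Q _ _ sides, OF Q(2,3)])
  ultimately show "\<exists>h g. (h, g) \<in> arc_set k \<and> consecutive_vertices Q' (pent h g) \<and> {dir h, dir g} \<in> \<Union> (sides ` pentagons k)"
    using hg(1) by (intro exI[of _ h] exI[of _ g]) simp
  show "length Q' = 5" using outer(1) Q(1) by simp
qed

lemma sides_pent:
  "sides (pent h g) = insert {dir h, dir g} ((\<lambda>(h', g'). {dir h', dir g'}) ` sub_arcs (h, g))"
  unfolding pent_def list.map sides_five sub_arcs_def by (simp add: insert_commute)

lemma outer_arcs: "outer_arcs k"
proof (induction k)
  case 0 show ?case by (rule outer_arcs_0)
next
  case (Suc k)
  show ?case
    unfolding outer_arcs_def
  proof (intro ballI conjI allI impI)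
    fix Q assume Q: "Q \<in> pentagons (Suc k)"
    show 5: "length Q = 5" by (rule pentagon_Suc_form(1)[OF Suc Q])
    obtain h g where hg: "(h, g) \<in> arc_set k" "consecutive_vertices Q (pent h g)" "{dir h, dir g} \<in> \<Union> (sides ` pentagons k)"
      using pentagon_Suc_form(2)[OF Suc Q] by (elim exE conjE) (rule that)
    fix p q assume pq: "{p, q} \<in> sides Q" "0 < Suc k \<longrightarrow> {p, q} \<notin> \<Union> (sides ` pentagons (Suc k - 1))"
    have "{dir h, dir g} \<in> \<Union> (sides ` pentagons (Suc k - 1))" using hg(3) by simp
    then have "{p, q} \<noteq> {dir h, dir g}" using mp[OF pq(2) zero_less_Suc] by metis
    moreover have "{p, q} \<in> sides (pent h g)" using consecutive_vertices_sides(1)[OF 5 hg(2)] pq(1) by simp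
    ultimately have "{p, q} \<in> (\<lambda>(h', g'). {dir h', dir g'}) ` sub_arcs (h, g)"
      unfolding sides_pent by (simp only: insert_iff simp_thms)
    then obtain x where x: "x \<in> sub_arcs (h, g)" "{p, q} = {dir (fst x), dir (snd x)}"
      by (elim imageE) (simp only: case_prod_beta)
    define h' g' where "h' = fst x" and "g' = snd x"
    have h': "(h', g') \<in> sub_arcs (h, g)" "{p, q} = {dir h', dir g'}"
      using x by (simp_all only: h'_def g'_def prod.collapse)
    have "(h', g') \<in> arc_set (Suc k)" using h'(1) hg(1) unfolding arc_set_Suc by blast
    moreover have "consecutive_vertices Q (mirror_pent h' g')"
      using mirror_pent_sub_arc[OF h'(1)] consecutive_vertices_trans[OF hg(2)] by simp
    ultimately show "\<exists>h g. (h, g) \<in> arc_set (Suc k) \<and> {p, q} = {dir h, dir g} \<and> consecutive_vertices Q (mirror_pent h g)"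
      using h'(2) by (intro exI conjI)
  qed
qed

lemma vertices_fan_list: "Q \<in> pentagons k \<Longrightarrow> set Q \<subseteq> dir ` set (fan_list k)"
proof (cases k)
  case 0
  assume "Q \<in> pentagons k"
  then have "Q = map side_direction [1, 2, 3, 4, 5]" using 0 by simp
  then show ?thesis unfolding side_direction_x0 0 fan_list_0 by auto
next
  case (Suc j)
  assume Q: "Q \<in> pentagons k"
  obtain h g where hg: "(h, g) \<in> arc_set j" "consecutive_vertices Q (pent h g)"
    using pentagon_Suc_form(2)[OF outer_arcs Q[unfolded Suc]] by (elim exE conjE) (rule that)
  \<comment> \<open>The end \<open>x\<^sub>0 5\<close> of the last arc is not in the list, but its
    direction is that of \<open>x\<^sub>0 0\<close>.\<close>
  have l: "dir (x\<^sub>0 5) \<in> dir ` set (fan_list i)" for i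
  proof -
    have "x\<^sub>0 0 \<in> set (fan_list i)"
      by (induction i) (use set_refine in \<open>auto simp: fan_list_0 fan_list_Suc\<close>)
    then show ?thesis using dir_x0_period[of 0] by (metis add_0 imageI)
  qed
  have "h \<in> set (fan_list k)" "g \<in> insert (x\<^sub>0 5) (set (fan_list k))"
    using arcs_subset[OF hg(1)[unfolded arc_set_def]] set_refine unfolding Suc fan_list_Suc by blast+
  then have "dir h \<in> dir ` set (fan_list k)" "dir g \<in> dir ` set (fan_list k)" using l by auto
  moreover have "{phi *\<^sub>R h + g, phi *\<^sub>R h + phi *\<^sub>R g, h + phi *\<^sub>R g} \<subseteq> set (fan_list k)"
    using mids_refine[OF hg(1)[unfolded arc_set_def]] unfolding Suc fan_list_Suc .
  ultimately have "set (pent h g) \<subseteq> dir ` set (fan_list k)" unfolding pent_def by auto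
  then show ?thesis
    using consecutive_vertices_sides(2)[OF pentagon_Suc_form(1)[OF outer_arcs Q[unfolded Suc]] hg(2)] by simp
qed

section \<open>The formulas for the new vertices\<close>

text \<open>Each new vertex is an end of one of the new tables, whose words agree with the stated
  ones up to cyclic rotation.\<close>

lemma table_words:
  assumes t: "table h g a A b B"
  defines "\<sigma> \<equiv> map side_label"
  shows "short_orbit (dir h) = cyclic_word (\<sigma> a)" "long_orbit (dir h) = cyclic_word (\<sigma> A)"
    "short_orbit (dir g) = cyclic_word (\<sigma> b)" "long_orbit (dir g) = cyclic_word (\<sigma> B)"
    "short_orbit (dir (phi *\<^sub>R h + g)) = cyclic_word (\<sigma> b @ \<sigma> A)"
    "long_orbit (dir (phi *\<^sub>R h + g)) = cyclic_word (\<sigma> B @ \<sigma> a @ \<sigma> A)"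
    "short_orbit (dir (phi *\<^sub>R h + phi *\<^sub>R g)) = cyclic_word (\<sigma> A @ \<sigma> B)"
    "long_orbit (dir (phi *\<^sub>R h + phi *\<^sub>R g)) = cyclic_word (\<sigma> b @ \<sigma> B @ \<sigma> a @ \<sigma> A)"
    "short_orbit (dir (h + phi *\<^sub>R g)) = cyclic_word (\<sigma> a @ \<sigma> B)"
    "long_orbit (dir (h + phi *\<^sub>R g)) = cyclic_word (\<sigma> A @ \<sigma> b @ \<sigma> B)"
proof -
  note c = cyclic_word_append_commute
  show "short_orbit (dir h) = cyclic_word (\<sigma> a)" "long_orbit (dir h) = cyclic_word (\<sigma> A)"
    "short_orbit (dir g) = cyclic_word (\<sigma> b)" "long_orbit (dir g) = cyclic_word (\<sigma> B)"
    unfolding \<sigma>_def by (rule table_orbits[OF t])+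
  show "short_orbit (dir (phi *\<^sub>R h + g)) = cyclic_word (\<sigma> b @ \<sigma> A)"
    using table_orbits(3)[OF table_step(1)[OF t]] c[of "\<sigma> b" "\<sigma> A"] by (simp add: \<sigma>_def)
  show "long_orbit (dir (phi *\<^sub>R h + g)) = cyclic_word (\<sigma> B @ \<sigma> a @ \<sigma> A)"
    using table_orbits(4)[OF table_step(1)[OF t]] c[of "\<sigma> B @ \<sigma> a" "\<sigma> A"] by (simp add: \<sigma>_def)
  show "short_orbit (dir (phi *\<^sub>R h + phi *\<^sub>R g)) = cyclic_word (\<sigma> A @ \<sigma> B)"
    using table_orbits(1)[OF table_step(3)[OF t]] by (simp add: \<sigma>_def)
  show "long_orbit (dir (phi *\<^sub>R h + phi *\<^sub>R g)) = cyclic_word (\<sigma> b @ \<sigma> B @ \<sigma> a @ \<sigma> A)"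
    using table_orbits(2)[OF table_step(3)[OF t]] c[of "\<sigma> b @ \<sigma> B @ \<sigma> a" "\<sigma> A"] by (simp add: \<sigma>_def)
  show "short_orbit (dir (h + phi *\<^sub>R g)) = cyclic_word (\<sigma> a @ \<sigma> B)"
    using table_orbits(1)[OF table_step(4)[OF t]] c[of "\<sigma> a" "\<sigma> B"] by (simp add: \<sigma>_def)
  show "long_orbit (dir (h + phi *\<^sub>R g)) = cyclic_word (\<sigma> A @ \<sigma> b @ \<sigma> B)"
    using table_orbits(2)[OF table_step(4)[OF t]] c[of "\<sigma> B" "\<sigma> A @ \<sigma> b"] by (simp add: \<sigma>_def)
qed

definition orbit_words :: "complex \<Rightarrow> complex \<Rightarrow> complex \<Rightarrow> complex \<Rightarrow> complex \<Rightarrow>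
    nat list \<Rightarrow> nat list \<Rightarrow> nat list \<Rightarrow> nat list \<Rightarrow> bool" where
  "orbit_words p r\<^sub>1 r\<^sub>2 r\<^sub>3 q a A b B \<longleftrightarrow>
    cyclic_word a = short_orbit p \<and> cyclic_word A = long_orbit p \<and>
    cyclic_word b = short_orbit q \<and> cyclic_word B = long_orbit q \<and>
    short_orbit r\<^sub>1 = cyclic_word (b @ A) \<and> long_orbit r\<^sub>1 = cyclic_word (B @ a @ A) \<and>
    short_orbit r\<^sub>2 = cyclic_word (A @ B) \<and> long_orbit r\<^sub>2 = cyclic_word (b @ B @ a @ A) \<and>
    short_orbit r\<^sub>3 = cyclic_word (a @ B) \<and> long_orbit r\<^sub>3 = cyclic_word (A @ b @ B)"

text \<open>Exchanging the two ends swaps the formulas for the outer vertices, and the words of the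
  middle vertex are only rotated cyclically.\<close>

lemma orbit_words_swap:
  assumes "orbit_words p r\<^sub>1 r\<^sub>2 r\<^sub>3 q a A b B"
  shows "orbit_words q r\<^sub>3 r\<^sub>2 r\<^sub>1 p b B a A"
  using assms cyclic_word_append_commute[of A B] cyclic_word_append_commute[of "b @ B" "a @ A"]
  unfolding orbit_words_def by simp

lemma has_table_words:
  assumes "has_table h g"
  shows "\<exists>a A b B. orbit_words (dir h) (dir (phi *\<^sub>R h + g)) (dir (phi *\<^sub>R h + phi *\<^sub>R g)) (dir (h + phi *\<^sub>R g)) (dir g) a A b B"
proof -
  have *: "orbit_words (dir h) (dir (phi *\<^sub>R h + g)) (dir (phi *\<^sub>R h + phi *\<^sub>R g)) (dir (h + phi *\<^sub>R g)) (dir g)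
      (map side_label a) (map side_label A) (map side_label b) (map side_label B)" if "table h g a A b B" for h g a A b B
    unfolding orbit_words_def by (intro conjI; rule table_words[OF that] table_words[OF that, symmetric])
  obtain a A b B where "table h g a A b B \<or> table (- h) (- g) a A b B"
    using assms unfolding has_table_def by blast
  then show ?thesis
  proof
    assume "table h g a A b B"
    from *[OF this] show ?thesis by blast
  next
    assume "table (- h) (- g) a A b B"
    from *[OF this] have "orbit_words (dir (- h)) (dir (- (phi *\<^sub>R h + g))) (dir (- (phi *\<^sub>R h + phi *\<^sub>R g))) (dir (- (h + phi *\<^sub>R g))) (dir (- g))
      (map side_label a) (map side_label A) (map side_label b) (map side_label B)"
      by (simp add: algebra_simps)
    then show ?thesis unfolding dir_minus by blast
  qed
qed

lemma sides_subset: "{p, q} \<in> sides Q \<Longrightarrow> p \<in> set Q \<and> q \<in> set Q"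
proof -
  assume "{p, q} \<in> sides Q"
  then obtain i where i: "i < length Q" "{p, q} = {Q ! i, Q ! (Suc i mod length Q)}"
    unfolding sides_def by blast
  then have "{p, q} \<subseteq> set Q" by (metis empty_subsetI insert_subset mod_less_divisor nth_mem gr_implies_not0 not_gr0)
  then show ?thesis by simp
qed

text \<open>Every side of the new pentagon other than the reflecting one has an end strictly inside
  the arc, where no vertex of generation \<open>k\<close> lies.\<close>

lemma common_side:
  assumes Q: "Q \<in> pentagons k" "{p, q} \<in> sides Q"
    and hg: "(h, g) \<in> arc_set k" and pq: "{p, q} \<in> sides (pent h g)"
  shows "{p, q} = {dir h, dir g}"
proof (rule ccontr)
  assume "{p, q} \<noteq> {dir h, dir g}"
  have old: "{p, q} \<subseteq> dir ` set (fan_list k)"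
    using sides_subset[OF Q(2)] vertices_fan_list[OF Q(1)] by blast
  have new: "dir w \<notin> {p, q}" if w: "w = x *\<^sub>R h + y *\<^sub>R g" "x > 0" "y > 0" for w x y
  proof
    assume "dir w \<in> {p, q}"
    then obtain v where v: "v \<in> set (fan_list k)" "dir v = dir w" using old by (metis imageE subsetD)
    have c: "cross v w \<noteq> 0"
      unfolding w(1) by (rule fan_not_in_arc[OF fan_fan_list hg[unfolded arc_set_def] v(1) w(2,3)])
    then have "v \<noteq> 0" "w \<noteq> 0" by auto
    with c v(2) show False by (simp add: dir_eq_iff)
  qed
  have n: "dir (phi *\<^sub>R h + g) \<notin> {p, q}" "dir (phi *\<^sub>R h + phi *\<^sub>R g) \<notin> {p, q}" "dir (h + phi *\<^sub>R g) \<notin> {p, q}"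
    by (rule new[where x = phi and y = 1] new[where x = phi and y = phi] new[where x = 1 and y = phi];
      simp add: phi_pos)+
  have "{p, q} \<in> {{dir h, dir (phi *\<^sub>R h + g)}, {dir (phi *\<^sub>R h + g), dir (phi *\<^sub>R h + phi *\<^sub>R g)},
      {dir (phi *\<^sub>R h + phi *\<^sub>R g), dir (h + phi *\<^sub>R g)}, {dir (h + phi *\<^sub>R g), dir g}, {dir g, dir h}}"
    using pq unfolding pent_def list.map sides_five .
  with n \<open>{p, q} \<noteq> {dir h, dir g}\<close> show False
    unfolding insert_iff empty_iff by (elim disjE FalseE) (auto simp: doubleton_eq_iff)
qed

lemma distinct_pent:
  assumes "cross h g > 0"
  shows "distinct (pent h g)"
proof -
  have c: "cross g h = - cross h g" by (simp add: cross_def)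
  have ne: "dir v \<noteq> dir w" if "cross v w \<noteq> 0" for v w
  proof -
    have "v \<noteq> 0" "w \<noteq> 0" using that by auto
    then show ?thesis using that by (simp add: dir_eq_iff)
  qed
  have "cross h (phi *\<^sub>R h + g) > 0" "cross h (phi *\<^sub>R h + phi *\<^sub>R g) > 0" "cross h (h + phi *\<^sub>R g) > 0"
    "cross (phi *\<^sub>R h + g) (phi *\<^sub>R h + phi *\<^sub>R g) > 0" "cross (phi *\<^sub>R h + g) (h + phi *\<^sub>R g) > 0"
    "cross (phi *\<^sub>R h + phi *\<^sub>R g) (h + phi *\<^sub>R g) > 0"
    "cross (phi *\<^sub>R h + g) g > 0" "cross (phi *\<^sub>R h + phi *\<^sub>R g) g > 0" "cross (h + phi *\<^sub>R g) g > 0"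
    using assms phi_bounds by (simp_all add: cross_linear c algebra_simps)
  then have "\<forall>(v, w)\<in>{(h, phi *\<^sub>R h + g), (h, phi *\<^sub>R h + phi *\<^sub>R g), (h, h + phi *\<^sub>R g), (h, g),
      (phi *\<^sub>R h + g, phi *\<^sub>R h + phi *\<^sub>R g), (phi *\<^sub>R h + g, h + phi *\<^sub>R g), (phi *\<^sub>R h + g, g),
      (phi *\<^sub>R h + phi *\<^sub>R g, h + phi *\<^sub>R g), (phi *\<^sub>R h + phi *\<^sub>R g, g), (h + phi *\<^sub>R g, g)}. dir v \<noteq> dir w"
    using assms ne by simp
  then show ?thesis unfolding pent_def by simp
qed

lemma consecutive_vertices_endpoints:
  assumes "distinct [a, b, c, d, e]" "consecutive_vertices [a, b, c, d, e] [p, r\<^sub>1, r\<^sub>2, r\<^sub>3, q]" "{p, q} = {a, e}"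
  shows "[p, r\<^sub>1, r\<^sub>2, r\<^sub>3, q] = [a, b, c, d, e] \<or> [p, r\<^sub>1, r\<^sub>2, r\<^sub>3, q] = [e, d, c, b, a]"
  using assms unfolding consecutive_vertices_five insert_iff empty_iff
  by (elim disjE FalseE) (simp_all add: doubleton_eq_iff)

theorem theorem3:
  fixes k :: nat and Q Q' :: "complex list" and p q r\<^sub>1 r\<^sub>2 r\<^sub>3 :: complex
  assumes "Q \<in> pentagons k" and "{p, q} \<in> sides Q"
    and "Q' \<in> pentagons (Suc k)" and "{p, q} \<in> sides Q'"
    and "consecutive_vertices Q' [p, r\<^sub>1, r\<^sub>2, r\<^sub>3, q]"
  shows "\<exists>a A b B :: nat list.
    cyclic_word a = short_orbit p \<and> cyclic_word A = long_orbit p \<and>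
    cyclic_word b = short_orbit q \<and> cyclic_word B = long_orbit q \<and>
    short_orbit r\<^sub>1 = cyclic_word (b @ A) \<and> long_orbit r\<^sub>1 = cyclic_word (B @ a @ A) \<and>
    short_orbit r\<^sub>2 = cyclic_word (A @ B) \<and> long_orbit r\<^sub>2 = cyclic_word (b @ B @ a @ A) \<and>
    short_orbit r\<^sub>3 = cyclic_word (a @ B) \<and> long_orbit r\<^sub>3 = cyclic_word (A @ b @ B)"
proof -
  note form = pentagon_Suc_form[OF outer_arcs assms(3)]
  obtain h g where hg: "(h, g) \<in> arc_set k" and Q': "consecutive_vertices Q' (pent h g)"
    using form(2) by (elim exE conjE) (rule that)
  have "{p, q} \<in> sides (pent h g)" using assms(4) consecutive_vertices_sides(1)[OF form(1) Q'] by simp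
  with assms(1,2) hg have pq: "{p, q} = {dir h, dir g}" by (rule common_side)
  have vs: "consecutive_vertices (pent h g) [p, r\<^sub>1, r\<^sub>2, r\<^sub>3, q]"
    using assms(5) consecutive_vertices_trans[OF Q'] by simp
  obtain a A b B where w: "orbit_words (dir h) (dir (phi *\<^sub>R h + g)) (dir (phi *\<^sub>R h + phi *\<^sub>R g)) (dir (h + phi *\<^sub>R g)) (dir g) a A b B"
    using has_table_words[OF arc_set_table[OF hg]] by blast
  \<comment> \<open>The ends of the arc are known only as an unordered pair, so the list may run in
    either sense; the reversed sense is covered by the symmetry of the formulas.\<close>
  have "[p, r\<^sub>1, r\<^sub>2, r\<^sub>3, q] = pent h g \<or> [p, r\<^sub>1, r\<^sub>2, r\<^sub>3, q] = rev (pent h g)"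
    using consecutive_vertices_endpoints[OF _ _ pq] distinct_pent[OF arc_set_cross[OF hg]] vs
    unfolding pent_def by simp
  then have "\<exists>a A b B. orbit_words p r\<^sub>1 r\<^sub>2 r\<^sub>3 q a A b B"
    using w orbit_words_swap[OF w] unfolding pent_def by auto
  then show ?thesis unfolding orbit_words_def .
qed

end
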